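(* Let $N\ge2$ and $q\in\{2,3,4,\dots\}$. There is no nontrivial (i.e. not identically zero) quasimonochromatic breather $u$ of $$\partial_tu+\partial_{x_1}(\Delta u+2u^q)=0$$ (in the sense defined in the context) whose profile $F$ is real analytic in a neighborhood of $0$ with $F(0)=0$.
   Context: Here $t\in\mathbb R$, $x=(x_1,\dots,x_N)\in\mathbb R^N$, $\Delta=\sum_{j=1}^N\partial_{x_j}^2$. A function $u:\mathbb R\times\mathbb R^N\to\mathbb R$ is a quasimonochromatic breather of the equation if it is a smooth solution of it of the form $$u(t,x)=\partial_{x_1}\big(F(p(x)\sin(2\alpha(x_1+mt)))\big),$$ where $m\in\mathbb R$, $\alpha>0$, and $F\in C^\infty(\mathbb R)$, $p\in C^2(\mathbb R^N)$ are nontrivial functions such that $F(0)=0$ and $p(x),\nabla p(x),D^2p(x)\to0$ as $|x|\to\infty$. It is called trivial if $u\equiv0$. *)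

theory Defs
  imports "HOL-Analysis.Analysis"
begin

definition dir_deriv :: "'a::real_normed_vector \<Rightarrow> ('a \<Rightarrow> real) \<Rightarrow> 'a \<Rightarrow> real" where
  "dir_deriv v f x = frechet_derivative f (at x) v"

(* A class C^k function on the whole space: differentiable with all first-order partial
   derivatives of class C^(k-1).  For f :: real => real the only basis vector is 1. *)
primrec of_class_C :: "nat \<Rightarrow> ('a::euclidean_space \<Rightarrow> real) \<Rightarrow> bool" where
  "of_class_C 0 f \<longleftrightarrow> continuous_on UNIV f"
| "of_class_C (Suc k) f \<longleftrightarrow>
     (\<forall>x. f differentiable (at x)) \<and> (\<forall>b\<in>Basis. of_class_C k (dir_deriv b f))"

definition smooth :: "('a::euclidean_space \<Rightarrow> real) \<Rightarrow> bool" where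
  "smooth f \<longleftrightarrow> (\<forall>k. of_class_C k f)"

definition real_analytic_on :: "(real \<Rightarrow> real) \<Rightarrow> real set \<Rightarrow> bool" where
  "real_analytic_on f S \<longleftrightarrow>
     (\<forall>x\<in>S. \<exists>r>0. \<exists>a. \<forall>y. \<bar>y - x\<bar> < r \<longrightarrow> (\<lambda>n. a n * (y - x) ^ n) sums f y)"

definition real_analytic_near :: "(real \<Rightarrow> real) \<Rightarrow> real \<Rightarrow> bool" where
  "real_analytic_near f x \<longleftrightarrow> (\<exists>U. open U \<and> x \<in> U \<and> real_analytic_on f U)"

definition d_t :: "(real \<times> (real ^ 'n) \<Rightarrow> real) \<Rightarrow> real \<times> (real ^ 'n::finite) \<Rightarrow> real" where
  "d_t = dir_deriv (1, 0)"

definition d_x :: "'n::finite \<Rightarrow> (real \<times> (real ^ 'n) \<Rightarrow> real) \<Rightarrow> real \<times> (real ^ 'n) \<Rightarrow> real" where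
  "d_x j = dir_deriv (0, axis j 1)"

definition laplace_x :: "(real \<times> (real ^ 'n::finite) \<Rightarrow> real) \<Rightarrow> real \<times> (real ^ 'n) \<Rightarrow> real" where
  "laplace_x u z = (\<Sum>j\<in>UNIV. d_x j (d_x j u) z)"

(* The index type 'n has no canonical first element, so the index e of the distinguished
   coordinate x_1 is a parameter here and below. *)
definition smooth_solution :: "'n::finite \<Rightarrow> nat \<Rightarrow> (real \<times> (real ^ 'n) \<Rightarrow> real) \<Rightarrow> bool" where
  "smooth_solution e q u \<longleftrightarrow>
     smooth u \<and> (\<forall>z. d_t u z + d_x e (\<lambda>w. laplace_x u w + 2 * u w ^ q) z = 0)"

definition admissible_amplitude :: "(real ^ 'n::finite \<Rightarrow> real) \<Rightarrow> bool" where
  "admissible_amplitude p \<longleftrightarrow>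
     of_class_C 2 p \<and> (\<exists>x. p x \<noteq> 0) \<and>
     (p \<longlongrightarrow> 0) at_infinity \<and>
     (\<forall>b\<in>Basis. (dir_deriv b p \<longlongrightarrow> 0) at_infinity) \<and>
     (\<forall>b\<in>Basis. \<forall>c\<in>Basis. (dir_deriv b (dir_deriv c p) \<longlongrightarrow> 0) at_infinity)"

definition breather_with_profile ::
    "'n::finite \<Rightarrow> nat \<Rightarrow> (real \<Rightarrow> real) \<Rightarrow> (real \<times> (real ^ 'n) \<Rightarrow> real) \<Rightarrow> bool" where
  "breather_with_profile e q F u \<longleftrightarrow>
     smooth_solution e q u \<and>
     smooth F \<and> (\<exists>s. F s \<noteq> 0) \<and> F 0 = 0 \<and>
     (\<exists>m \<alpha> p. \<alpha> > 0 \<and> admissible_amplitude p \<and>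
        u = d_x e (\<lambda>(t, x). F (p x * sin (2 * \<alpha> * (x $ e + m * t)))))"

end

theory Submission
  imports Defs
begin

text \<open>Write \<theta> = 2 \<alpha> (x_1 + m t), s = p sin \<theta> and G = F'. The breather is u = G(s) (\<partial>_1 p sin \<theta> + 2 \<alpha> p cos \<theta>),
which tends to 0 as |x| \<rightarrow> \<infinity>. The evolution equation says that the x_1-derivative of
  2 \<alpha> m G(s) p cos \<theta> + \<Delta>u + 2 u^q
vanishes. So this expression is constant on lines parallel to the x_1-axis, and the constant is 0: far out on such a line
u and the first and last terms are small, and a small function cannot have a Laplacian bounded away from 0, with
constant sign, on a ball of fixed radius (profile_equation). Three cases remain.

Stationary breathers, m = 0. Then \<Delta>u + V u = 0 with V = 2 u^(q-1) \<rightarrow> 0 at infinity. Since F(s) = 0 wherever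
sin \<theta> = 0, Rolle's theorem gives a zero of u on every segment in the x_1-direction of length \<pi>/\<alpha>. These zeros yield a
Poincare inequality relative to every weight that is constant in the x_1-direction. It is combined with a Carleman estimate
for a wide Gaussian in x_1 whose centre lies far out, where V is small. Far from the centre the logarithmic slope of
the Gaussian is large, and the first-order part of the conjugated Laplacian dominates V; near the centre V
is already small compared with the Poincare constant. Both together force u = 0, whatever the rate of decay of u
(vanishing_of_line_zeros, stationary_vanishes).

Moving breathers, m \<noteq> 0, whose profile vanishes on a neighbourhood of 0. Then u vanishes near the hyperplanes
sin \<theta> = 0 of space-time. In the slab between two consecutive ones u has compact support, because there |t| \<rightarrow> \<infinity>
forces |x| \<rightarrow> \<infinity>. The integral of u^2 over a time slice of the slab is conserved and vanishes for large |t|, so u = 0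
(flat_profile_vanishes).

Moving breathers with F(s) = a_k s^k + ..., a_k \<noteq> 0, k \<ge> 1. For a fixed x every \<theta> is attained at some time, so the
integrated equation is an identity in \<theta> whose coefficients are derivatives of p at x (profile_identity). If
k \<ge> 3, its leading term as \<theta> \<rightarrow> 0 is 8 \<alpha>^3 k (k-1) (k-2) a_k p^k \<theta>^(k-3), which forces p = 0 (no_high_order_zero). If k \<le> 2, adding the
identities at \<theta> = 0 and \<theta> = \<pi> shows that p \<partial>_1 p has a constant sign, so that p^2 is monotone on lines and cannot decay
at both ends; the only exception is q odd, k = 1 and F''(0) = 0. In this exceptional case p is smooth, because p(x) is a
multiple of u(-x_1/m, x). The identity at \<theta> = 0 expresses \<Delta>p + 2 \<partial>_1\<partial>_1 p, and the part of its \<theta>-derivative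
that changes sign between \<theta> = 0 and \<theta> = \<pi> expresses \<partial>_1 \<Delta>p, by p and \<partial>_1 p. In a suitable combination both \<Delta>p and the power p^q cancel. What is left is an
ordinary differential equation in x_1, and two integrations give (\<partial>_1 p)^2 = p^2 (K p^2 - M) (amplitude_ode). Hence p^2 takes its
maximum M/K, the same number for all lines, on every x_1-line on which p is not identically 0. The union of these
lines is open and closed, hence it is the whole space. In at least two dimensions there are such lines arbitrarily far from
the origin, which contradicts the decay of p (first_integral_contradiction).\<close>


section \<open>Partial derivatives along lines\<close>

text \<open>Everything below only involves derivatives along lines, and frequently of functions that are not known to be
differentiable in the Frechet sense. Working with the one-variable derivative at 0 also makes the rules of
one-variable calculus directly applicable.\<close>

definition has_pderiv :: "('a::real_normed_vector \<Rightarrow> real) \<Rightarrow> 'a \<Rightarrow> ('a \<Rightarrow> real) \<Rightarrow> bool" where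
  "has_pderiv f b f' \<longleftrightarrow> (\<forall>x. ((\<lambda>r. f (x + r *\<^sub>R b)) has_real_derivative f' x) (at 0))"

lemma has_pderivD: "has_pderiv f b f' \<Longrightarrow> ((\<lambda>r. f (x + r *\<^sub>R b)) has_real_derivative f' x) (at 0)"
  by (simp add: has_pderiv_def)

lemma has_pderiv_line:
  assumes "has_pderiv f b f'"
  shows "((\<lambda>r. f (x + r *\<^sub>R b)) has_real_derivative f' (x + r *\<^sub>R b)) (at r)"
proof -
  have "((\<lambda>h. f ((x + r *\<^sub>R b) + h *\<^sub>R b)) has_real_derivative f' (x + r *\<^sub>R b)) (at 0)"
    using assms by (rule has_pderivD)
  then have "((\<lambda>h. f (x + (h + r) *\<^sub>R b)) has_real_derivative f' (x + r *\<^sub>R b)) (at 0)"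
    by (simp add: algebra_simps)
  then show ?thesis
    using DERIV_shift[of "\<lambda>h. f (x + h *\<^sub>R b)" "f' (x + r *\<^sub>R b)" 0 r] by simp
qed

lemma has_pderiv_unique: "has_pderiv f b f' \<Longrightarrow> has_pderiv f b f'' \<Longrightarrow> f' = f''"
  by (auto simp: has_pderiv_def fun_eq_iff intro: DERIV_unique)

lemma frechet_has_pderiv:
  assumes "\<And>x. f differentiable (at x)"
  shows "has_pderiv f v (dir_deriv v f)"
  unfolding has_pderiv_def
proof
  fix x
  have "(f has_derivative frechet_derivative f (at x)) (at (x + 0 *\<^sub>R v))"
    using assms[of x] by (simp add: frechet_derivative_works)
  moreover have "((\<lambda>r. x + r *\<^sub>R v) has_derivative (\<lambda>r. r *\<^sub>R v)) (at 0)"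
    by (auto intro!: derivative_eq_intros)
  ultimately have d: "((\<lambda>r. f (x + r *\<^sub>R v)) has_derivative (\<lambda>r. frechet_derivative f (at x) (r *\<^sub>R v))) (at 0)"
    by (rule has_derivative_compose[rotated])
  have "linear (frechet_derivative f (at x))"
    using assms[of x] by (rule linear_frechet_derivative)
  then have "(\<lambda>r. frechet_derivative f (at x) (r *\<^sub>R v)) = (*) (dir_deriv v f x)"
    by (auto simp: dir_deriv_def linear_cmul)
  with d show "((\<lambda>r. f (x + r *\<^sub>R v)) has_real_derivative dir_deriv v f x) (at 0)"
    by (simp add: has_field_derivative_def)
qed

lemma of_class_C_pderiv: "of_class_C (Suc k) f \<Longrightarrow> has_pderiv f v (dir_deriv v f)"
  by (rule frechet_has_pderiv) simp

lemma of_class_C_dir_deriv: "of_class_C (Suc k) f \<Longrightarrow> b \<in> Basis \<Longrightarrow> of_class_C k (dir_deriv b f)"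
  by simp

lemma of_class_C_continuous: "of_class_C k f \<Longrightarrow> continuous_on UNIV f"
  by (cases k) (auto simp: continuous_on_eq_continuous_at differentiable_imp_continuous_within)

lemma of_class_C_Suc_imp: "of_class_C (Suc k) f \<Longrightarrow> of_class_C k f"
proof (induction k arbitrary: f)
  case 0
  then show ?case using of_class_C_continuous[OF 0] by simp
next
  case (Suc k)
  then show ?case by (simp add: of_class_C.simps(2))
qed

lemma eventually_line_in_open:
  fixes x b :: "'a::real_normed_vector"
  assumes "open N" "x \<in> N"
  shows "eventually (\<lambda>r. x + r *\<^sub>R b \<in> N) (nhds 0)"
proof -
  have "open ((\<lambda>r. x + r *\<^sub>R b) -` N)"
    by (intro open_vimage assms continuous_intros)
  then show ?thesis
    using eventually_nhds_in_open[of "(\<lambda>r. x + r *\<^sub>R b) -` N" 0] assms(2) by simp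
qed

lemma has_pderiv_zero_on_open:
  assumes N: "open N" "x \<in> N" "\<And>y. y \<in> N \<Longrightarrow> g y = 0" and d: "has_pderiv g b g'"
  shows "g' x = 0"
proof -
  have "eventually (\<lambda>r. g (x + r *\<^sub>R b) = 0) (nhds 0)"
    using eventually_line_in_open[OF N(1,2)] by eventually_elim (use N in auto)
  then have "((\<lambda>r. g (x + r *\<^sub>R b)) has_real_derivative 0) (at 0) \<longleftrightarrow> ((\<lambda>r. 0::real) has_real_derivative 0) (at 0)"
    by (intro DERIV_cong_ev) auto
  then show ?thesis using has_pderivD[OF d, of x] DERIV_unique by fastforce
qed

text \<open>The second difference over a parallelogram is symmetric in its two directions. Two applications of the mean value
theorem turn it into a mixed derivative at an intermediate point; this is the source of the symmetry of mixed derivatives below.\<close>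

lemma second_difference_mvt:
  fixes f :: "'a::real_normed_vector \<Rightarrow> real"
  assumes fa: "has_pderiv f a fa" and fab: "has_pderiv fa b fab" and h: "h > 0"
  obtains r s where "0 < r" "r < h" "0 < s" "s < h"
    "f (x + h *\<^sub>R a + h *\<^sub>R b) - f (x + h *\<^sub>R a) - f (x + h *\<^sub>R b) + f x = h * h * fab (x + r *\<^sub>R a + s *\<^sub>R b)"
proof -
  define g where "g r = f (x + h *\<^sub>R b + r *\<^sub>R a) - f (x + r *\<^sub>R a)" for r
  have "(g has_real_derivative fa (x + h *\<^sub>R b + r *\<^sub>R a) - fa (x + r *\<^sub>R a)) (at r)" for r
    unfolding g_def by (intro DERIV_diff has_pderiv_line fa)
  then obtain r where r: "0 < r" "r < h" "g h - g 0 = h * (fa (x + h *\<^sub>R b + r *\<^sub>R a) - fa (x + r *\<^sub>R a))"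
    using MVT2[OF h, of g "\<lambda>r. fa (x + h *\<^sub>R b + r *\<^sub>R a) - fa (x + r *\<^sub>R a)"] by auto
  have "((\<lambda>s. fa (x + r *\<^sub>R a + s *\<^sub>R b)) has_real_derivative fab (x + r *\<^sub>R a + s *\<^sub>R b)) (at s)" for s
    by (intro has_pderiv_line fab)
  then obtain s where s: "0 < s" "s < h"
     "fa (x + r *\<^sub>R a + h *\<^sub>R b) - fa (x + r *\<^sub>R a + 0 *\<^sub>R b) = h * fab (x + r *\<^sub>R a + s *\<^sub>R b)"
    using MVT2[OF h, of "\<lambda>s. fa (x + r *\<^sub>R a + s *\<^sub>R b)" "\<lambda>s. fab (x + r *\<^sub>R a + s *\<^sub>R b)"] by auto
  have "g h - g 0 = h * (h * fab (x + r *\<^sub>R a + s *\<^sub>R b))"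
    using r(3) s(3) by (simp add: algebra_simps)
  then have "f (x + h *\<^sub>R a + h *\<^sub>R b) - f (x + h *\<^sub>R a) - f (x + h *\<^sub>R b) + f x = h * h * fab (x + r *\<^sub>R a + s *\<^sub>R b)"
    unfolding g_def by (simp add: algebra_simps)
  then show thesis using that r s by blast
qed

lemma clairaut_pderiv:
  fixes f :: "'a::real_normed_vector \<Rightarrow> real"
  assumes fa: "has_pderiv f a fa" and fab: "has_pderiv fa b fab"
    and fb: "has_pderiv f b fb" and fba: "has_pderiv fb a fba"
    and c1: "isCont fab x" and c2: "isCont fba x"
  shows "fab x = fba x"
proof (rule ccontr)
  assume ne: "fab x \<noteq> fba x"
  define e where "e = \<bar>fab x - fba x\<bar> / 2"
  have e: "e > 0" using ne by (simp add: e_def)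
  obtain d1 where d1: "d1 > 0" "\<And>y. dist y x < d1 \<Longrightarrow> dist (fab y) (fab x) < e"
    using c1 e unfolding continuous_at_eps_delta by blast
  obtain d2 where d2: "d2 > 0" "\<And>y. dist y x < d2 \<Longrightarrow> dist (fba y) (fba x) < e"
    using c2 e unfolding continuous_at_eps_delta by blast
  define h where "h = min d1 d2 / (norm a + norm b + 1)"
  have np: "norm a + norm b + 1 > 0" by (smt (verit) norm_ge_zero)
  have h: "h > 0" using d1 d2 np by (simp add: h_def)
  have hd: "h * (norm a + norm b) < min d1 d2"
  proof -
    have "h * (norm a + norm b) < h * (norm a + norm b + 1)" using h by simp
    also have "\<dots> = min d1 d2" using np by (simp add: h_def)
    finally show ?thesis .
  qed
  have close: "dist (x + r *\<^sub>R a + s *\<^sub>R b) x < min d1 d2" if "0 < r" "r < h" "0 < s" "s < h" for r s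
  proof -
    have "dist (x + r *\<^sub>R a + s *\<^sub>R b) x = norm (r *\<^sub>R a + s *\<^sub>R b)" by (simp add: dist_norm)
    also have "\<dots> \<le> r * norm a + s * norm b" using that norm_triangle_ineq[of "r *\<^sub>R a" "s *\<^sub>R b"] by simp
    also have "\<dots> \<le> h * norm a + h * norm b" using that by (intro add_mono mult_right_mono) auto
    finally show ?thesis using hd by (simp add: algebra_simps)
  qed
  obtain r s where rs: "0 < r" "r < h" "0 < s" "s < h"
    "f (x + h *\<^sub>R a + h *\<^sub>R b) - f (x + h *\<^sub>R a) - f (x + h *\<^sub>R b) + f x = h * h * fab (x + r *\<^sub>R a + s *\<^sub>R b)"
    by (rule second_difference_mvt[OF fa fab h])
  obtain r' s' where rs': "0 < r'" "r' < h" "0 < s'" "s' < h"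
    "f (x + h *\<^sub>R b + h *\<^sub>R a) - f (x + h *\<^sub>R b) - f (x + h *\<^sub>R a) + f x = h * h * fba (x + r' *\<^sub>R b + s' *\<^sub>R a)"
    by (rule second_difference_mvt[OF fb fba h])
  have "h * h * fab (x + r *\<^sub>R a + s *\<^sub>R b) = h * h * fba (x + r' *\<^sub>R b + s' *\<^sub>R a)"
    using rs(5) rs'(5) by (simp add: algebra_simps)
  then have eq: "fab (x + r *\<^sub>R a + s *\<^sub>R b) = fba (x + r' *\<^sub>R b + s' *\<^sub>R a)" using h by simp
  have 1: "dist (fab (x + r *\<^sub>R a + s *\<^sub>R b)) (fab x) < e"
    using close[OF rs(1-4)] by (intro d1) simp
  have 2: "dist (fba (x + s' *\<^sub>R a + r' *\<^sub>R b)) (fba x) < e"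
    using close[OF rs'(3,4,1,2)] by (intro d2) simp
  have "x + s' *\<^sub>R a + r' *\<^sub>R b = x + r' *\<^sub>R b + s' *\<^sub>R a" by simp
  with 1 2 eq show False unfolding e_def dist_real_def by (smt (verit) field_sum_of_halves)
qed

lemma dir_deriv_commute:
  assumes "of_class_C (Suc (Suc k)) f" "a \<in> Basis" "b \<in> Basis"
  shows "dir_deriv a (dir_deriv b f) = dir_deriv b (dir_deriv a f)"
proof
  fix x
  have C: "of_class_C (Suc k) (dir_deriv c f)" if "c \<in> Basis" for c
    using assms(1) that by (rule of_class_C_dir_deriv)
  have cont: "isCont (dir_deriv c (dir_deriv d f)) x" if "c \<in> Basis" "d \<in> Basis" for c d
    using of_class_C_continuous[OF of_class_C_dir_deriv[OF C[OF that(2)] that(1)]]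
    by (simp add: continuous_on_eq_continuous_at)
  show "dir_deriv a (dir_deriv b f) x = dir_deriv b (dir_deriv a f) x"
    by (rule clairaut_pderiv[OF of_class_C_pderiv[OF assms(1)] of_class_C_pderiv[OF C]
          of_class_C_pderiv[OF assms(1)] of_class_C_pderiv[OF C]]) (use assms cont in auto)
qed

section \<open>The second derivative test for the Laplacian\<close>

lemma no_local_max_if_second_deriv_pos:
  fixes g g' :: "real \<Rightarrow> real"
  assumes g: "\<And>r. (g has_real_derivative g' r) (at r)"
    and g': "(g' has_real_derivative D) (at 0)" and D: "D > 0"
    and d: "d > 0" "\<And>r. \<bar>r\<bar> < d \<Longrightarrow> g r \<le> g 0"
  shows False
proof -
  have z: "g' 0 = 0"
    using DERIV_local_max[OF g d(1)] d(2) by simp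
  obtain c where c: "c > 0" "\<And>h. 0 < h \<Longrightarrow> h < c \<Longrightarrow> g' 0 < g' (0 + h)"
    using DERIV_pos_inc_right[OF g' D] by auto
  define h where "h = min c d / 2"
  have h: "0 < h" "h < c" "h < d" using c(1) d(1) by (auto simp: h_def min_def)
  obtain y where y: "0 < y" "y < h" "g h - g 0 = (h - 0) * g' y"
    using MVT2[OF h(1), of g g'] g by auto
  have "g' y > 0" using c(2)[of y] y h z by simp
  then have "h * g' y > 0" using h(1) by simp
  then have "g h > g 0" using y(3) by simp
  moreover have "g h \<le> g 0" using d(2)[of h] h by simp
  ultimately show False by simp
qed

lemma norm_sq_pderiv:
  fixes c :: "'a::euclidean_space"
  shows "((\<lambda>r. (norm (y + r *\<^sub>R b - c))\<^sup>2) has_real_derivative 2 * ((y + r *\<^sub>R b - c) \<bullet> b)) (at r)"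
proof -
  have "((\<lambda>r. (y + r *\<^sub>R b - c) \<bullet> (y + r *\<^sub>R b - c)) has_derivative (\<lambda>h. h * (2 * ((y + r *\<^sub>R b - c) \<bullet> b)))) (at r)"
    by (auto intro!: derivative_eq_intros simp: algebra_simps inner_commute)
  then show ?thesis
    by (simp add: has_field_derivative_def power2_norm_eq_inner mult_commute_abs)
qed

text \<open>If the inequality failed, f - l |x - c|^2 with a suitable l would have a positive Laplacian on the ball and an
interior maximum, which the second derivative test excludes in at least one coordinate direction. The lemma shows that the constant of integration in the integrated
equation is 0.\<close>

lemma laplacian_bound_by_sup:
  fixes f :: "'a::euclidean_space \<Rightarrow> real" and K B \<rho> :: real
  assumes f1: "\<And>b. b \<in> Basis \<Longrightarrow> has_pderiv f b (f1 b)"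
    and f2: "\<And>b. b \<in> Basis \<Longrightarrow> has_pderiv (f1 b) b (f2 b)"
    and cont: "continuous_on UNIV f"
    and \<rho>: "\<rho> > 0"
    and lap: "\<And>x. x \<in> cball c \<rho> \<Longrightarrow> K \<le> (\<Sum>b\<in>Basis. f2 b x)"
    and bnd: "\<And>x. x \<in> cball c \<rho> \<Longrightarrow> \<bar>f x\<bar> \<le> B"
  shows "K * \<rho>\<^sup>2 \<le> 4 * DIM('a) * B"
proof (rule ccontr)
  assume "\<not> K * \<rho>\<^sup>2 \<le> 4 * DIM('a) * B"
  then have "4 * DIM('a) * B < K * \<rho>\<^sup>2" by simp
  then have "2 * B / \<rho>\<^sup>2 < K / (2 * DIM('a))" using \<rho> by (simp add: field_simps)
  (* The lower bound on l keeps the maximum off the sphere, the upper bound keeps the Laplacian positive. *)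
  then obtain l where l: "2 * B / \<rho>\<^sup>2 < l" "l < K / (2 * DIM('a))" using dense by blast
  have l1: "2 * B < l * \<rho>\<^sup>2" using l(1) \<rho> by (simp add: field_simps)
  have l2: "2 * l * DIM('a) < K" using l(2) by (simp add: field_simps)
  define g where "g x = f x - l * (norm (x - c))\<^sup>2" for x
  have "continuous_on (cball c \<rho>) g"
    unfolding g_def by (intro continuous_intros continuous_on_subset[OF cont]) auto
  then obtain y where y: "y \<in> cball c \<rho>" "\<And>x. x \<in> cball c \<rho> \<Longrightarrow> g x \<le> g y"
    using continuous_attains_sup[of "cball c \<rho>" g] \<rho> by auto
  have ltr: "norm (y - c) < \<rho>"
  proof (rule ccontr)
    assume "\<not> norm (y - c) < \<rho>"
    then have "norm (y - c) = \<rho>" using y(1) by (simp add: dist_norm norm_minus_commute)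
    then have "g y \<le> B - l * \<rho>\<^sup>2" using bnd[OF y(1)] by (simp add: g_def)
    moreover have "g c \<ge> - B" using bnd[of c] \<rho> by (simp add: g_def)
    moreover have "g c \<le> g y" using y(2)[of c] \<rho> by simp
    ultimately show False using l1 by simp
  qed
  have "\<exists>b\<in>Basis. f2 b y > 2 * l"
  proof (rule ccontr)
    assume "\<not> ?thesis"
    then have "(\<Sum>b\<in>Basis. f2 b y) \<le> (\<Sum>b\<in>(Basis::'a set). 2 * l)" by (intro sum_mono) auto
    with lap[OF y(1)] l2 show False by (simp add: algebra_simps)
  qed
  then obtain b where b: "b \<in> Basis" "f2 b y > 2 * l" by blast
  show False
  proof (rule no_local_max_if_second_deriv_pos)
    fix r
    show "((\<lambda>r. g (y + r *\<^sub>R b)) has_real_derivative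
        f1 b (y + r *\<^sub>R b) - l * (2 * ((y + r *\<^sub>R b - c) \<bullet> b))) (at r)"
      unfolding g_def by (intro DERIV_diff DERIV_cmult norm_sq_pderiv has_pderiv_line f1 b)
  next
    have "(\<lambda>r. (y + r *\<^sub>R b - c) \<bullet> b) = (\<lambda>r. (y - c) \<bullet> b + r)"
      using b(1) by (auto simp: inner_add_left inner_diff_left)
    then have "((\<lambda>r. (y + r *\<^sub>R b - c) \<bullet> b) has_real_derivative 1) (at 0)"
      by (auto intro!: derivative_eq_intros)
    then show "((\<lambda>r. f1 b (y + r *\<^sub>R b) - l * (2 * ((y + r *\<^sub>R b - c) \<bullet> b))) has_real_derivative f2 b y - l * (2 * 1)) (at 0)"
      by (intro DERIV_diff DERIV_cmult has_pderivD[OF f2[OF b(1)]])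
  next
    show "f2 b y - l * (2 * 1) > 0" using b(2) by simp
    show "\<rho> - norm (y - c) > 0" using ltr by simp
  next
    fix r :: real assume "\<bar>r\<bar> < \<rho> - norm (y - c)"
    then have "norm (y + r *\<^sub>R b - c) \<le> \<rho>"
      using norm_triangle_ineq[of "y - c" "r *\<^sub>R b"] b(1) by (simp add: algebra_simps)
    then show "g (y + r *\<^sub>R b) \<le> g (y + 0 *\<^sub>R b)"
      using y(2)[of "y + r *\<^sub>R b"] by (simp add: dist_norm norm_minus_commute)
  qed
qed

lemma smooth_dir_deriv: "smooth f \<Longrightarrow> b \<in> Basis \<Longrightarrow> smooth (dir_deriv b f)"
  unfolding smooth_def using of_class_C_dir_deriv by blast

lemma smooth_pderiv: "smooth f \<Longrightarrow> has_pderiv f v (dir_deriv v f)"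
  unfolding smooth_def using of_class_C_pderiv by blast

lemma smooth_continuous: "smooth f \<Longrightarrow> continuous_on UNIV f"
  unfolding smooth_def using of_class_C_continuous by blast

lemma smooth_differentiable: "smooth f \<Longrightarrow> f differentiable (at x)"
  unfolding smooth_def by (metis of_class_C.simps(2))

lemma smooth_real_DERIV:
  fixes f :: "real \<Rightarrow> real"
  assumes "smooth f"
  shows "(f has_real_derivative dir_deriv 1 f s) (at s)"
  using has_pderiv_line[OF smooth_pderiv[OF assms], of 0 1 s] by simp

text \<open>The data of a breather with profile F, velocity m, wave number \<alpha> and amplitude p. Within the locale the
distinguished coordinate direction is ax, and p1 is the derivative of p in this direction.\<close>

locale breather =
  fixes e :: "'n::finite" and q :: nat and F :: "real \<Rightarrow> real"
    and u :: "real \<times> (real ^ 'n) \<Rightarrow> real" and m \<alpha> :: real and p :: "real ^ 'n \<Rightarrow> real"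
  assumes solution: "smooth_solution e q u"
    and smooth_F: "smooth F" and F_0: "F 0 = 0"
    and alpha_pos: "\<alpha> > 0" and admissible: "admissible_amplitude p"
    and u_eq: "u = d_x e (\<lambda>(t, x). F (p x * sin (2 * \<alpha> * (x $ e + m * t))))"
    and q_ge_2: "q \<ge> 2"
begin

definition "ax = (axis e 1 :: real ^ 'n)"
definition "G = dir_deriv 1 F"
definition "G' = dir_deriv 1 G"
definition "G'' = dir_deriv 1 G'"
definition "theta t x = 2 * \<alpha> * (x $ e + m * t)"
definition "p1 = dir_deriv ax p"

lemma ax_Basis [simp]: "ax \<in> Basis"
  by (auto simp: ax_def Basis_vec_def)

lemma smooth_G: "smooth G" "smooth G'" "smooth G''"
  by (auto simp: G_def G'_def G''_def smooth_F intro!: smooth_dir_deriv)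

lemma F_DERIV: "(F has_real_derivative G s) (at s)"
  and G_DERIV: "(G has_real_derivative G' s) (at s)"
  and G'_DERIV: "(G' has_real_derivative G'' s) (at s)"
  using smooth_real_DERIV smooth_F smooth_G by (auto simp: G_def G'_def G''_def)

lemma p_C2: "of_class_C (Suc (Suc 0)) p"
  using admissible by (simp add: admissible_amplitude_def numeral_2_eq_2)

lemma p_pderiv: "has_pderiv p v (dir_deriv v p)"
  by (rule of_class_C_pderiv[OF p_C2])

lemma dp_C1: "b \<in> Basis \<Longrightarrow> of_class_C (Suc 0) (dir_deriv b p)"
  by (rule of_class_C_dir_deriv[OF p_C2])

lemma dp_pderiv: "b \<in> Basis \<Longrightarrow> has_pderiv (dir_deriv b p) v (dir_deriv v (dir_deriv b p))"
  by (rule of_class_C_pderiv[OF dp_C1])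

lemma theta_ax [simp]: "theta t (x + r *\<^sub>R ax) = theta t x + 2 * \<alpha> * r"
  by (simp add: theta_def ax_def algebra_simps)

lemma theta_t [simp]: "theta (t + r) x = theta t x + 2 * \<alpha> * m * r"
  by (simp add: theta_def algebra_simps)

lemma u_smooth: "smooth u"
  using solution by (simp add: smooth_solution_def)

lemma u_formula: "u (t, x) = G (p x * sin (theta t x)) * (p1 x * sin (theta t x) + 2 * \<alpha> * p x * cos (theta t x))"
proof -
  let ?w = "\<lambda>(t, x). F (p x * sin (2 * \<alpha> * (x $ e + m * t)))"
  have "?w differentiable (at z)" for z
  proof -
    have 1: "(\<lambda>z::real \<times> (real^'n). p (snd z)) differentiable (at z)"
    proof (rule differentiable_compose[of p])
      show "p differentiable at (snd z)" using p_C2 by simp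
      show "snd differentiable at z" by (intro bounded_linear_imp_differentiable bounded_linear_snd)
    qed
    have 2: "(\<lambda>z::real \<times> (real^'n). snd z $ e) differentiable (at z)"
      by (intro bounded_linear_imp_differentiable bounded_linear_compose[OF bounded_linear_vec_nth] bounded_linear_snd)
    have 3: "(\<lambda>z::real \<times> (real^'n). fst z) differentiable (at z)"
      by (intro bounded_linear_imp_differentiable bounded_linear_fst)
    have 4: "(\<lambda>z::real \<times> (real^'n). sin (2 * \<alpha> * (snd z $ e + m * fst z))) differentiable (at z)"
      by (rule differentiable_compose[of sin])
        (auto intro!: differentiable_mult differentiable_add 2 3 field_differentiable_imp_differentiable
           field_differentiable_at_sin)
    have "(\<lambda>z::real \<times> (real^'n). F (p (snd z) * sin (2 * \<alpha> * (snd z $ e + m * fst z)))) differentiable (at z)"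
      by (rule differentiable_compose[of F, OF smooth_differentiable[OF smooth_F]])
        (intro differentiable_mult 1 4)
    then show ?thesis by (simp add: case_prod_unfold)
  qed
  then have "has_pderiv ?w (0, ax) u"
    unfolding u_eq d_x_def ax_def by (rule frechet_has_pderiv)
  from has_pderivD[OF this, of "(t, x)"]
  have 1: "((\<lambda>r. F (p (x + r *\<^sub>R ax) * sin (theta t (x + r *\<^sub>R ax)))) has_real_derivative u (t, x)) (at 0)"
    by (simp add: theta_def)
  have "((\<lambda>r. p (x + r *\<^sub>R ax) * sin (theta t x + 2 * \<alpha> * r)) has_real_derivative
      p1 x * sin (theta t x) + 2 * \<alpha> * p x * cos (theta t x)) (at 0)"
    by (auto intro!: derivative_eq_intros has_pderivD[OF p_pderiv] simp: p1_def)
  then have "((\<lambda>r. F (p (x + r *\<^sub>R ax) * sin (theta t x + 2 * \<alpha> * r))) has_real_derivative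
      G (p x * sin (theta t x)) * (p1 x * sin (theta t x) + 2 * \<alpha> * p x * cos (theta t x))) (at 0)"
    by (intro DERIV_chain2[of F]) (auto intro: F_DERIV)
  with 1 show ?thesis by (auto intro: DERIV_unique)
qed

end

section \<open>The integrated equation\<close>

lemma has_pderiv_slice:
  "has_pderiv f (0, b) f' \<Longrightarrow> has_pderiv (\<lambda>x. f (t, x)) b (\<lambda>x. f' (t, x))"
  unfolding has_pderiv_def by (auto dest: spec[of _ "(t, _)"])

lemma Basis_vec_axis: "(Basis :: (real ^ 'n::finite) set) = (\<lambda>j. axis j 1) ` UNIV"
  by (auto simp: Basis_vec_def)

lemma sum_Basis_vec: "(\<Sum>b\<in>(Basis :: (real ^ 'n::finite) set). f b) = (\<Sum>j\<in>UNIV. f (axis j 1))"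
  unfolding Basis_vec_axis by (subst sum.reindex) (auto intro!: injI simp: axis_eq_axis)

lemma laplace_x_Basis:
  "laplace_x u z = (\<Sum>b\<in>Basis. dir_deriv (0, b) (dir_deriv (0, b) u) z)"
  by (simp add: laplace_x_def d_x_def sum_Basis_vec)

lemma tendsto_0_at_infinityE:
  fixes f :: "'a::real_normed_vector \<Rightarrow> real"
  assumes "(f \<longlongrightarrow> 0) at_infinity" "\<eta> > 0"
  obtains R where "\<And>x. norm x \<ge> R \<Longrightarrow> \<bar>f x\<bar> < \<eta>"
  using tendstoD[OF assms] unfolding eventually_at_infinity by (auto simp: dist_real_def)

lemma bounded_if_tendsto_at_infinity:
  fixes f :: "'a::euclidean_space \<Rightarrow> real"
  assumes lim: "(f \<longlongrightarrow> 0) at_infinity" and cont: "continuous_on UNIV f"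
  obtains B where "B > 0" "\<And>x. \<bar>f x\<bar> \<le> B"
proof -
  obtain R where R: "\<And>x. norm x \<ge> R \<Longrightarrow> \<bar>f x\<bar> < 1"
    using tendsto_0_at_infinityE[OF lim, of 1] by auto
  have "bounded (f ` cball 0 R)"
    by (intro compact_imp_bounded compact_continuous_image continuous_on_subset[OF cont]) auto
  then obtain C where C: "\<And>x. norm x \<le> R \<Longrightarrow> \<bar>f x\<bar> \<le> C"
    unfolding bounded_iff by (metis imageI mem_cball_0 real_norm_def)
  have "\<bar>f x\<bar> \<le> max 1 C" for x
    using R[of x] C[of x] by (cases "norm x \<le> R") (auto simp: less_imp_le)
  moreover have "max 1 C > 0" by simp
  ultimately show thesis using that by blast
qed

context breather begin

text \<open>The time derivative of F(p sin \<theta>), of which u is the x_1-derivative. The function potential below is a primitive in x_1 of the left-hand side of the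
evolution equation.\<close>

definition "transport t x = 2 * \<alpha> * m * G (p x * sin (theta t x)) * p x * cos (theta t x)"
definition "potential t x = transport t x + laplace_x u (t, x) + 2 * u (t, x) ^ q"

lemma Basis_axis_t: "(1, 0) \<in> (Basis :: (real \<times> (real ^ 'n)) set)"
  and Basis_axis_x: "b \<in> Basis \<Longrightarrow> (0, b) \<in> (Basis :: (real \<times> (real ^ 'n)) set)"
  by (auto simp: Basis_prod_def)

lemma u_smooth1: "b \<in> Basis \<Longrightarrow> smooth (dir_deriv (0, b) u)"
  and u_smooth2: "b \<in> Basis \<Longrightarrow> c \<in> Basis \<Longrightarrow> smooth (dir_deriv (0, b) (dir_deriv (0, c) u))"
  by (auto intro!: smooth_dir_deriv u_smooth Basis_axis_x)

lemma continuous_theta [continuous_intros]: "continuous_on S (theta t)"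
  unfolding theta_def by (intro continuous_intros)

lemma continuous_G: "continuous_on S G" "continuous_on S G'" "continuous_on S G''"
  using smooth_continuous smooth_G continuous_on_subset by blast+

lemma continuous_p: "continuous_on S p"
  using of_class_C_continuous[OF p_C2] continuous_on_subset by blast

lemma continuous_dp: "b \<in> Basis \<Longrightarrow> continuous_on S (dir_deriv b p)"
  using of_class_C_continuous[OF dp_C1] continuous_on_subset by blast

lemma continuous_ddp: "b \<in> Basis \<Longrightarrow> c \<in> Basis \<Longrightarrow> continuous_on S (dir_deriv b (dir_deriv c p))"
  using of_class_C_continuous[OF of_class_C_dir_deriv[OF dp_C1]] continuous_on_subset by blast

lemma p_tendsto: "(p \<longlongrightarrow> 0) at_infinity"
  and dp_tendsto: "b \<in> Basis \<Longrightarrow> (dir_deriv b p \<longlongrightarrow> 0) at_infinity"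
  and ddp_tendsto: "b \<in> Basis \<Longrightarrow> c \<in> Basis \<Longrightarrow> (dir_deriv b (dir_deriv c p) \<longlongrightarrow> 0) at_infinity"
  using admissible by (auto simp: admissible_amplitude_def)

lemma p_bounded: obtains B where "B > 0" "\<And>x. \<bar>p x\<bar> \<le> B"
  using bounded_if_tendsto_at_infinity[OF p_tendsto continuous_p] by blast

lemma bounded_on_range:
  fixes g :: "real \<Rightarrow> real"
  assumes "continuous_on UNIV g"
  obtains B where "B > 0" "\<And>x t. \<bar>g (p x * sin t)\<bar> \<le> B"
proof -
  obtain C where C: "C > 0" "\<And>x. \<bar>p x\<bar> \<le> C" using p_bounded by blast
  have "bounded (g ` {-C..C})"
    by (intro compact_imp_bounded compact_continuous_image continuous_on_subset[OF assms]) auto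
  then obtain B where B: "B > 0" "\<And>s. s \<in> {-C..C} \<Longrightarrow> \<bar>g s\<bar> \<le> B"
    unfolding bounded_pos by auto
  have "\<bar>g (p x * sin t)\<bar> \<le> B" for x t
  proof -
    have "\<bar>p x * sin t\<bar> \<le> C * 1"
      unfolding abs_mult by (intro mult_mono C) (use C in auto)
    then show ?thesis by (intro B) auto
  qed
  with B(1) show thesis using that by blast
qed

lemma decay:
  assumes "\<eta> > 0"
  obtains R where "\<And>t x. norm x \<ge> R \<Longrightarrow> \<bar>u (t, x)\<bar> \<le> \<eta>" "\<And>t x. norm x \<ge> R \<Longrightarrow> \<bar>transport t x\<bar> \<le> \<eta>"
proof -
  obtain B where B: "B > 0" "\<And>x t. \<bar>G (p x * sin t)\<bar> \<le> B"
    using bounded_on_range[OF continuous_G(1)] by blast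
  define K where "K = B * (1 + 2 * \<alpha>) + 2 * \<alpha> * \<bar>m\<bar> * B"
  have K: "K > 0" "B * (1 + 2 * \<alpha>) \<le> K" "2 * \<alpha> * \<bar>m\<bar> * B \<le> K"
    using B(1) alpha_pos by (auto simp: K_def intro!: add_pos_nonneg mult_nonneg_nonneg mult_pos_pos)
  obtain R1 where R1: "\<And>x. norm x \<ge> R1 \<Longrightarrow> \<bar>p x\<bar> < \<eta> / K"
    using tendsto_0_at_infinityE[OF p_tendsto, of "\<eta> / K"] K assms by auto
  obtain R2 where R2: "\<And>x. norm x \<ge> R2 \<Longrightarrow> \<bar>p1 x\<bar> < \<eta> / K"
    using tendsto_0_at_infinityE[OF dp_tendsto[OF ax_Basis], of "\<eta> / K"] K assms by (auto simp: p1_def)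
  show thesis
  proof (rule that[of "max R1 R2"])
    fix t and x :: "real ^ 'n" assume x: "norm x \<ge> max R1 R2"
    let ?th = "theta t x"
    have 1: "\<bar>p x\<bar> \<le> \<eta> / K" "\<bar>p1 x\<bar> \<le> \<eta> / K" using R1[of x] R2[of x] x by auto
    have "\<bar>p1 x * sin ?th + 2 * \<alpha> * p x * cos ?th\<bar> \<le> \<bar>p1 x\<bar> * \<bar>sin ?th\<bar> + 2 * \<alpha> * \<bar>p x\<bar> * \<bar>cos ?th\<bar>"
      using abs_triangle_ineq[of "p1 x * sin ?th" "2 * \<alpha> * p x * cos ?th"] alpha_pos by (simp add: abs_mult)
    also have "\<dots> \<le> \<eta> / K * 1 + 2 * \<alpha> * (\<eta> / K) * 1"
      using alpha_pos assms K 1 by (intro add_mono mult_mono) auto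
    finally have 2: "\<bar>p1 x * sin ?th + 2 * \<alpha> * p x * cos ?th\<bar> \<le> \<eta> / K * (1 + 2 * \<alpha>)" by (simp add: algebra_simps)
    have "\<bar>u (t, x)\<bar> \<le> B * (\<eta> / K * (1 + 2 * \<alpha>))"
      unfolding u_formula abs_mult by (intro mult_mono B 2) (use B in auto)
    also have "\<dots> = B * (1 + 2 * \<alpha>) * (\<eta> / K)" by simp
    also have "\<dots> \<le> K * (\<eta> / K)" using K assms by (intro mult_right_mono) auto
    finally show "\<bar>u (t, x)\<bar> \<le> \<eta>" using K by simp
    have "\<bar>transport t x\<bar> = 2 * \<alpha> * \<bar>m\<bar> * \<bar>G (p x * sin ?th)\<bar> * \<bar>p x\<bar> * \<bar>cos ?th\<bar>"
      using alpha_pos by (simp add: transport_def abs_mult)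
    also have "\<dots> \<le> 2 * \<alpha> * \<bar>m\<bar> * B * (\<eta> / K) * 1"
      using alpha_pos 1 B K assms by (intro mult_mono) auto
    also have "\<dots> \<le> K * (\<eta> / K)" using K assms by (simp add: mult_right_mono del: times_divide_eq_right)
    finally show "\<bar>transport t x\<bar> \<le> \<eta>" using K by simp
  qed
qed

lemma potential_continuous: "continuous_on UNIV (potential t)"
proof -
  have sl: "continuous_on UNIV (\<lambda>x. f (t, x))" if "continuous_on UNIV f" for f :: "real \<times> (real ^ 'n) \<Rightarrow> real"
    by (rule continuous_on_compose2[OF that]) (auto intro!: continuous_intros)
  have 1: "continuous_on UNIV (transport t)"
    unfolding transport_def
    by (intro continuous_intros continuous_on_compose2[OF continuous_G(1)] continuous_p) auto
  show ?thesis
    unfolding potential_def laplace_x_Basis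
    by (intro continuous_intros 1 sl smooth_continuous u_smooth2 u_smooth)
qed

lemma flux_pderiv:
  "has_pderiv (\<lambda>w. laplace_x u w + 2 * u w ^ q) (0, ax) (d_x e (\<lambda>w. laplace_x u w + 2 * u w ^ q))"
proof -
  have "(\<lambda>w. laplace_x u w + 2 * u w ^ q) differentiable (at z)" for z
    unfolding laplace_x_Basis
    by (intro differentiable_add differentiable_sum differentiable_mult differentiable_power differentiable_const
        smooth_differentiable[OF u_smooth]) (auto intro: smooth_differentiable[OF u_smooth2])
  then show ?thesis
    unfolding d_x_def ax_def by (rule frechet_has_pderiv)
qed

text \<open>The x_1-derivative of the transport term is the time derivative of u: both are the same mixed second derivative of
F(p sin \<theta>). Only first derivatives of p occur, so the amplitude is regular enough.\<close>

lemma potential_pderiv_ax: "has_pderiv (potential t) ax (\<lambda>x. 0)"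
  unfolding has_pderiv_def
proof
  fix x
  let ?th = "theta t x" and ?s = "p x * sin (theta t x)"
  let ?D = "2 * \<alpha> * m * (G' ?s * (p1 x * sin ?th + 2 * \<alpha> * p x * cos ?th) * p x * cos ?th
      + G ?s * (p1 x * cos ?th - 2 * \<alpha> * p x * sin ?th))"
  have pd: "((\<lambda>r. p (x + r *\<^sub>R ax)) has_real_derivative p1 x) (at 0)"
    unfolding p1_def by (rule has_pderivD[OF p_pderiv])
  have s: "((\<lambda>r. p (x + r *\<^sub>R ax) * sin (?th + 2 * \<alpha> * r)) has_real_derivative
      p1 x * sin ?th + 2 * \<alpha> * p x * cos ?th) (at 0)"
    by (auto intro!: derivative_eq_intros pd)
  have Gs: "((\<lambda>r. G (p (x + r *\<^sub>R ax) * sin (?th + 2 * \<alpha> * r))) has_real_derivative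
      G' ?s * (p1 x * sin ?th + 2 * \<alpha> * p x * cos ?th)) (at 0)"
    by (intro DERIV_chain2[of G] s) (auto intro: G_DERIV)
  have 1: "((\<lambda>r. transport t (x + r *\<^sub>R ax)) has_real_derivative ?D) (at 0)"
    unfolding transport_def theta_ax
    by (rule DERIV_cong, (rule derivative_intros Gs pd)+, simp add: algebra_simps)
  have ts: "((\<lambda>r. p x * sin (?th + 2 * \<alpha> * m * r)) has_real_derivative 2 * \<alpha> * m * p x * cos ?th) (at 0)"
    by (auto intro!: derivative_eq_intros)
  have tG: "((\<lambda>r. G (p x * sin (?th + 2 * \<alpha> * m * r))) has_real_derivative G' ?s * (2 * \<alpha> * m * p x * cos ?th)) (at 0)"
    by (intro DERIV_chain2[of G] ts) (auto intro: G_DERIV)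
  have "((\<lambda>r. u (t + r, x)) has_real_derivative ?D) (at 0)"
    unfolding u_formula theta_t
    by (rule DERIV_cong, (rule derivative_intros tG)+, simp add: algebra_simps)
  moreover have "((\<lambda>r. u (t + r, x)) has_real_derivative d_t u (t, x)) (at 0)"
    using has_pderivD[OF smooth_pderiv[OF u_smooth], of "(t, x)" "(1, 0)"] by (simp add: d_t_def)
  ultimately have D: "?D = d_t u (t, x)" by (rule DERIV_unique)
  from has_pderivD[OF has_pderiv_slice[OF flux_pderiv], of t x]
  have 2: "((\<lambda>r. laplace_x u (t, x + r *\<^sub>R ax) + 2 * u (t, x + r *\<^sub>R ax) ^ q) has_real_derivative
     d_x e (\<lambda>w. laplace_x u w + 2 * u w ^ q) (t, x)) (at 0)" .
  have "d_t u (t, x) + d_x e (\<lambda>w. laplace_x u w + 2 * u w ^ q) (t, x) = 0"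
    using solution by (simp add: smooth_solution_def)
  with DERIV_add[OF 1 2] show "((\<lambda>r. potential t (x + r *\<^sub>R ax)) has_real_derivative 0) (at 0)"
    unfolding D by (simp add: potential_def add.assoc)
qed

lemma potential_shift: "potential t (x + r *\<^sub>R ax) = potential t x"
  using DERIV_isconst_all[of "\<lambda>r. potential t (x + r *\<^sub>R ax)" r 0] has_pderiv_line[OF potential_pderiv_ax] by auto

text \<open>A nonzero value of the potential persists on a small ball, and by invariance on all its translates in the x_1-direction. On a far
translate u and the transport term are negligible, so the Laplacian of the small function u would be bounded away
from 0.\<close>

lemma laplacian_sign_contradiction:
  assumes \<sigma>: "\<sigma> = 1 \<or> \<sigma> = (-1::real)" and pos: "\<sigma> * potential t y > 0"
  shows False
proof -
  define h where "h = \<sigma> * potential t y"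
  have h: "h > 0" using pos by (simp add: h_def)
  have "isCont (\<lambda>x. \<sigma> * potential t x) y"
    using continuous_on_mult_left[OF potential_continuous, of \<sigma> t] by (simp add: continuous_on_eq_continuous_at)
  then obtain d where d: "d > 0" "\<And>x. dist x y < d \<Longrightarrow> dist (\<sigma> * potential t x) (\<sigma> * potential t y) < h / 2"
    using h unfolding continuous_at_eps_delta by (metis half_gt_zero)
  define \<rho> where "\<rho> = d / 2"
  have \<rho>: "\<rho> > 0" using d by (simp add: \<rho>_def)
  have near: "\<sigma> * potential t x \<ge> h / 2" if "dist x y \<le> \<rho>" for x
  proof -
    have "dist (\<sigma> * potential t x) (\<sigma> * potential t y) < h / 2" using that d(1) by (intro d(2)) (auto simp: \<rho>_def)
    then show ?thesis unfolding dist_real_def h_def[symmetric] by linarith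
  qed
  let ?n = "real DIM(real ^ 'n)"
  have n0: "?n > 0" using DIM_positive[where 'a="real ^ 'n"] by linarith
  (* Small enough for the lower order terms to take at most a quarter of h, and to contradict the bound of the Laplacian by the supremum. *)
  define \<eta> where "\<eta> = min 1 (min (h / 12) (h * \<rho>\<^sup>2 / (32 * ?n)))"
  have \<eta>: "\<eta> > 0" "\<eta> \<le> 1" "\<eta> \<le> h / 12" "\<eta> \<le> h * \<rho>\<^sup>2 / (32 * ?n)"
    using h \<rho> n0 by (auto simp: \<eta>_def)
  obtain R where R: "\<And>t x. norm x \<ge> R \<Longrightarrow> \<bar>u (t, x)\<bar> \<le> \<eta>" "\<And>t x. norm x \<ge> R \<Longrightarrow> \<bar>transport t x\<bar> \<le> \<eta>"
    using decay[OF \<eta>(1)] by blast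
  define r where "r = \<bar>R\<bar> + norm y + \<rho>"
  define c where "c = y + r *\<^sub>R ax"
  have far: "norm x \<ge> R" if "x \<in> cball c \<rho>" for x
  proof -
    have "r = norm (r *\<^sub>R ax)" using \<rho> by (simp add: r_def)
    also have "\<dots> = norm (x - (x - c) - y)" by (simp add: c_def)
    also have "\<dots> \<le> norm x + norm (x - c) + norm y"
      by (meson add_mono norm_triangle_ineq4 order.trans order_refl)
    also have "\<dots> \<le> norm x + \<rho> + norm y" using that by (simp add: dist_norm norm_minus_commute)
    finally show ?thesis by (simp add: r_def)
  qed
  have "h / 4 * \<rho>\<^sup>2 \<le> 4 * DIM(real ^ 'n) * \<eta>"
  proof (rule laplacian_bound_by_sup[where c = c])
    fix b :: "real ^ 'n" assume b: "b \<in> Basis"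
    have 1: "has_pderiv (\<lambda>x. u (t, x)) b (\<lambda>x. dir_deriv (0, b) u (t, x))"
      by (intro has_pderiv_slice smooth_pderiv u_smooth)
    have 2: "has_pderiv (\<lambda>x. dir_deriv (0, b) u (t, x)) b (\<lambda>x. dir_deriv (0, b) (dir_deriv (0, b) u) (t, x))"
      by (intro has_pderiv_slice smooth_pderiv u_smooth1 b)
    show "has_pderiv (\<lambda>x. \<sigma> * u (t, x)) b (\<lambda>x. \<sigma> * dir_deriv (0, b) u (t, x))"
      using 1 unfolding has_pderiv_def by (auto intro: DERIV_cmult)
    show "has_pderiv (\<lambda>x. \<sigma> * dir_deriv (0, b) u (t, x)) b (\<lambda>x. \<sigma> * dir_deriv (0, b) (dir_deriv (0, b) u) (t, x))"
      using 2 unfolding has_pderiv_def by (auto intro: DERIV_cmult)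
  next
    show "continuous_on UNIV (\<lambda>x. \<sigma> * u (t, x))"
      by (intro continuous_intros continuous_on_compose2[OF smooth_continuous[OF u_smooth]]) auto
    show "\<rho> > 0" by fact
  next
    fix x assume x: "x \<in> cball c \<rho>"
    note bd = R[OF far[OF x], of t]
    have "\<bar>u (t, x)\<bar> ^ q \<le> \<bar>u (t, x)\<bar> ^ 1"
      using bd \<eta> q_ge_2 by (intro power_decreasing) auto
    then have "\<bar>2 * u (t, x) ^ q\<bar> \<le> 2 * \<eta>" using bd by (simp add: abs_mult power_abs)
    moreover have "\<bar>\<sigma> * transport t x\<bar> = \<bar>transport t x\<bar>" "\<bar>\<sigma> * (2 * u (t, x) ^ q)\<bar> = \<bar>2 * u (t, x) ^ q\<bar>"
      using \<sigma> by (auto simp: abs_mult)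
    moreover have "\<sigma> * potential t x = \<sigma> * potential t (x - r *\<^sub>R ax)" using potential_shift[of t "x - r *\<^sub>R ax" r] by simp
    moreover have "dist (x - r *\<^sub>R ax) y \<le> \<rho>"
      using x by (simp add: c_def dist_norm norm_minus_commute algebra_simps)
    then have "\<sigma> * potential t (x - r *\<^sub>R ax) \<ge> h / 2" by (rule near)
    moreover have "\<sigma> * potential t x = \<sigma> * transport t x + \<sigma> * laplace_x u (t, x) + \<sigma> * (2 * u (t, x) ^ q)"
      by (simp add: potential_def algebra_simps)
    ultimately have "\<sigma> * laplace_x u (t, x) \<ge> h / 4"
      using bd(2) \<eta>(3) unfolding abs_le_iff by linarith
    then show "h / 4 \<le> (\<Sum>b\<in>Basis. \<sigma> * dir_deriv (0, b) (dir_deriv (0, b) u) (t, x))"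
      by (simp add: laplace_x_Basis sum_distrib_left)
    show "\<bar>\<sigma> * u (t, x)\<bar> \<le> \<eta>" using bd(1) \<sigma> by (auto simp: abs_mult)
  qed
  also have "\<dots> \<le> 4 * ?n * (h * \<rho>\<^sup>2 / (32 * ?n))"
    using mult_left_mono[OF \<eta>(4), of "4 * ?n"] n0 by simp
  also have "\<dots> = h * \<rho>\<^sup>2 / 8" using n0 by (simp add: field_simps)
  finally show False using h \<rho> by simp
qed

lemma profile_equation: "transport t x + laplace_x u (t, x) + 2 * u (t, x) ^ q = 0"
  using laplacian_sign_contradiction[of 1 t x] laplacian_sign_contradiction[of "-1" t x]
  by (fold potential_def) (metis less_eq_real_def linorder_not_le mult.left_neutral mult_minus1 neg_0_less_iff_less)

end

section \<open>The divergence theorem without boundary\<close>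

lemma lborel_integral_shift:
  fixes g :: "'a::euclidean_space \<Rightarrow> real"
  assumes [measurable]: "g \<in> borel_measurable borel"
  shows "(\<integral>x. g (x + c) \<partial>lborel) = (\<integral>x. g x \<partial>lborel)"
  by (subst (2) lborel_distr_plus[of c, symmetric]) (simp add: integral_distr add.commute)

lemma lborel_integrable_shift:
  fixes g :: "'a::euclidean_space \<Rightarrow> real"
  assumes "integrable lborel g"
  shows "integrable lborel (\<lambda>x. g (x + c))"
proof -
  have "integrable (distr lborel borel ((+) c)) g" using assms by (simp add: lborel_distr_plus)
  then show ?thesis
    by (subst (asm) integrable_distr_eq) (use assms in \<open>auto simp: add.commute\<close>)
qed

lemma lborel_nn_integral_shift:
  assumes [measurable]: "g \<in> borel_measurable borel"
  shows "(\<integral>\<^sup>+x. g (x + c) \<partial>lborel) = (\<integral>\<^sup>+x. g x \<partial>(lborel :: 'a::euclidean_space measure))"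
  by (subst (2) lborel_distr_plus[of c, symmetric]) (simp add: nn_integral_distr add.commute)

lemma continuous_borel_measurable:
  fixes f :: "'a::euclidean_space \<Rightarrow> real"
  shows "continuous_on UNIV f \<Longrightarrow> f \<in> borel_measurable borel"
  by (rule borel_measurable_continuous_onI)

lemma integrable_compact_support:
  fixes g :: "'a::euclidean_space \<Rightarrow> real"
  assumes cont: "continuous_on UNIV g" and supp: "\<And>x. norm x > R \<Longrightarrow> g x = 0"
  shows "integrable lborel g"
proof -
  have "integrable lborel (\<lambda>x. indicator (cball 0 R) x *\<^sub>R g x)"
    by (intro borel_integrable_compact continuous_on_subset[OF cont]) auto
  also have "(\<lambda>x. indicator (cball 0 R) x *\<^sub>R g x) = g"
    using supp by (auto simp: indicator_def fun_eq_iff not_le)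
  finally show ?thesis .
qed

text \<open>Difference quotients of an integrable function have integral 0 by translation invariance of Lebesgue measure, and they
converge boundedly to the derivative.\<close>

lemma integral_pderiv_compact_support:
  fixes g :: "'a::euclidean_space \<Rightarrow> real"
  assumes d: "has_pderiv g b g'" and cont: "continuous_on UNIV g" and cont': "continuous_on UNIV g'"
    and supp: "\<And>x. norm x > R \<Longrightarrow> g x = 0"
  shows "(\<integral>x. g' x \<partial>lborel) = 0"
proof -
  note [measurable] = continuous_borel_measurable[OF cont] continuous_borel_measurable[OF cont']
  have "open {x::'a. norm x > R}" by (intro open_Collect_less continuous_intros)
  then have supp': "g' x = 0" if "norm x > R" for x
    using that supp by (intro has_pderiv_zero_on_open[OF _ _ _ d]) auto
  have "bounded (g' ` cball 0 R)"
    by (intro compact_imp_bounded compact_continuous_image continuous_on_subset[OF cont']) auto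
  then obtain M where M: "M > 0" "\<And>x. norm x \<le> R \<Longrightarrow> \<bar>g' x\<bar> \<le> M"
    unfolding bounded_pos by (metis imageI mem_cball_0 real_norm_def)
  have M': "\<bar>g' x\<bar> \<le> M" for x using M supp'[of x] by (cases "norm x \<le> R") auto
  define h where "h n = 1 / real (Suc n)" for n
  define f where "f n x = (g (x + h n *\<^sub>R b) - g x) / h n" for n x
  have h: "h n > 0" "h n \<le> 1" for n by (auto simp: h_def)
  have h0: "h \<longlonglongrightarrow> 0" unfolding h_def by (rule LIMSEQ_Suc[OF lim_1_over_n])
  have [measurable]: "f n \<in> borel_measurable borel" for n
    unfolding f_def by (intro continuous_borel_measurable continuous_intros continuous_on_compose2[OF cont]) (use h(1)[of n] in auto)
  have "(\<lambda>n. \<integral>x. f n x \<partial>lborel) \<longlonglongrightarrow> (\<integral>x. g' x \<partial>lborel)"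
  proof (rule integral_dominated_convergence[where w = "\<lambda>x. indicator (cball 0 (R + norm b)) x *\<^sub>R M"])
    show "integrable lborel (\<lambda>x::'a. indicator (cball 0 (R + norm b)) x *\<^sub>R M)"
      by (intro borel_integrable_compact) auto
    show "AE x in lborel. (\<lambda>n. f n x) \<longlonglongrightarrow> g' x"
    proof (rule AE_I2)
      fix x
      have "((\<lambda>r. (g (x + r *\<^sub>R b) - g (x + 0 *\<^sub>R b)) / (r - 0)) \<longlongrightarrow> g' x) (at 0)"
        using has_pderivD[OF d, of x] unfolding has_field_derivative_iff by simp
      moreover have "filterlim h (at 0) sequentially"
        unfolding filterlim_at using h0 by (auto simp: h_def)
      ultimately have "((\<lambda>n. (g (x + h n *\<^sub>R b) - g (x + 0 *\<^sub>R b)) / (h n - 0)) \<longlongrightarrow> g' x) sequentially"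
        by (rule filterlim_compose)
      then show "(\<lambda>n. f n x) \<longlonglongrightarrow> g' x" by (simp add: f_def)
    qed
    show "AE x in lborel. norm (f n x) \<le> indicator (cball 0 (R + norm b)) x *\<^sub>R M" for n
    proof (rule AE_I2)
      fix x
      show "norm (f n x) \<le> indicator (cball 0 (R + norm b)) x *\<^sub>R M"
      proof (cases "norm x \<le> R + norm b")
        case True
        obtain z where "0 < z" "z < h n" "g (x + h n *\<^sub>R b) - g (x + 0 *\<^sub>R b) = (h n - 0) * g' (x + z *\<^sub>R b)"
          using MVT2[OF h(1)[of n], of "\<lambda>r. g (x + r *\<^sub>R b)" "\<lambda>r. g' (x + r *\<^sub>R b)"] has_pderiv_line[OF d] by blast
        then have "f n x = g' (x + z *\<^sub>R b)" using h[of n] by (simp add: f_def)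
        then show ?thesis using M' True by simp
      next
        case False
        have "norm x \<le> norm (x + h n *\<^sub>R b) + norm (h n *\<^sub>R b)"
          by (metis add_diff_cancel_right' norm_triangle_ineq4)
        moreover have "norm (h n *\<^sub>R b) \<le> norm b" using h[of n] by (simp add: mult_left_le_one_le)
        ultimately have "norm (x + h n *\<^sub>R b) > R" using False by linarith
        moreover have "norm x > R" using False norm_ge_zero[of b] by linarith
        ultimately show ?thesis using supp False by (simp add: f_def)
      qed
    qed
  qed auto
  moreover have "(\<integral>x. f n x \<partial>lborel) = 0" for n
  proof -
    have gi: "integrable lborel g" by (rule integrable_compact_support[OF cont supp])
    have "(\<integral>x. f n x \<partial>lborel) = ((\<integral>x. g (x + h n *\<^sub>R b) \<partial>lborel) - (\<integral>x. g x \<partial>lborel)) / h n"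
      unfolding f_def using gi lborel_integrable_shift[OF gi] by simp
    then show ?thesis by (simp add: lborel_integral_shift)
  qed
  ultimately show ?thesis by (simp add: LIMSEQ_const_iff)
qed

lemma DERIV_max_0_sq: "((\<lambda>t::real. (max 0 t)\<^sup>2) has_real_derivative 2 * max 0 t) (at t)"
proof -
  consider "t > 0" | "t < 0" | "t = 0" by linarith
  then show ?thesis
  proof cases
    case 1
    have base: "((\<lambda>t::real. t\<^sup>2) has_real_derivative 2 * max 0 t) (at t)" using 1 by (auto intro!: derivative_eq_intros)
    have "eventually (\<lambda>s. s \<in> {0<..}) (nhds t)" using 1 by (intro eventually_nhds_in_open) auto
    then have ev: "eventually (\<lambda>s. s\<^sup>2 = (max 0 s)\<^sup>2) (nhds t)" by eventually_elim auto
    show ?thesis by (rule iffD1[OF DERIV_cong_ev[OF refl ev refl] base])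
  next
    case 2
    have base: "((\<lambda>t::real. 0) has_real_derivative 2 * max 0 t) (at t)" using 2 by (auto intro!: derivative_eq_intros)
    have "eventually (\<lambda>s. s \<in> {..<0}) (nhds t)" using 2 by (intro eventually_nhds_in_open) auto
    then have ev: "eventually (\<lambda>s. 0 = (max 0 s)\<^sup>2) (nhds t)" by eventually_elim auto
    show ?thesis by (rule iffD1[OF DERIV_cong_ev[OF refl ev refl] base])
  next
    case 3
    have "((\<lambda>h. (max 0 h)\<^sup>2 / h) \<longlongrightarrow> (0::real)) (at 0)"
    proof (rule Lim_null_comparison)
      show "\<forall>\<^sub>F h in at 0. norm ((max 0 h)\<^sup>2 / h) \<le> \<bar>h::real\<bar>"
        by (rule always_eventually) (auto simp: max_def power2_eq_square)
      show "((\<lambda>h. \<bar>h::real\<bar>) \<longlongrightarrow> 0) (at 0)" by (auto intro!: tendsto_eq_intros)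
    qed
    then show ?thesis using 3 by (simp add: has_field_derivative_iff)
  qed
qed

text \<open>The square of a truncated paraboloid: it is continuously differentiable, has compact support, and its gradient is of size 1/R.\<close>

definition cutoff :: "real \<Rightarrow> 'a::euclidean_space \<Rightarrow> real" where
  "cutoff R x = (max 0 (1 - (norm x)\<^sup>2 / R\<^sup>2))\<^sup>2"

definition cutoff' :: "real \<Rightarrow> 'a::euclidean_space \<Rightarrow> 'a \<Rightarrow> real" where
  "cutoff' R b x = 2 * max 0 (1 - (norm x)\<^sup>2 / R\<^sup>2) * (- (2 * (x \<bullet> b)) / R\<^sup>2)"

lemma cutoff_pderiv: "has_pderiv (cutoff R) b (cutoff' R b)"
  unfolding has_pderiv_def
proof
  fix x
  have "((\<lambda>r. 1 - (norm (x + r *\<^sub>R b))\<^sup>2 / R\<^sup>2) has_real_derivative - (2 * (x \<bullet> b)) / R\<^sup>2) (at 0)"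
    by (rule DERIV_cong[OF DERIV_diff[OF DERIV_const DERIV_cdivide[OF norm_sq_pderiv[of x b 0 0, simplified]]]]) simp
  then show "((\<lambda>r. cutoff R (x + r *\<^sub>R b)) has_real_derivative cutoff' R b x) (at 0)"
    unfolding cutoff_def cutoff'_def
    by (rule DERIV_chain2[rotated]) (use DERIV_max_0_sq in auto)
qed

lemma cutoff_continuous: "continuous_on UNIV (cutoff R)" "continuous_on UNIV (cutoff' R b)"
  unfolding cutoff_def cutoff'_def divide_inverse by (intro continuous_intros)+

lemma cutoff_bounds: "0 \<le> cutoff R x" "cutoff R x \<le> 1"
  by (auto simp: cutoff_def power_le_one_iff)

lemma cutoff_zero: "R > 0 \<Longrightarrow> norm x > R \<Longrightarrow> cutoff R x = 0"
  by (auto simp: cutoff_def max_def field_simps power_mono less_imp_le)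

lemma cutoff'_bound:
  assumes R: "R > 0" and b: "b \<in> Basis"
  shows "\<bar>cutoff' R b x\<bar> \<le> 4 / R"
proof (cases "norm x \<le> R")
  case True
  have "\<bar>cutoff' R b x\<bar> = 2 * \<bar>max 0 (1 - (norm x)\<^sup>2 / R\<^sup>2)\<bar> * (2 * \<bar>x \<bullet> b\<bar> / R\<^sup>2)"
    by (simp add: cutoff'_def abs_mult)
  also have "\<dots> \<le> 2 * 1 * (2 * R / R\<^sup>2)"
    using R True Basis_le_norm[OF b, of x]
    by (intro mult_mono divide_right_mono) (auto simp: max_def)
  also have "\<dots> = 4 / R" using R by (simp add: power2_eq_square)
  finally show ?thesis .
next
  case False
  then have "R\<^sup>2 \<le> (norm x)\<^sup>2" using R by (intro power_mono) auto
  then have "1 - (norm x)\<^sup>2 / R\<^sup>2 \<le> 0" using R by (simp add: field_simps)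
  then show ?thesis using R by (simp add: cutoff'_def max_def)
qed

lemma cutoff_tendsto: "(\<lambda>n. cutoff (real (Suc n)) x) \<longlonglongrightarrow> 1"
proof -
  have "(\<lambda>n. 1 / real (Suc n)) \<longlonglongrightarrow> 0" by (rule LIMSEQ_Suc[OF lim_1_over_n])
  then have "(\<lambda>n. (max 0 (1 - (norm x)\<^sup>2 * (1 / real (Suc n))\<^sup>2))\<^sup>2) \<longlonglongrightarrow> (max 0 (1 - (norm x)\<^sup>2 * 0\<^sup>2))\<^sup>2"
    by (intro tendsto_intros)
  then show ?thesis by (simp add: cutoff_def power_divide)
qed

text \<open>Only the divergence has to be integrable, not its single terms. This matters below: the second derivatives that arise when the
vector fields of the Carleman estimate are differentiated are not known to be integrable, but they cancel in the divergence.\<close>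

theorem integral_divergence_zero:
  fixes Z Z' :: "'a::euclidean_space \<Rightarrow> 'a \<Rightarrow> real"
  assumes d: "\<And>b. b \<in> Basis \<Longrightarrow> has_pderiv (Z b) b (Z' b)"
    and c: "\<And>b. b \<in> Basis \<Longrightarrow> continuous_on UNIV (Z b)"
    and c': "\<And>b. b \<in> Basis \<Longrightarrow> continuous_on UNIV (Z' b)"
    and int: "\<And>b. b \<in> Basis \<Longrightarrow> integrable lborel (Z b)"
    and int': "integrable lborel (\<lambda>x. \<Sum>b\<in>Basis. Z' b x)"
  shows "(\<integral>x. (\<Sum>b\<in>Basis. Z' b x) \<partial>lborel) = 0"
proof -
  define D where "D x = (\<Sum>b\<in>Basis. Z' b x)" for x
  have Dc: "continuous_on UNIV D" unfolding D_def by (intro continuous_intros c')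
  note [measurable] = continuous_borel_measurable[OF Dc] continuous_borel_measurable[OF cutoff_continuous(1)]
     continuous_borel_measurable[OF cutoff_continuous(2)]
  let ?R = "\<lambda>n. real (Suc n)"
  have lim: "(\<lambda>n. \<integral>x. cutoff (?R n) x * D x \<partial>lborel) \<longlonglongrightarrow> (\<integral>x. D x \<partial>lborel)"
  proof (rule integral_dominated_convergence[where w = "\<lambda>x. \<bar>D x\<bar>"])
    show "integrable lborel (\<lambda>x. \<bar>D x\<bar>)" using int' unfolding D_def by (rule integrable_abs)
    show "AE x in lborel. (\<lambda>n. cutoff (?R n) x * D x) \<longlonglongrightarrow> D x"
      using tendsto_mult_right[OF cutoff_tendsto] by (auto intro!: AE_I2)
    show "AE x in lborel. norm (cutoff (?R n) x * D x) \<le> \<bar>D x\<bar>" for n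
      using cutoff_bounds by (auto intro!: AE_I2 mult_left_le_one_le simp: abs_mult abs_of_nonneg[OF cutoff_bounds(1)])
  qed auto
  define J where "J = (\<Sum>b\<in>Basis. \<integral>x. \<bar>Z b x\<bar> \<partial>lborel)"
  have bound: "\<bar>\<integral>x. cutoff (?R n) x * D x \<partial>lborel\<bar> \<le> 4 * J * (1 / ?R n)" for n
  proof -
    have R: "?R n > 0" by simp
    have i1: "integrable lborel (\<lambda>x. cutoff (?R n) x * Z' b x)" if b: "b \<in> Basis" for b
      by (rule integrable_compact_support[where R = "?R n"])
        (auto intro!: continuous_intros cutoff_continuous c' b simp: cutoff_zero)
    have i2: "integrable lborel (\<lambda>x. cutoff' (?R n) b x * Z b x)" if b: "b \<in> Basis" for b
    proof (rule Bochner_Integration.integrable_bound)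
      show "integrable lborel (\<lambda>x. 4 / ?R n * \<bar>Z b x\<bar>)" using int[OF b] by auto
      show "(\<lambda>x. cutoff' (?R n) b x * Z b x) \<in> borel_measurable lborel"
        using continuous_borel_measurable[OF c[OF b]] by measurable
      show "AE x in lborel. norm (cutoff' (?R n) b x * Z b x) \<le> norm (4 / ?R n * \<bar>Z b x\<bar>)"
      proof (rule AE_I2)
        fix x
        show "norm (cutoff' (?R n) b x * Z b x) \<le> norm (4 / ?R n * \<bar>Z b x\<bar>)"
          using mult_right_mono[OF cutoff'_bound[OF R b], of "\<bar>Z b x\<bar>" x] by (simp add: abs_mult)
      qed
    qed
    have zero: "(\<integral>x. cutoff' (?R n) b x * Z b x + cutoff (?R n) x * Z' b x \<partial>lborel) = 0" if b: "b \<in> Basis" for b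
    proof (rule integral_pderiv_compact_support[where R = "?R n" and g = "\<lambda>x. cutoff (?R n) x * Z b x" and b = b])
      show "has_pderiv (\<lambda>x. cutoff (?R n) x * Z b x) b (\<lambda>x. cutoff' (?R n) b x * Z b x + cutoff (?R n) x * Z' b x)"
        unfolding has_pderiv_def
        by (intro allI) (rule DERIV_cong, rule DERIV_mult[OF has_pderivD[OF cutoff_pderiv] has_pderivD[OF d[OF b]]], simp)
    qed (auto intro!: continuous_intros cutoff_continuous c c' b simp: cutoff_zero)
    have "(\<integral>x. cutoff (?R n) x * D x \<partial>lborel) = (\<Sum>b\<in>Basis. \<integral>x. cutoff (?R n) x * Z' b x \<partial>lborel)"
      unfolding D_def sum_distrib_left by (intro Bochner_Integration.integral_sum i1)
    also have "\<dots> = (\<Sum>b\<in>Basis. - (\<integral>x. cutoff' (?R n) b x * Z b x \<partial>lborel))"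
      using zero i1 i2 by (intro sum.cong refl) (simp add: eq_neg_iff_add_eq_0 add.commute)
    finally have "\<bar>\<integral>x. cutoff (?R n) x * D x \<partial>lborel\<bar> \<le> (\<Sum>b\<in>Basis. \<bar>\<integral>x. cutoff' (?R n) b x * Z b x \<partial>lborel\<bar>)"
      using sum_abs[of "\<lambda>b. - (\<integral>x. cutoff' (?R n) b x * Z b x \<partial>lborel)" Basis] by simp
    also have "\<dots> \<le> (\<Sum>b\<in>Basis. 4 / ?R n * (\<integral>x. \<bar>Z b x\<bar> \<partial>lborel))"
    proof (rule sum_mono)
      fix b :: 'a assume b: "b \<in> Basis"
      have "\<bar>\<integral>x. cutoff' (?R n) b x * Z b x \<partial>lborel\<bar> \<le> (\<integral>x. \<bar>cutoff' (?R n) b x * Z b x\<bar> \<partial>lborel)"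
        using integral_abs_bound by blast
      also have "\<dots> \<le> (\<integral>x. 4 / ?R n * \<bar>Z b x\<bar> \<partial>lborel)"
      proof (rule integral_mono)
        show "integrable lborel (\<lambda>x. \<bar>cutoff' (?R n) b x * Z b x\<bar>)" by (rule integrable_abs[OF i2[OF b]])
        show "integrable lborel (\<lambda>x. 4 / ?R n * \<bar>Z b x\<bar>)" using int[OF b] by auto
        show "\<bar>cutoff' (?R n) b x * Z b x\<bar> \<le> 4 / ?R n * \<bar>Z b x\<bar>" for x
          using mult_right_mono[OF cutoff'_bound[OF R b], of "\<bar>Z b x\<bar>" x] by (simp add: abs_mult)
      qed
      finally show "\<bar>\<integral>x. cutoff' (?R n) b x * Z b x \<partial>lborel\<bar> \<le> 4 / ?R n * (\<integral>x. \<bar>Z b x\<bar> \<partial>lborel)" by simp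
    qed
    also have "\<dots> = 4 * J * (1 / ?R n)" by (simp add: J_def sum_distrib_left sum_divide_distrib)
    finally show ?thesis .
  qed
  have "(\<lambda>n. 4 * J * (1 / ?R n)) \<longlonglongrightarrow> 4 * J * 0"
    by (intro tendsto_mult_left LIMSEQ_Suc[OF lim_1_over_n])
  then have J0: "(\<lambda>n. 4 * J * (1 / ?R n)) \<longlonglongrightarrow> 0" by simp
  have "(\<lambda>n. \<integral>x. cutoff (?R n) x * D x \<partial>lborel) \<longlonglongrightarrow> 0"
  proof (rule Lim_null_comparison[OF _ J0])
    show "\<forall>\<^sub>F n in sequentially. norm (\<integral>x. cutoff (?R n) x * D x \<partial>lborel) \<le> 4 * J * (1 / ?R n)"
      using bound by (intro always_eventually allI) (simp only: real_norm_def)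
  qed
  with lim show ?thesis unfolding D_def by (rule LIMSEQ_unique)
qed

section \<open>A Poincare inequality for functions with a zero on every segment\<close>

lemma integral_sq_Cauchy_Schwarz:
  fixes f :: "real \<Rightarrow> real"
  assumes L: "L > 0" and cont: "continuous_on {-L..L} f"
  shows "(integral {-L..L} (\<lambda>r. \<bar>f r\<bar>))\<^sup>2 \<le> 2 * L * integral {-L..L} (\<lambda>r. (f r)\<^sup>2)"
proof -
  let ?I = "{-L..L}"
  define M where "M = integral ?I (\<lambda>r. \<bar>f r\<bar>)"
  define c where "c = M / (2 * L)"
  have i1: "(\<lambda>r. \<bar>f r\<bar>) integrable_on ?I" and i2: "(\<lambda>r. (f r)\<^sup>2) integrable_on ?I"
    by (intro integrable_continuous_real continuous_intros cont)+
  have "0 \<le> integral ?I (\<lambda>r. (\<bar>f r\<bar> - c)\<^sup>2)"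
    by (intro integral_nonneg integrable_continuous_real continuous_intros cont) auto
  also have "(\<lambda>r. (\<bar>f r\<bar> - c)\<^sup>2) = (\<lambda>r. (f r)\<^sup>2 - (2 * c) * \<bar>f r\<bar> + c\<^sup>2)"
    by (auto simp: power2_diff algebra_simps)
  also have "integral ?I \<dots> = integral ?I (\<lambda>r. (f r)\<^sup>2) - 2 * c * M + 2 * L * c\<^sup>2"
  proof (rule integral_unique)
    have "((\<lambda>r. c\<^sup>2) has_integral 2 * L * c\<^sup>2) ?I"
      using has_integral_const_real[of "c\<^sup>2" "- L" L] L by simp
    then show "((\<lambda>r. (f r)\<^sup>2 - (2 * c) * \<bar>f r\<bar> + c\<^sup>2) has_integral
        integral ?I (\<lambda>r. (f r)\<^sup>2) - 2 * c * M + 2 * L * c\<^sup>2) ?I"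
      unfolding M_def
      by (intro has_integral_add has_integral_diff has_integral_mult_right integrable_integral i1 i2)
  qed
  also have "\<dots> = integral ?I (\<lambda>r. (f r)\<^sup>2) - M\<^sup>2 / (2 * L)"
    using L by (simp add: c_def power2_eq_square field_simps)
  finally show ?thesis using L by (simp add: M_def field_simps)
qed

lemma sq_le_integral_deriv_sq:
  fixes f f' :: "real \<Rightarrow> real"
  assumes L: "L > 0" and d: "\<And>r. (f has_real_derivative f' r) (at r)" and cont: "continuous_on UNIV f'"
    and z: "\<bar>r0\<bar> \<le> L" "f r0 = 0"
  shows "(f 0)\<^sup>2 \<le> 2 * L * integral {-L..L} (\<lambda>r. (f' r)\<^sup>2)"
proof -
  let ?I = "{-L..L}"
  have c: "continuous_on S f'" for S using cont continuous_on_subset by blast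
  have ftc: "(f' has_integral f b - f a) {a..b}" if "a \<le> b" for a b
    by (rule fundamental_theorem_of_calculus[OF that])
      (use d in \<open>auto simp: has_real_derivative_iff_has_vector_derivative intro: has_vector_derivative_at_within\<close>)
  have bound: "\<bar>f b - f a\<bar> \<le> integral ?I (\<lambda>r. \<bar>f' r\<bar>)" if "a \<le> b" "{a..b} \<subseteq> ?I" for a b
  proof -
    have "\<bar>f b - f a\<bar> = norm (integral {a..b} f')" using integral_unique[OF ftc[OF that(1)]] by simp
    also have "\<dots> \<le> integral {a..b} (\<lambda>r. \<bar>f' r\<bar>)"
      by (intro integral_norm_bound_integral integrable_continuous_real continuous_intros c) auto
    also have "\<dots> \<le> integral ?I (\<lambda>r. \<bar>f' r\<bar>)"
      by (intro integral_subset_le that(2) integrable_continuous_real continuous_intros c) auto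
    finally show ?thesis .
  qed
  have "\<bar>f 0\<bar> \<le> integral ?I (\<lambda>r. \<bar>f' r\<bar>)"
    using bound[of r0 0] bound[of 0 r0] z L by (cases "r0 \<le> 0") auto
  then have "(f 0)\<^sup>2 \<le> (integral ?I (\<lambda>r. \<bar>f' r\<bar>))\<^sup>2"
    by (metis abs_ge_zero power2_abs power_mono)
  also have "\<dots> \<le> 2 * L * integral ?I (\<lambda>r. (f' r)\<^sup>2)"
    by (rule integral_sq_Cauchy_Schwarz[OF L c])
  finally show ?thesis .
qed

text \<open>On each line the value of z is the integral of its derivative from the nearby zero. Integrating over all base points
and exchanging the integrals costs nothing, because Lebesgue measure and the weight are invariant under translation along e.\<close>

lemma weighted_Poincare:
  fixes z z' \<omega> :: "'a::euclidean_space \<Rightarrow> real"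
  assumes L: "L > 0" and d: "has_pderiv z e z'"
    and c: "continuous_on UNIV z" and c': "continuous_on UNIV z'" and cw: "continuous_on UNIV \<omega>"
    and w0: "\<And>x. \<omega> x \<ge> 0" and inv: "\<And>x r. \<omega> (x + r *\<^sub>R e) = \<omega> x"
    and zero: "\<And>x. \<exists>r. \<bar>r\<bar> \<le> L \<and> z (x + r *\<^sub>R e) = 0"
    and i: "integrable lborel (\<lambda>x. \<omega> x * (z x)\<^sup>2)" and i': "integrable lborel (\<lambda>x. \<omega> x * (z' x)\<^sup>2)"
  shows "(\<integral>x. \<omega> x * (z x)\<^sup>2 \<partial>lborel) \<le> 4 * L\<^sup>2 * (\<integral>x. \<omega> x * (z' x)\<^sup>2 \<partial>lborel)"
proof -
  note [measurable] = continuous_borel_measurable[OF c] continuous_borel_measurable[OF c'] continuous_borel_measurable[OF cw]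
  let ?W = "\<lambda>x. \<omega> x * (z' x)\<^sup>2"
  have line: "(z x)\<^sup>2 \<le> 2 * L * integral {-L..L} (\<lambda>r. (z' (x + r *\<^sub>R e))\<^sup>2)" for x
  proof -
    obtain r0 where "\<bar>r0\<bar> \<le> L" "z (x + r0 *\<^sub>R e) = 0" using zero by blast
    moreover have "continuous_on UNIV (\<lambda>r. z' (x + r *\<^sub>R e))"
      by (intro continuous_on_compose2[OF c'] continuous_intros) auto
    ultimately show ?thesis
      using sq_le_integral_deriv_sq[OF L has_pderiv_line[OF d], of x r0] by simp
  qed
  have nn: "ennreal (\<omega> x * (z x)\<^sup>2) \<le> ennreal (2 * L) * (\<integral>\<^sup>+r. indicator {-L..L} r * ennreal (?W (x + r *\<^sub>R e)) \<partial>lborel)" for x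
  proof -
    have cx: "continuous_on {-L..L} (\<lambda>r. ?W (x + r *\<^sub>R e))"
      by (intro continuous_intros continuous_on_compose2[OF c'] continuous_on_compose2[OF cw]) auto
    have "set_integrable lborel {-L..L} (\<lambda>r. ?W (x + r *\<^sub>R e))"
      unfolding set_integrable_def by (intro borel_integrable_compact cx) auto
    then have si: "integrable lborel (\<lambda>r. indicator {-L..L} r * ?W (x + r *\<^sub>R e))"
      by (simp add: set_integrable_def)
    have "(\<integral>r. indicator {-L..L} r * ?W (x + r *\<^sub>R e) \<partial>lborel) = integral {-L..L} (\<lambda>r. ?W (x + r *\<^sub>R e))"
      using set_borel_integral_eq_integral(2)[of "{-L..L}" "\<lambda>r. ?W (x + r *\<^sub>R e)"] si
      by (simp add: set_lebesgue_integral_def set_integrable_def)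
    also have "\<dots> = \<omega> x * integral {-L..L} (\<lambda>r. (z' (x + r *\<^sub>R e))\<^sup>2)" by (simp add: inv)
    finally have eq: "(\<integral>r. indicator {-L..L} r * ?W (x + r *\<^sub>R e) \<partial>lborel) = \<omega> x * integral {-L..L} (\<lambda>r. (z' (x + r *\<^sub>R e))\<^sup>2)" .
    have "(\<integral>\<^sup>+r. indicator {-L..L} r * ennreal (?W (x + r *\<^sub>R e)) \<partial>lborel)
        = (\<integral>\<^sup>+r. ennreal (indicator {-L..L} r * ?W (x + r *\<^sub>R e)) \<partial>lborel)"
      by (intro nn_integral_cong) (auto simp: indicator_def)
    also have "\<dots> = ennreal (\<omega> x * integral {-L..L} (\<lambda>r. (z' (x + r *\<^sub>R e))\<^sup>2))"
      unfolding eq[symmetric] using w0 by (intro nn_integral_eq_integral si) (auto intro!: AE_I2)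
    finally have "ennreal (2 * L) * (\<integral>\<^sup>+r. indicator {-L..L} r * ennreal (?W (x + r *\<^sub>R e)) \<partial>lborel)
        = ennreal (2 * L * (\<omega> x * integral {-L..L} (\<lambda>r. (z' (x + r *\<^sub>R e))\<^sup>2)))"
      using L by (simp only: ennreal_mult')
    moreover have "\<omega> x * (z x)\<^sup>2 \<le> 2 * L * (\<omega> x * integral {-L..L} (\<lambda>r. (z' (x + r *\<^sub>R e))\<^sup>2))"
      using mult_left_mono[OF line[of x] w0[of x]] by (simp add: mult_ac)
    ultimately show ?thesis by (simp only: ennreal_leI)
  qed
  have "(\<integral>\<^sup>+x. ennreal (\<omega> x * (z x)\<^sup>2) \<partial>lborel)
      \<le> (\<integral>\<^sup>+x. ennreal (2 * L) * (\<integral>\<^sup>+r. indicator {-L..L} r * ennreal (?W (x + r *\<^sub>R e)) \<partial>lborel) \<partial>lborel)"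
    by (intro nn_integral_mono nn)
  also have "\<dots> = ennreal (2 * L) * (\<integral>\<^sup>+x. (\<integral>\<^sup>+r. indicator {-L..L} r * ennreal (?W (x + r *\<^sub>R e)) \<partial>lborel) \<partial>lborel)"
    by (intro nn_integral_cmult) measurable
  also have "(\<integral>\<^sup>+x. (\<integral>\<^sup>+r. indicator {-L..L} r * ennreal (?W (x + r *\<^sub>R e)) \<partial>lborel) \<partial>lborel)
      = (\<integral>\<^sup>+r. (\<integral>\<^sup>+x. indicator {-L..L} r * ennreal (?W (x + r *\<^sub>R e)) \<partial>lborel) \<partial>lborel)"
    by (rule lborel_pair.Fubini'[symmetric]) measurable
  also have "\<dots> = (\<integral>\<^sup>+r. indicator {-L..L} r * (\<integral>\<^sup>+x. ennreal (?W x) \<partial>lborel) \<partial>lborel)"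
  proof (rule nn_integral_cong)
    fix r :: real
    have "(\<integral>\<^sup>+x. indicator {-L..L} r * ennreal (?W (x + r *\<^sub>R e)) \<partial>lborel)
       = indicator {-L..L} r * (\<integral>\<^sup>+x. ennreal (?W (x + r *\<^sub>R e)) \<partial>lborel)"
      by (intro nn_integral_cmult) measurable
    then show "(\<integral>\<^sup>+x. indicator {-L..L} r * ennreal (?W (x + r *\<^sub>R e)) \<partial>lborel)
       = indicator {-L..L} r * (\<integral>\<^sup>+x. ennreal (?W x) \<partial>lborel)"
      using lborel_nn_integral_shift[of "\<lambda>x. ennreal (?W x)" "r *\<^sub>R e"] by simp
  qed
  also have "\<dots> = ennreal (2 * L) * (\<integral>\<^sup>+x. ennreal (?W x) \<partial>lborel)"
    using L by (subst nn_integral_multc) auto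
  finally have "(\<integral>\<^sup>+x. ennreal (\<omega> x * (z x)\<^sup>2) \<partial>lborel) \<le> ennreal (4 * L\<^sup>2) * (\<integral>\<^sup>+x. ennreal (?W x) \<partial>lborel)"
    using L by (simp add: mult.assoc[symmetric] ennreal_mult'[symmetric] power2_eq_square)
  then have "ennreal (\<integral>x. \<omega> x * (z x)\<^sup>2 \<partial>lborel) \<le> ennreal (4 * L\<^sup>2) * ennreal (\<integral>x. ?W x \<partial>lborel)"
    using w0 by (simp add: nn_integral_eq_integral[OF i] nn_integral_eq_integral[OF i'])
  then show ?thesis
    using w0 by (simp add: ennreal_mult''[symmetric])
qed

section \<open>Weights\<close>

text \<open>A slowly varying weight in the directions other than e, and integrable in these directions. Its gradient is at most h times the weight itself, so that the errors
which it causes in the integrations by parts are negligible for small h; being constant along e, it is admissible in the Poincare inequality.\<close>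

definition weight :: "'a::euclidean_space \<Rightarrow> real \<Rightarrow> 'a \<Rightarrow> real" where
  "weight e h x = (\<Prod>b\<in>Basis - {e}. 1 / (1 + h\<^sup>2 * (x \<bullet> b)\<^sup>2))"

definition weight' :: "'a::euclidean_space \<Rightarrow> real \<Rightarrow> 'a \<Rightarrow> 'a \<Rightarrow> real" where
  "weight' e h b x = (if b = e then 0 else - (2 * h\<^sup>2 * (x \<bullet> b)) / (1 + h\<^sup>2 * (x \<bullet> b)\<^sup>2) * weight e h x)"

lemma one_plus_sq_pos: "1 + (h::real)\<^sup>2 * t\<^sup>2 > 0"
  by (simp add: add_pos_nonneg)

lemma weight_pos: "weight e h x > 0"
  unfolding weight_def by (intro prod_pos) (auto intro: one_plus_sq_pos divide_pos_pos)

lemma weight_continuous: "continuous_on UNIV (weight e h)"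
  unfolding weight_def
  by (intro continuous_intros) (use one_plus_sq_pos in \<open>auto simp: less_imp_neq[symmetric]\<close>)

lemma weight'_continuous: "continuous_on UNIV (weight' e h b)"
proof (cases "b = e")
  case False
  have "1 + h\<^sup>2 * (x \<bullet> b)\<^sup>2 \<noteq> 0" for x using one_plus_sq_pos[of h "x \<bullet> b"] by linarith
  with False show ?thesis
    unfolding weight'_def by (auto intro!: continuous_intros weight_continuous)
qed (simp add: weight'_def)

lemma weight_invariant:
  assumes "e \<in> Basis"
  shows "weight e h (x + r *\<^sub>R e) = weight e h x"
  unfolding weight_def using assms by (intro prod.cong refl) (auto simp: inner_add_left inner_not_same_Basis)

lemma weight_pderiv:
  assumes e: "e \<in> Basis" and b: "b \<in> Basis"
  shows "has_pderiv (weight e h) b (weight' e h b)"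
  unfolding has_pderiv_def
proof
  fix x
  show "((\<lambda>r. weight e h (x + r *\<^sub>R b)) has_real_derivative weight' e h b x) (at 0)"
  proof (cases "b = e")
    case True
    then show ?thesis using e by (simp add: weight_invariant weight'_def)
  next
    case False
    define k where "k = (\<Prod>c\<in>Basis - {e} - {b}. 1 / (1 + h\<^sup>2 * (x \<bullet> c)\<^sup>2))"
    have split: "weight e h (x + r *\<^sub>R b) = 1 / (1 + h\<^sup>2 * (x \<bullet> b + r)\<^sup>2) * k" for r
    proof -
      have "weight e h (x + r *\<^sub>R b) = 1 / (1 + h\<^sup>2 * ((x + r *\<^sub>R b) \<bullet> b)\<^sup>2) *
         (\<Prod>c\<in>Basis - {e} - {b}. 1 / (1 + h\<^sup>2 * ((x + r *\<^sub>R b) \<bullet> c)\<^sup>2))"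
        unfolding weight_def by (rule prod.remove) (use False b in auto)
      also have "(\<Prod>c\<in>Basis - {e} - {b}. 1 / (1 + h\<^sup>2 * ((x + r *\<^sub>R b) \<bullet> c)\<^sup>2)) = k"
        unfolding k_def using b by (intro prod.cong refl) (auto simp: inner_add_left inner_not_same_Basis)
      finally show ?thesis using b by (simp add: inner_add_left)
    qed
    have nz: "1 + h\<^sup>2 * (x \<bullet> b)\<^sup>2 \<noteq> 0" using one_plus_sq_pos[of h "x \<bullet> b"] by linarith
    have w0: "weight e h x = 1 / (1 + h\<^sup>2 * (x \<bullet> b)\<^sup>2) * k" using split[of 0] by simp
    have "((\<lambda>r. 1 / (1 + h\<^sup>2 * (x \<bullet> b + r)\<^sup>2) * k) has_real_derivative weight' e h b x) (at 0)"
      unfolding weight'_def w0 using False nz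
      by (auto intro!: derivative_eq_intros simp: power2_eq_square)
    then show ?thesis by (simp only: split)
  qed
qed

lemma weight'_bound:
  assumes "h > 0"
  shows "\<bar>weight' e h b x\<bar> \<le> h * weight e h x"
proof (cases "b = e")
  case True
  then show ?thesis using assms weight_pos[of e h x] by (simp add: weight'_def less_imp_le)
next
  case False
  define t where "t = h * \<bar>x \<bullet> b\<bar>"
  have "0 \<le> (1 - t)\<^sup>2" by simp
  then have "2 * t \<le> 1 + h\<^sup>2 * (x \<bullet> b)\<^sup>2" by (simp add: t_def power2_diff power_mult_distrib)
  then have "2 * h\<^sup>2 * \<bar>x \<bullet> b\<bar> \<le> h * (1 + h\<^sup>2 * (x \<bullet> b)\<^sup>2)"
    using mult_left_mono[of "2 * t" "1 + h\<^sup>2 * (x \<bullet> b)\<^sup>2" h] assms by (simp add: t_def power2_eq_square mult_ac)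
  then have "2 * h\<^sup>2 * \<bar>x \<bullet> b\<bar> / (1 + h\<^sup>2 * (x \<bullet> b)\<^sup>2) \<le> h"
    using one_plus_sq_pos[of h "x \<bullet> b"] by (simp add: divide_le_eq)
  then have "2 * h\<^sup>2 * \<bar>x \<bullet> b\<bar> / (1 + h\<^sup>2 * (x \<bullet> b)\<^sup>2) * weight e h x \<le> h * weight e h x"
    using weight_pos[of e h x] by (intro mult_right_mono) auto
  moreover have "\<bar>weight' e h b x\<bar> = 2 * h\<^sup>2 * \<bar>x \<bullet> b\<bar> / (1 + h\<^sup>2 * (x \<bullet> b)\<^sup>2) * weight e h x"
    using False weight_pos[of e h x] one_plus_sq_pos[of h "x \<bullet> b"] by (simp add: weight'_def abs_mult)
  ultimately show ?thesis by simp
qed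

lemma nn_integral_Cauchy_density_finite:
  assumes h: "(h::real) > 0"
  shows "(\<integral>\<^sup>+t. ennreal (1 / (1 + h\<^sup>2 * t\<^sup>2)) \<partial>lborel) < \<infinity>"
proof -
  let ?f = "\<lambda>t::real. 1 / (1 + h\<^sup>2 * t\<^sup>2)"
  have nz: "1 + h\<^sup>2 * t\<^sup>2 \<noteq> 0" for t using one_plus_sq_pos[of h t] by linarith
  have meas[measurable]: "?f \<in> borel_measurable borel" by measurable
  have half: "(\<integral>\<^sup>+t. ennreal (?f t) * indicator {0..} t \<partial>lborel) = ennreal (pi / 2 / h - arctan (h * 0) / h)"
  proof (rule nn_integral_FTC_atLeast)
    fix t :: real
    show "((\<lambda>t. arctan (h * t) / h) has_real_derivative ?f t) (at t)"
      using h nz[of t] by (auto intro!: derivative_eq_intros simp: power_mult_distrib divide_inverse)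
    show "0 \<le> ?f t" using one_plus_sq_pos[of h t] by simp
  next
    have "filterlim (\<lambda>t. h * t) at_top at_top"
      using h by (intro filterlim_tendsto_pos_mult_at_top[OF tendsto_const]) (auto intro: filterlim_ident)
    then have "((\<lambda>t. arctan (h * t)) \<longlongrightarrow> pi / 2) at_top"
      by (rule filterlim_compose[OF tendsto_arctan_at_top])
    then show "((\<lambda>t. arctan (h * t) / h) \<longlongrightarrow> pi / 2 / h) at_top"
      using h by (intro tendsto_divide) auto
  qed (rule meas)
  have "(\<integral>\<^sup>+t. ennreal (?f t) \<partial>lborel)
      \<le> (\<integral>\<^sup>+t. ennreal (?f t) * indicator {0..} t + ennreal (?f (- t)) * indicator {0..} (- t) \<partial>lborel)"
    by (intro nn_integral_mono) (auto simp: indicator_def)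
  also have "\<dots> = (\<integral>\<^sup>+t. ennreal (?f t) * indicator {0..} t \<partial>lborel) + (\<integral>\<^sup>+t. ennreal (?f (- t)) * indicator {0..} (- t) \<partial>lborel)"
    by (intro nn_integral_add) measurable
  also have "(\<integral>\<^sup>+t. ennreal (?f (- t)) * indicator {0..} (- t) \<partial>lborel) = (\<integral>\<^sup>+t. ennreal (?f t) * indicator {0..} t \<partial>lborel)"
    using nn_integral_real_affine[of "\<lambda>t. ennreal (?f t) * indicator {0..} t" "- 1" 0] by simp
  finally show ?thesis
    unfolding half by (rule le_less_trans) (simp add: less_top[symmetric])
qed

lemma integrable_weight:
  fixes e :: "'a::euclidean_space"
  assumes h: "h > 0" and e: "e \<in> Basis"
  shows "integrable lborel (\<lambda>x. weight e h x * (1 / (1 + (x \<bullet> e)\<^sup>2)))"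
proof -
  let ?h = "\<lambda>b. if b = e then 1 else h"
  have eq: "weight e h x * (1 / (1 + (x \<bullet> e)\<^sup>2)) = (\<Prod>b\<in>Basis. 1 / (1 + (?h b)\<^sup>2 * (x \<bullet> b)\<^sup>2))" for x
  proof -
    have "(\<Prod>b\<in>Basis. 1 / (1 + (?h b)\<^sup>2 * (x \<bullet> b)\<^sup>2)) = 1 / (1 + (?h e)\<^sup>2 * (x \<bullet> e)\<^sup>2) * (\<Prod>b\<in>Basis-{e}. 1 / (1 + (?h b)\<^sup>2 * (x \<bullet> b)\<^sup>2))"
      by (rule prod.remove) (use e in auto)
    also have "(\<Prod>b\<in>Basis-{e}. 1 / (1 + (?h b)\<^sup>2 * (x \<bullet> b)\<^sup>2)) = weight e h x"
      unfolding weight_def by (intro prod.cong) auto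
    finally show ?thesis by simp
  qed
  have meas: "(\<lambda>x::'a. \<Prod>b\<in>Basis. 1 / (1 + (?h b)\<^sup>2 * (x \<bullet> b)\<^sup>2)) \<in> borel_measurable lborel"
    by measurable
  have pos: "0 \<le> (\<Prod>b\<in>Basis. 1 / (1 + (?h b)\<^sup>2 * (x \<bullet> b)\<^sup>2))" for x :: 'a
    by (intro prod_nonneg) (use one_plus_sq_pos in \<open>auto simp: less_imp_le\<close>)
  have "(\<integral>\<^sup>+x. ennreal (\<Prod>b\<in>Basis. 1 / (1 + (?h b)\<^sup>2 * ((x::'a) \<bullet> b)\<^sup>2)) \<partial>lborel)
     = (\<integral>\<^sup>+x. (\<Prod>b\<in>Basis. ennreal (1 / (1 + (?h b)\<^sup>2 * ((x::'a) \<bullet> b)\<^sup>2))) \<partial>lborel)"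
    by (intro nn_integral_cong) (auto intro!: prod_ennreal[symmetric] simp: less_imp_le[OF one_plus_sq_pos] divide_nonneg_pos[OF _ one_plus_sq_pos])
  also have "\<dots> = (\<Prod>b\<in>(Basis::'a set). \<integral>\<^sup>+t. ennreal (1 / (1 + (?h b)\<^sup>2 * t\<^sup>2)) \<partial>lborel)"
    by (rule nn_integral_lborel_prod) auto
  also have "\<dots> < \<infinity>"
    using nn_integral_Cauchy_density_finite h
    by (auto simp: less_top[symmetric] ennreal_prod_eq_top)
  finally have "integrable lborel (\<lambda>x::'a. \<Prod>b\<in>Basis. 1 / (1 + (?h b)\<^sup>2 * (x \<bullet> b)\<^sup>2))"
    using meas pos by (intro integrableI_nonneg) auto
  then show ?thesis by (simp only: eq)
qed

lemma continuous_nonneg_integral_zero: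
  fixes f :: "'a::euclidean_space \<Rightarrow> real"
  assumes c: "continuous_on UNIV f" and nn: "\<And>x. f x \<ge> 0" and i: "integrable lborel f"
    and z: "(\<integral>x. f x \<partial>lborel) = 0"
  shows "f x = 0"
proof -
  let ?S = "{x. f x \<noteq> 0}"
  have "AE x in lborel. f x = 0"
    using integral_nonneg_eq_0_iff_AE[OF i] nn z by auto
  moreover have op: "open ?S" by (intro open_Collect_neq c continuous_intros)
  ultimately have "?S \<in> null_sets lborel"
    by (subst AE_iff_null_sets) auto
  then have "negligible ?S"
    by (simp add: negligible_iff_null_sets null_sets_completionI)
  with op have "?S = {}" using open_not_negligible by blast
  then show ?thesis by auto
qed

section \<open>A Carleman estimate\<close>

text \<open>Here v = exp(\<phi>) u, where u solves \<Delta>u + V u = 0 and \<phi> = - \<delta>/2 (x_e - r0)^2, and \<sigma> is the derivative of \<phi>. Up to its sign, A is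
the antisymmetric part of the conjugated Laplacian applied to v, and eqn is the equation for v.\<close>

locale weighted_identity =
  fixes e :: "'a::euclidean_space" and h \<delta> r0 :: real
    and v V :: "'a \<Rightarrow> real" and dv :: "'a \<Rightarrow> 'a \<Rightarrow> real" and ddv :: "'a \<Rightarrow> 'a \<Rightarrow> 'a \<Rightarrow> real"
    and \<sigma> A :: "'a \<Rightarrow> real"
  assumes e: "e \<in> Basis" and h: "h > 0"
    and sigma: "\<sigma> = (\<lambda>x. - \<delta> * (x \<bullet> e - r0))"
    and A: "A = (\<lambda>x. 2 * \<sigma> x * dv e x - \<delta> * v x)"
    and dv: "\<And>b. b \<in> Basis \<Longrightarrow> has_pderiv v b (dv b)"
    and ddv: "\<And>b c. b \<in> Basis \<Longrightarrow> c \<in> Basis \<Longrightarrow> has_pderiv (dv b) c (ddv b c)"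
    and sym: "\<And>b c x. b \<in> Basis \<Longrightarrow> c \<in> Basis \<Longrightarrow> ddv b c x = ddv c b x"
    and cont_dd: "\<And>b c. b \<in> Basis \<Longrightarrow> c \<in> Basis \<Longrightarrow> continuous_on UNIV (ddv b c)"
    and eqn: "\<And>x. (\<Sum>b\<in>Basis. ddv b b x) = A x - (\<sigma> x)\<^sup>2 * v x - V x * v x"
    and cont_V: "continuous_on UNIV V"
begin

abbreviation "\<omega> \<equiv> weight e h"

text \<open>The product of two such functions is integrable against the weight.\<close>

definition root_decay :: "('a \<Rightarrow> real) \<Rightarrow> bool" where
  "root_decay f \<longleftrightarrow> continuous_on UNIV f \<and> (\<exists>K. \<forall>x. \<bar>f x\<bar> \<le> K / sqrt (1 + (x \<bullet> e)\<^sup>2))"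

lemma root_decay_cont: "root_decay f \<Longrightarrow> continuous_on UNIV f"
  by (simp add: root_decay_def)

lemma root_decay_add: assumes "root_decay f" "root_decay g" shows "root_decay (\<lambda>x. f x + g x)"
proof -
  obtain K1 K2 where K: "\<And>x. \<bar>f x\<bar> \<le> K1 / sqrt (1 + (x \<bullet> e)\<^sup>2)" "\<And>x. \<bar>g x\<bar> \<le> K2 / sqrt (1 + (x \<bullet> e)\<^sup>2)"
    using assms unfolding root_decay_def by blast
  have "\<bar>f x + g x\<bar> \<le> (K1 + K2) / sqrt (1 + (x \<bullet> e)\<^sup>2)" for x
    using K(1)[of x] K(2)[of x] by (simp add: add_divide_distrib)
  then show ?thesis using assms unfolding root_decay_def by (auto intro!: continuous_intros)
qed

lemma root_decay_bounded_mult: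
  assumes "root_decay f" and c: "continuous_on UNIV k" and k: "\<And>x. \<bar>k x\<bar> \<le> B"
  shows "root_decay (\<lambda>x. k x * f x)"
proof -
  obtain K where K: "\<And>x. \<bar>f x\<bar> \<le> K / sqrt (1 + (x \<bullet> e)\<^sup>2)"
    using assms unfolding root_decay_def by blast
  have "B \<ge> 0" using k[of 0] by simp
  then have "\<bar>k x * f x\<bar> \<le> (B * K) / sqrt (1 + (x \<bullet> e)\<^sup>2)" for x
    using mult_mono[OF k[of x] K[of x]] by (simp add: abs_mult)
  then show ?thesis using assms c unfolding root_decay_def by (auto intro!: continuous_intros)
qed

lemma root_decay_cmult: "root_decay f \<Longrightarrow> root_decay (\<lambda>x. c * f x)"
  by (rule root_decay_bounded_mult[where B = "\<bar>c\<bar>"]) auto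

lemma root_decay_diff: "root_decay f \<Longrightarrow> root_decay g \<Longrightarrow> root_decay (\<lambda>x. f x - g x)"
  using root_decay_add[of f "\<lambda>x. (-1) * g x"] root_decay_cmult[of g "-1"] by simp

lemma integrable_bounded_root_decay:
  assumes "root_decay f" "root_decay g" and c: "continuous_on UNIV k" and k: "\<And>x. \<bar>k x\<bar> \<le> B * \<omega> x"
  shows "integrable lborel (\<lambda>x. k x * (f x * g x))"
proof -
  obtain K1 K2 where K: "\<And>x. \<bar>f x\<bar> \<le> K1 / sqrt (1 + (x \<bullet> e)\<^sup>2)" "\<And>x. \<bar>g x\<bar> \<le> K2 / sqrt (1 + (x \<bullet> e)\<^sup>2)"
    using assms unfolding root_decay_def by blast
  show ?thesis
  proof (rule Bochner_Integration.integrable_bound)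
    show "integrable lborel (\<lambda>x. B * K1 * K2 * (\<omega> x * (1 / (1 + (x \<bullet> e)\<^sup>2))))"
      by (intro integrable_mult_right integrable_weight h e)
    show "(\<lambda>x. k x * (f x * g x)) \<in> borel_measurable lborel"
      using assms unfolding root_decay_def by (auto intro!: continuous_borel_measurable continuous_intros)
    show "AE x in lborel. norm (k x * (f x * g x)) \<le> norm (B * K1 * K2 * (\<omega> x * (1 / (1 + (x \<bullet> e)\<^sup>2))))"
    proof (rule AE_I2)
      fix x
      let ?s = "sqrt (1 + (x \<bullet> e)\<^sup>2)"
      have ss: "?s * ?s = 1 + (x \<bullet> e)\<^sup>2" by simp
      have "\<bar>f x * g x\<bar> \<le> (K1 / ?s) * (K2 / ?s)"
        unfolding abs_mult using K[of x] order_trans[OF abs_ge_zero K(1)[of x]] by (intro mult_mono) auto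
      then have fg: "\<bar>f x * g x\<bar> \<le> K1 * K2 * (1 / (1 + (x \<bullet> e)\<^sup>2))" using ss by simp
      have "\<bar>k x * (f x * g x)\<bar> \<le> (B * \<omega> x) * (K1 * K2 * (1 / (1 + (x \<bullet> e)\<^sup>2)))"
        unfolding abs_mult[of "k x"] using k[of x] fg order_trans[OF abs_ge_zero k[of x]] by (intro mult_mono) auto
      also have "\<dots> = B * K1 * K2 * (\<omega> x * (1 / (1 + (x \<bullet> e)\<^sup>2)))" by simp
      also have "\<dots> \<le> \<bar>B * K1 * K2 * (\<omega> x * (1 / (1 + (x \<bullet> e)\<^sup>2)))\<bar>" by (rule abs_ge_self)
      finally show "norm (k x * (f x * g x)) \<le> norm (B * K1 * K2 * (\<omega> x * (1 / (1 + (x \<bullet> e)\<^sup>2))))" by (simp only: real_norm_def)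
    qed
  qed
qed

lemma integrable_root_decay: "root_decay f \<Longrightarrow> root_decay g \<Longrightarrow> integrable lborel (\<lambda>x. \<omega> x * (f x * g x))"
  by (rule integrable_bounded_root_decay[where B = 1])
    (auto simp: weight_continuous less_imp_le[OF weight_pos])

end

text \<open>The smallness of V is needed only where the slope \<sigma> of the Gaussian exponent is below \<tau>. All small quantities are
bounded by \<kappa>, which is small in comparison with the Poincare constant 4 L^2.\<close>

locale carleman = weighted_identity +
  fixes L \<epsilon> \<tau> C \<kappa> :: real
  assumes root_decay_v: "root_decay v" "root_decay (\<lambda>x. \<sigma> x * v x)" "root_decay (\<lambda>x. (\<sigma> x)\<^sup>2 * v x)"
    and root_decay_dv: "\<And>b. b \<in> Basis \<Longrightarrow> root_decay (dv b)" "\<And>b. b \<in> Basis \<Longrightarrow> root_decay (\<lambda>x. \<sigma> x * dv b x)"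
    and L: "L > 0" and zeros: "\<And>x. \<exists>r. \<bar>r\<bar> \<le> L \<and> v (x + r *\<^sub>R e) = 0"
    and V_bound: "\<And>x. \<bar>V x\<bar> \<le> C"
    and V_small: "\<And>x. \<bar>V x\<bar> \<le> \<epsilon> \<or> \<tau> \<le> \<bar>\<sigma> x\<bar>"
    and \<tau>: "\<tau> > 0" and \<delta>: "\<delta> > 0" and \<epsilon>: "\<epsilon> > 0"
    and small: "\<delta> \<le> \<kappa>" "h * DIM('a) \<le> \<kappa>" "\<epsilon> \<le> \<kappa>" "C \<le> \<kappa> * \<tau>\<^sup>2" "C\<^sup>2 \<le> \<kappa> * \<tau>\<^sup>2"
    and \<kappa>: "\<kappa> * (1 + 4 * L\<^sup>2)\<^sup>2 \<le> 1 / 100"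
begin

definition "grad2 x = (\<Sum>b\<in>Basis. (dv b x)\<^sup>2)"

lemma cont: "continuous_on UNIV v" "continuous_on UNIV \<sigma>" "continuous_on UNIV A"
  "b \<in> Basis \<Longrightarrow> continuous_on UNIV (dv b)"
  unfolding A sigma using root_decay_v(1) root_decay_dv(1) e by (auto dest!: root_decay_cont intro!: continuous_intros)

lemma root_decay_A: "root_decay A"
  using root_decay_diff[OF root_decay_cmult[OF root_decay_dv(2)[OF e], of 2] root_decay_cmult[OF root_decay_v(1), of \<delta>]]
  by (simp add: A mult.assoc)

lemma root_decay_V: "root_decay (\<lambda>x. V x * v x)"
  by (rule root_decay_bounded_mult[OF root_decay_v(1) cont_V V_bound])

lemma sigma_pderiv: "b \<in> Basis \<Longrightarrow> has_pderiv \<sigma> b (\<lambda>x. if b = e then - \<delta> else 0)"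
  unfolding has_pderiv_def sigma using e
  by (auto simp: inner_add_left inner_not_same_Basis intro!: derivative_eq_intros)

lemma A_pderiv:
  assumes b: "b \<in> Basis"
  shows "has_pderiv A b (\<lambda>x. 2 * \<sigma> x * ddv e b x - \<delta> * dv b x - (if b = e then 2 * \<delta> * dv e x else 0))"
  unfolding has_pderiv_def
proof
  fix x
  show "((\<lambda>r. A (x + r *\<^sub>R b)) has_real_derivative 2 * \<sigma> x * ddv e b x - \<delta> * dv b x - (if b = e then 2 * \<delta> * dv e x else 0)) (at 0)"
    unfolding A
    by (rule DERIV_cong, (rule derivative_intros has_pderivD[OF sigma_pderiv[OF b]] has_pderivD[OF ddv[OF e b]] has_pderivD[OF dv[OF b]])+) auto
qed

definition "wint f = (\<integral>x. \<omega> x * f x \<partial>lborel)"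

definition "weight_integrable f \<longleftrightarrow> integrable lborel (\<lambda>x. \<omega> x * f x)"

lemma wint_add: "weight_integrable f \<Longrightarrow> weight_integrable g \<Longrightarrow> weight_integrable (\<lambda>x. f x + g x) \<and> wint (\<lambda>x. f x + g x) = wint f + wint g"
  unfolding weight_integrable_def wint_def by (simp add: distrib_left)

lemma wint_cmult: "weight_integrable f \<Longrightarrow> weight_integrable (\<lambda>x. c * f x) \<and> wint (\<lambda>x. c * f x) = c * wint f"
  unfolding weight_integrable_def wint_def by (simp add: mult.left_commute)

lemma weight_integrable_root_decay: "root_decay f \<Longrightarrow> root_decay g \<Longrightarrow> weight_integrable (\<lambda>x. f x * g x)"
  unfolding weight_integrable_def by (rule integrable_root_decay)

lemma weight_integrable_terms: "weight_integrable (\<lambda>x. (v x)\<^sup>2)" "weight_integrable (\<lambda>x. (\<sigma> x * v x)\<^sup>2)" "weight_integrable (\<lambda>x. (A x)\<^sup>2)" "weight_integrable grad2"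
proof -
  show "weight_integrable (\<lambda>x. (v x)\<^sup>2)" "weight_integrable (\<lambda>x. (\<sigma> x * v x)\<^sup>2)" "weight_integrable (\<lambda>x. (A x)\<^sup>2)"
    using root_decay_v root_decay_A by (auto simp: power2_eq_square intro!: weight_integrable_root_decay)
  have "integrable lborel (\<lambda>x. \<Sum>b\<in>Basis. \<omega> x * (dv b x * dv b x))"
    by (intro Bochner_Integration.integrable_sum integrable_root_decay root_decay_dv) auto
  then show "weight_integrable grad2" unfolding weight_integrable_def grad2_def by (simp add: sum_distrib_left power2_eq_square)
qed

lemma wint_mono_divergence:
  fixes Z Z' :: "'a \<Rightarrow> 'a \<Rightarrow> real"
  assumes "\<And>b. b \<in> Basis \<Longrightarrow> has_pderiv (Z b) b (Z' b)"
    and "\<And>b. b \<in> Basis \<Longrightarrow> continuous_on UNIV (Z b)"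
    and "\<And>b. b \<in> Basis \<Longrightarrow> continuous_on UNIV (Z' b)"
    and "\<And>b. b \<in> Basis \<Longrightarrow> integrable lborel (Z b)"
    and "integrable lborel (\<lambda>x. \<Sum>b\<in>Basis. Z' b x)"
    and f: "weight_integrable f" and le: "\<And>x. \<omega> x * f x \<le> (\<Sum>b\<in>Basis. Z' b x)"
  shows "wint f \<le> 0"
proof -
  have "wint f \<le> (\<integral>x. (\<Sum>b\<in>Basis. Z' b x) \<partial>lborel)"
    unfolding wint_def using assms(5) f le by (intro integral_mono) (auto simp: weight_integrable_def)
  also have "\<dots> = 0" by (rule integral_divergence_zero[OF assms(1-5)])
  finally show ?thesis .
qed

lemma weight'_root_decay_integrable:
  "root_decay f \<Longrightarrow> root_decay g \<Longrightarrow> integrable lborel (\<lambda>x. weight' e h b x * (f x * g x))"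
  by (rule integrable_bounded_root_decay[where B = h]) (auto intro: weight'_continuous weight'_bound[OF h])

text \<open>The terms with derivatives of the weight are absorbed with Young's inequality, at the price of the small factor h DIM('a).\<close>

lemma weight_error:
  "(\<Sum>b\<in>Basis. weight' e h b x * (f * dv b x)) \<ge> - \<omega> x * (\<kappa> / 2 * (f\<^sup>2 + grad2 x))"
proof -
  have summand: "- (h * \<omega> x / 2 * (f\<^sup>2 + (dv b x)\<^sup>2)) \<le> weight' e h b x * (f * dv b x)" for b
  proof -
    have "2 * \<bar>f * dv b x\<bar> \<le> f\<^sup>2 + (dv b x)\<^sup>2"
      using zero_le_power2[of "\<bar>f\<bar> - \<bar>dv b x\<bar>"] by (simp add: power2_diff abs_mult)
    then have "\<bar>weight' e h b x\<bar> * (2 * \<bar>f * dv b x\<bar>) \<le> h * \<omega> x * (f\<^sup>2 + (dv b x)\<^sup>2)"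
      by (intro mult_mono weight'_bound[OF h]) (use h weight_pos[of e h x] in auto)
    then have "\<bar>weight' e h b x * (f * dv b x)\<bar> \<le> h * \<omega> x / 2 * (f\<^sup>2 + (dv b x)\<^sup>2)" by (simp add: abs_mult)
    then show ?thesis by (simp add: abs_le_iff)
  qed
  have n1: "1 \<le> real DIM('a)" using DIM_positive[where 'a='a] by linarith
  have "h * 1 \<le> h * real DIM('a)" using h n1 by (intro mult_left_mono) auto
  then have h\<kappa>: "h \<le> \<kappa>" "h * DIM('a) \<le> \<kappa>" using small(2) by auto
  have g0: "0 \<le> grad2 x" by (simp add: grad2_def sum_nonneg)
  have "(h * DIM('a)) * f\<^sup>2 + h * grad2 x \<le> \<kappa> * f\<^sup>2 + \<kappa> * grad2 x"
    using h\<kappa> g0 by (intro add_mono mult_right_mono) auto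
  then have "\<omega> x / 2 * ((h * DIM('a)) * f\<^sup>2 + h * grad2 x) \<le> \<omega> x / 2 * (\<kappa> * f\<^sup>2 + \<kappa> * grad2 x)"
    using weight_pos[of e h x] by (intro mult_left_mono) auto
  moreover have "- (\<omega> x / 2 * ((h * DIM('a)) * f\<^sup>2 + h * grad2 x)) = (\<Sum>b\<in>(Basis::'a set). - (h * \<omega> x / 2 * (f\<^sup>2 + (dv b x)\<^sup>2)))"
  proof -
    have "(\<Sum>b\<in>(Basis::'a set). - (h * \<omega> x / 2 * (f\<^sup>2 + (dv b x)\<^sup>2))) = - (h * \<omega> x / 2 * (DIM('a) * f\<^sup>2 + grad2 x))"
      by (simp only: grad2_def sum_negf sum_distrib_left[symmetric] sum.distrib sum_constant)
    then show ?thesis by (simp add: algebra_simps)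
  qed
  moreover have "(\<Sum>b\<in>(Basis::'a set). - (h * \<omega> x / 2 * (f\<^sup>2 + (dv b x)\<^sup>2))) \<le> (\<Sum>b\<in>Basis. weight' e h b x * (f * dv b x))"
    by (intro sum_mono summand)
  ultimately show ?thesis by (simp add: algebra_simps)
qed

text \<open>Where V is not small, 1 is at most \<sigma>^2/\<tau>^2. So the potential term is controlled by v and \<sigma> v, with a small factor.\<close>

lemma V_split: "(V x * v x)\<^sup>2 \<le> \<kappa> * (v x)\<^sup>2 + \<kappa> * (\<sigma> x * v x)\<^sup>2" "V x * (v x)\<^sup>2 \<le> \<kappa> * (v x)\<^sup>2 + \<kappa> * (\<sigma> x * v x)\<^sup>2"
proof -
  have k0: "0 < \<kappa>" using small(3) \<epsilon> by simp
  have "\<kappa> * 1 \<le> \<kappa> * (1 + 4 * L\<^sup>2)\<^sup>2" using k0 by (intro mult_left_mono) (auto simp: one_le_power)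
  then have k1: "\<kappa> \<le> 1" using \<kappa> by simp
  have C: "C \<ge> 0" using V_bound[of 0] by simp
  have "(V x)\<^sup>2 \<le> \<kappa> + \<kappa> * (\<sigma> x)\<^sup>2 \<and> V x \<le> \<kappa> + \<kappa> * (\<sigma> x)\<^sup>2"
    using V_small[of x]
  proof
    assume a: "\<bar>V x\<bar> \<le> \<epsilon>"
    then have "\<bar>V x\<bar> \<le> \<kappa>" using small(3) by simp
    moreover then have "\<bar>V x\<bar> * \<bar>V x\<bar> \<le> \<kappa> * 1" using k1 by (intro mult_mono) auto
    moreover have "0 \<le> \<kappa> * (\<sigma> x)\<^sup>2" using k0 by simp
    ultimately show ?thesis unfolding power2_eq_square[of "V x"] by (intro conjI; linarith)
  next
    assume t: "\<tau> \<le> \<bar>\<sigma> x\<bar>"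
    have "\<tau>\<^sup>2 \<le> (\<sigma> x)\<^sup>2" using power_mono[OF t, of 2] \<tau> by simp
    then have "\<kappa> * \<tau>\<^sup>2 \<le> \<kappa> * (\<sigma> x)\<^sup>2" using k0 by simp
    moreover have "(V x)\<^sup>2 \<le> C\<^sup>2" using power_mono[OF V_bound[of x], of 2] by simp
    moreover have "V x \<le> C" using V_bound[of x] by simp
    ultimately show ?thesis using small(4,5) k0 by (intro conjI; linarith)
  qed
  then have "(V x)\<^sup>2 * (v x)\<^sup>2 \<le> (\<kappa> + \<kappa> * (\<sigma> x)\<^sup>2) * (v x)\<^sup>2" "V x * (v x)\<^sup>2 \<le> (\<kappa> + \<kappa> * (\<sigma> x)\<^sup>2) * (v x)\<^sup>2"
    by (auto intro: mult_right_mono)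
  then show "(V x * v x)\<^sup>2 \<le> \<kappa> * (v x)\<^sup>2 + \<kappa> * (\<sigma> x * v x)\<^sup>2" "V x * (v x)\<^sup>2 \<le> \<kappa> * (v x)\<^sup>2 + \<kappa> * (\<sigma> x * v x)\<^sup>2"
    by (auto simp: power_mult_distrib algebra_simps)
qed

text \<open>Multiply the equation by v and integrate. The antisymmetric part contributes the exact derivative of \<sigma> v^2.\<close>

lemma gradient_estimate:
  "wint grad2 \<le> wint (\<lambda>x. (\<sigma> x * v x)\<^sup>2) + \<kappa> * wint (\<lambda>x. (\<sigma> x * v x)\<^sup>2) + 3 / 2 * \<kappa> * wint (\<lambda>x. (v x)\<^sup>2) + \<kappa> / 2 * wint grad2"
proof -
  let ?f = "\<lambda>x. (1 - \<kappa> / 2) * grad2 x + ((- 1 - \<kappa>) * (\<sigma> x * v x)\<^sup>2 + (- 3 / 2 * \<kappa>) * (v x)\<^sup>2)"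
  define Z where "Z b x = \<omega> x * (v x * dv b x) - (if b = e then \<omega> x * ((\<sigma> x * v x) * v x) else 0)" for b x
  define Z' where "Z' b x = weight' e h b x * (v x * dv b x) + \<omega> x * (dv b x * dv b x + v x * ddv b b x)
      - (if b = e then \<omega> x * (- \<delta> * (v x * v x) + 2 * ((\<sigma> x * v x) * dv e x)) else 0)" for b x
  have Zd: "has_pderiv (Z b) b (Z' b)" if b: "b \<in> Basis" for b
    unfolding has_pderiv_def
  proof
    fix x
    note ds = has_pderivD[OF sigma_pderiv[OF b], of x] has_pderivD[OF dv[OF b], of x]
      has_pderivD[OF ddv[OF b b], of x] has_pderivD[OF weight_pderiv[OF e b, of h], of x]
    show "((\<lambda>r. Z b (x + r *\<^sub>R b)) has_real_derivative Z' b x) (at 0)"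
    proof (cases "b = e")
      case True
      show ?thesis unfolding Z_def Z'_def using True
        by (simp only: if_True simp_thms) (rule DERIV_cong, (rule derivative_intros ds[unfolded True])+,
          simp add: algebra_simps weight'_def)
    next
      case False
      show ?thesis unfolding Z_def Z'_def using False
        by (simp only: if_False simp_thms) (rule DERIV_cong, (rule derivative_intros ds)+, simp add: algebra_simps)
    qed
  qed
  have sumZ': "(\<Sum>b\<in>Basis. Z' b x) = (\<Sum>b\<in>Basis. weight' e h b x * (v x * dv b x))
      + \<omega> x * (grad2 x - (\<sigma> x * v x)\<^sup>2 - V x * (v x)\<^sup>2)" for x
  proof -
    have "(\<Sum>b\<in>Basis. Z' b x) = (\<Sum>b\<in>Basis. weight' e h b x * (v x * dv b x))
       + \<omega> x * (grad2 x + v x * (\<Sum>b\<in>Basis. ddv b b x)) - \<omega> x * (- \<delta> * (v x * v x) + 2 * ((\<sigma> x * v x) * dv e x))"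
      using e by (simp add: Z'_def sum.distrib sum_subtractf sum_distrib_left[symmetric] grad2_def power2_eq_square distrib_left)
    then show ?thesis unfolding eqn by (simp add: A power2_eq_square algebra_simps)
  qed
  have "wint ?f \<le> 0"
  proof (rule wint_mono_divergence[OF Zd])
    show "weight_integrable ?f" using weight_integrable_terms wint_add wint_cmult by presburger
    show "\<omega> x * ?f x \<le> (\<Sum>b\<in>Basis. Z' b x)" for x
    proof -
      have "\<omega> x * ?f x = - \<omega> x * (\<kappa> / 2 * ((v x)\<^sup>2 + grad2 x)) + \<omega> x * (grad2 x - (\<sigma> x * v x)\<^sup>2 - (\<kappa> * (v x)\<^sup>2 + \<kappa> * (\<sigma> x * v x)\<^sup>2))"
        by (simp add: algebra_simps)
      also have "\<dots> \<le> (\<Sum>b\<in>Basis. weight' e h b x * (v x * dv b x)) + \<omega> x * (grad2 x - (\<sigma> x * v x)\<^sup>2 - V x * (v x)\<^sup>2)"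
        using V_split(2)[of x] weight_pos[of e h x] by (intro add_mono weight_error mult_left_mono) auto
      finally show ?thesis unfolding sumZ' .
    qed
    show "continuous_on UNIV (Z b)" if "b \<in> Basis" for b
      unfolding Z_def using that by (cases "b = e") (auto intro!: continuous_intros cont weight_continuous)
    show "continuous_on UNIV (Z' b)" if "b \<in> Basis" for b
      unfolding Z'_def using that by (cases "b = e") (auto intro!: continuous_intros cont weight_continuous weight'_continuous cont_dd)
    show "integrable lborel (Z b)" if "b \<in> Basis" for b
      unfolding Z_def using that
      by (cases "b = e") (auto intro!: Bochner_Integration.integrable_diff integrable_root_decay root_decay_v root_decay_dv)
    have "integrable lborel (\<lambda>x. \<omega> x * grad2 x - \<omega> x * ((\<sigma> x * v x) * (\<sigma> x * v x)) - \<omega> x * ((V x * v x) * v x))"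
      using weight_integrable_terms(4) unfolding weight_integrable_def
      by (intro Bochner_Integration.integrable_diff integrable_root_decay root_decay_v root_decay_V) auto
    then have "integrable lborel (\<lambda>x. \<omega> x * (grad2 x - (\<sigma> x * v x)\<^sup>2 - V x * (v x)\<^sup>2))"
      by (simp add: right_diff_distrib power2_eq_square mult.assoc)
    then show "integrable lborel (\<lambda>x. \<Sum>b\<in>Basis. Z' b x)"
      unfolding sumZ' by (intro Bochner_Integration.integrable_add Bochner_Integration.integrable_sum weight'_root_decay_integrable root_decay_v root_decay_dv) auto
  qed
  moreover have "wint ?f = (1 - \<kappa> / 2) * wint grad2 + ((- 1 - \<kappa>) * wint (\<lambda>x. (\<sigma> x * v x)\<^sup>2) + (- 3 / 2 * \<kappa>) * wint (\<lambda>x. (v x)\<^sup>2))"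
    using weight_integrable_terms wint_add wint_cmult by presburger
  ultimately show ?thesis by (simp add: algebra_simps)
qed

text \<open>Multiply the equation by A and integrate. Besides A^2 and the terms with V and with derivatives of the weight, only the commutator of the symmetric and the antisymmetric
part remains, and it is of order \<delta> because \<sigma> has the constant derivative - \<delta>.\<close>

lemma commutator_estimate:
  "3 / 4 * wint (\<lambda>x. (A x)\<^sup>2) \<le> \<kappa> / 2 * wint (\<lambda>x. (A x)\<^sup>2) + 5 / 2 * \<kappa> * wint grad2
     + 3 * \<kappa> * wint (\<lambda>x. (\<sigma> x * v x)\<^sup>2) + \<kappa> * wint (\<lambda>x. (v x)\<^sup>2)"
proof -
  let ?f = "\<lambda>x. (3 / 4 - \<kappa> / 2) * (A x)\<^sup>2 + ((- 5 / 2 * \<kappa>) * grad2 x + ((- 3 * \<kappa>) * (\<sigma> x * v x)\<^sup>2 + (- \<kappa>) * (v x)\<^sup>2))"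
  define Z where "Z b x = \<omega> x * (A x * dv b x)
      - (if b = e then \<omega> x * (\<Sum>c\<in>Basis. (\<sigma> x * dv c x) * dv c x) - \<omega> x * (((\<sigma> x)\<^sup>2 * v x) * (\<sigma> x * v x)) else 0)" for b x
  define Z' where "Z' b x = weight' e h b x * (A x * dv b x)
      + \<omega> x * ((2 * \<sigma> x * ddv e b x - \<delta> * dv b x - (if b = e then 2 * \<delta> * dv e x else 0)) * dv b x + A x * ddv b b x)
      - (if b = e then \<omega> x * (\<Sum>c\<in>Basis. - \<delta> * (dv c x * dv c x) + 2 * \<sigma> x * (dv c x * ddv c e x))
           - \<omega> x * (- 3 * \<delta> * (\<sigma> x)\<^sup>2 * (v x)\<^sup>2 + 2 * (\<sigma> x)^3 * v x * dv e x) else 0)" for b x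
  have Zd: "has_pderiv (Z b) b (Z' b)" if b: "b \<in> Basis" for b
    unfolding has_pderiv_def
  proof
    fix x
    note ds = has_pderivD[OF sigma_pderiv[OF b], of x] has_pderivD[OF dv[OF b], of x]
      has_pderivD[OF ddv[OF b b], of x] has_pderivD[OF weight_pderiv[OF e b, of h], of x] has_pderivD[OF A_pderiv[OF b], of x]
    have 1: "((\<lambda>r. \<omega> (x + r *\<^sub>R b) * (A (x + r *\<^sub>R b) * dv b (x + r *\<^sub>R b))) has_real_derivative
       weight' e h b x * (A x * dv b x)
      + \<omega> x * ((2 * \<sigma> x * ddv e b x - \<delta> * dv b x - (if b = e then 2 * \<delta> * dv e x else 0)) * dv b x + A x * ddv b b x)) (at 0)"
      by (rule DERIV_cong, (rule derivative_intros ds)+) (simp add: algebra_simps)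
    show "((\<lambda>r. Z b (x + r *\<^sub>R b)) has_real_derivative Z' b x) (at 0)"
    proof (cases "b = e")
      case True
      have s: "((\<lambda>r. \<sigma> (x + r *\<^sub>R e)) has_real_derivative - \<delta>) (at 0)"
        using has_pderivD[OF sigma_pderiv[OF e], of x] by simp
      have dc: "((\<lambda>r. (\<sigma> (x + r *\<^sub>R e) * dv c (x + r *\<^sub>R e)) * dv c (x + r *\<^sub>R e)) has_real_derivative
          - \<delta> * (dv c x * dv c x) + 2 * \<sigma> x * (dv c x * ddv c e x)) (at 0)" if c: "c \<in> Basis" for c
        by (rule DERIV_cong, (rule derivative_intros s has_pderivD[OF ddv[OF c e]])+) (simp add: algebra_simps)
      have w: "\<omega> (x + r *\<^sub>R e) = \<omega> x" for r by (rule weight_invariant[OF e])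
      have v3: "((\<lambda>r. ((\<sigma> (x + r *\<^sub>R e))\<^sup>2 * v (x + r *\<^sub>R e)) * (\<sigma> (x + r *\<^sub>R e) * v (x + r *\<^sub>R e))) has_real_derivative
          - 3 * \<delta> * (\<sigma> x)\<^sup>2 * (v x)\<^sup>2 + 2 * (\<sigma> x)^3 * v x * dv e x) (at 0)"
        by (rule DERIV_cong, (rule derivative_intros s has_pderivD[OF dv[OF e]])+) (simp add: algebra_simps power2_eq_square power3_eq_cube)
      have "((\<lambda>r. \<omega> x * (\<Sum>c\<in>Basis. (\<sigma> (x + r *\<^sub>R e) * dv c (x + r *\<^sub>R e)) * dv c (x + r *\<^sub>R e))
            - \<omega> x * (((\<sigma> (x + r *\<^sub>R e))\<^sup>2 * v (x + r *\<^sub>R e)) * (\<sigma> (x + r *\<^sub>R e) * v (x + r *\<^sub>R e)))) has_real_derivative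
          \<omega> x * (\<Sum>c\<in>Basis. - \<delta> * (dv c x * dv c x) + 2 * \<sigma> x * (dv c x * ddv c e x))
           - \<omega> x * (- 3 * \<delta> * (\<sigma> x)\<^sup>2 * (v x)\<^sup>2 + 2 * (\<sigma> x)^3 * v x * dv e x)) (at 0)"
        by (intro DERIV_diff DERIV_cmult DERIV_sum dc v3)
      from DERIV_diff[OF 1[unfolded True] this] show ?thesis
        unfolding Z_def Z'_def True by (simp add: w)
    next
      case False
      show ?thesis unfolding Z_def Z'_def using False 1 by simp
    qed
  qed
  have sumZ': "(\<Sum>b\<in>Basis. Z' b x) = (\<Sum>b\<in>Basis. weight' e h b x * (A x * dv b x))
      + \<omega> x * ((A x)\<^sup>2 - V x * v x * A x - 2 * \<delta> * (dv e x)\<^sup>2 - 2 * \<delta> * (\<sigma> x * v x)\<^sup>2)" for x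
  proof -
    let ?M = "\<Sum>c\<in>Basis. dv c x * ddv c e x"
    have M: "(\<Sum>c\<in>Basis. dv c x * ddv e c x) = ?M" by (intro sum.cong refl) (simp add: sym e)
    define X where "X b = (2 * \<sigma> x * ddv e b x - \<delta> * dv b x - (if b = e then 2 * \<delta> * dv e x else 0)) * dv b x + A x * ddv b b x" for b
    define Y where "Y = (\<Sum>c\<in>Basis. - \<delta> * (dv c x * dv c x) + 2 * \<sigma> x * (dv c x * ddv c e x))"
    have s1: "(\<Sum>b\<in>Basis. X b)
      = 2 * \<sigma> x * ?M - \<delta> * grad2 x - 2 * \<delta> * (dv e x)\<^sup>2 + A x * (\<Sum>b\<in>Basis. ddv b b x)"
    proof -
      have "(2 * \<sigma> x * ddv e b x - \<delta> * dv b x - (if b = e then 2 * \<delta> * dv e x else 0)) * dv b x + A x * ddv b b x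
        = 2 * \<sigma> x * (dv b x * ddv e b x) - \<delta> * (dv b x)\<^sup>2 - (if b = e then 2 * \<delta> * (dv e x)\<^sup>2 else 0) + A x * ddv b b x" for b
        by (simp add: power2_eq_square algebra_simps)
      then show ?thesis
        using e by (simp add: X_def sum.distrib sum_subtractf sum_distrib_left[symmetric] grad2_def M)
    qed
    have s2: "Y = - \<delta> * grad2 x + 2 * \<sigma> x * ?M"
      by (simp add: Y_def sum.distrib sum_distrib_left[symmetric] grad2_def power2_eq_square sum_negf sum_subtractf)
    have "(\<Sum>b\<in>Basis. Z' b x) = (\<Sum>b\<in>Basis. weight' e h b x * (A x * dv b x))
       + \<omega> x * (2 * \<sigma> x * ?M - \<delta> * grad2 x - 2 * \<delta> * (dv e x)\<^sup>2 + A x * (\<Sum>b\<in>Basis. ddv b b x))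
       - (\<omega> x * (- \<delta> * grad2 x + 2 * \<sigma> x * ?M) - \<omega> x * (- 3 * \<delta> * (\<sigma> x)\<^sup>2 * (v x)\<^sup>2 + 2 * (\<sigma> x)^3 * v x * dv e x))"
      unfolding s1[symmetric] s2[symmetric]
      unfolding Z'_def X_def[symmetric] Y_def[symmetric]
      using e by (simp add: sum.distrib sum_subtractf sum_distrib_left[symmetric])
    also have "\<dots> = (\<Sum>b\<in>Basis. weight' e h b x * (A x * dv b x))
      + \<omega> x * ((A x)\<^sup>2 - V x * v x * A x - 2 * \<delta> * (dv e x)\<^sup>2 - 2 * \<delta> * (\<sigma> x * v x)\<^sup>2)"
      unfolding eqn by (simp add: A power2_eq_square power3_eq_cube algebra_simps)
    finally show ?thesis .
  qed
  have k0: "0 < \<kappa>" using small(3) \<epsilon> by simp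
  have "wint ?f \<le> 0"
  proof (rule wint_mono_divergence[OF Zd])
    show "weight_integrable ?f" using weight_integrable_terms wint_add wint_cmult by presburger
    show "\<omega> x * ?f x \<le> (\<Sum>b\<in>Basis. Z' b x)" for x
    proof -
      have "\<bar>(V x * v x) * A x\<bar> \<le> (V x * v x)\<^sup>2 + (A x)\<^sup>2 / 4"
        using zero_le_power2[of "\<bar>V x * v x\<bar> - \<bar>A x\<bar> / 2"] by (simp add: power2_diff abs_mult power_divide power_mult_distrib)
      then have VA: "V x * v x * A x \<le> \<kappa> * (v x)\<^sup>2 + \<kappa> * (\<sigma> x * v x)\<^sup>2 + (A x)\<^sup>2 / 4"
        using V_split(1)[of x] by (simp add: abs_le_iff)
      have "(dv e x)\<^sup>2 \<le> grad2 x" unfolding grad2_def by (rule member_le_sum) (use e in auto)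
      then have "2 * \<delta> * (dv e x)\<^sup>2 \<le> 2 * \<kappa> * grad2 x" using \<delta> small(1) by (intro mult_mono) auto
      moreover have "2 * \<delta> * (\<sigma> x * v x)\<^sup>2 \<le> 2 * \<kappa> * (\<sigma> x * v x)\<^sup>2" using small(1) by (intro mult_right_mono) auto
      ultimately have low: "3 / 4 * (A x)\<^sup>2 - 2 * \<kappa> * grad2 x - 3 * \<kappa> * (\<sigma> x * v x)\<^sup>2 - \<kappa> * (v x)\<^sup>2
          \<le> (A x)\<^sup>2 - V x * v x * A x - 2 * \<delta> * (dv e x)\<^sup>2 - 2 * \<delta> * (\<sigma> x * v x)\<^sup>2"
        using VA by linarith
      have "\<omega> x * ?f x = - \<omega> x * (\<kappa> / 2 * ((A x)\<^sup>2 + grad2 x))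
          + \<omega> x * (3 / 4 * (A x)\<^sup>2 - 2 * \<kappa> * grad2 x - 3 * \<kappa> * (\<sigma> x * v x)\<^sup>2 - \<kappa> * (v x)\<^sup>2)"
        by (simp add: algebra_simps)
      also have "\<dots> \<le> (\<Sum>b\<in>Basis. Z' b x)"
        unfolding sumZ' using low weight_pos[of e h x] by (intro add_mono weight_error mult_left_mono) auto
      finally show ?thesis .
    qed
    show "continuous_on UNIV (Z b)" if "b \<in> Basis" for b
      unfolding Z_def using that by (cases "b = e") (auto intro!: continuous_intros cont weight_continuous)
    show "continuous_on UNIV (Z' b)" if "b \<in> Basis" for b
      unfolding Z'_def using that e
      by (cases "b = e") (auto intro!: continuous_intros cont weight_continuous weight'_continuous cont_dd)
    show "integrable lborel (Z b)" if "b \<in> Basis" for b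
      unfolding Z_def sum_distrib_left using that
      by (cases "b = e") (auto intro!: Bochner_Integration.integrable_diff Bochner_Integration.integrable_sum integrable_root_decay root_decay_v root_decay_dv root_decay_A)
    have "integrable lborel (\<lambda>x. \<omega> x * (A x * A x) - \<omega> x * ((V x * v x) * A x) - 2 * \<delta> * (\<omega> x * (dv e x * dv e x))
        - 2 * \<delta> * (\<omega> x * ((\<sigma> x * v x) * (\<sigma> x * v x))))"
      by (intro Bochner_Integration.integrable_diff integrable_mult_right integrable_root_decay root_decay_v root_decay_V root_decay_A root_decay_dv e)
    then have "integrable lborel (\<lambda>x. \<omega> x * ((A x)\<^sup>2 - V x * v x * A x - 2 * \<delta> * (dv e x)\<^sup>2 - 2 * \<delta> * (\<sigma> x * v x)\<^sup>2))"
      by (simp add: right_diff_distrib power2_eq_square mult_ac)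
    then show "integrable lborel (\<lambda>x. \<Sum>b\<in>Basis. Z' b x)"
      unfolding sumZ' by (intro Bochner_Integration.integrable_add Bochner_Integration.integrable_sum weight'_root_decay_integrable root_decay_A root_decay_dv) auto
  qed
  moreover have "wint ?f = (3 / 4 - \<kappa> / 2) * wint (\<lambda>x. (A x)\<^sup>2) + ((- 5 / 2 * \<kappa>) * wint grad2 + ((- 3 * \<kappa>) * wint (\<lambda>x. (\<sigma> x * v x)\<^sup>2) + (- \<kappa>) * wint (\<lambda>x. (v x)\<^sup>2)))"
    using weight_integrable_terms wint_add wint_cmult by presburger
  ultimately show ?thesis by (simp add: algebra_simps)
qed

lemma wint_mono: "weight_integrable f \<Longrightarrow> weight_integrable g \<Longrightarrow> (\<And>x. f x \<le> g x) \<Longrightarrow> wint f \<le> wint g"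
  unfolding wint_def weight_integrable_def using weight_pos[of e h] by (intro integral_mono mult_left_mono) (auto simp: less_imp_le)

lemma wint_nonneg: "(\<And>x. f x \<ge> 0) \<Longrightarrow> wint f \<ge> 0"
  unfolding wint_def using weight_pos[of e h] by (intro Bochner_Integration.integral_nonneg mult_nonneg_nonneg) (auto simp: less_imp_le)

lemma Poincare_v: "wint (\<lambda>x. (v x)\<^sup>2) \<le> 4 * L\<^sup>2 * wint grad2"
proof -
  have g: "weight_integrable (\<lambda>x. (dv e x)\<^sup>2)" using root_decay_dv(1)[OF e] by (auto simp: power2_eq_square intro!: weight_integrable_root_decay)
  have "wint (\<lambda>x. (v x)\<^sup>2) \<le> 4 * L\<^sup>2 * wint (\<lambda>x. (dv e x)\<^sup>2)"
    unfolding wint_def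
    by (rule weighted_Poincare[OF L dv[OF e] cont(1) cont(4)[OF e] weight_continuous _ weight_invariant[OF e] zeros])
      (use weight_integrable_terms g in \<open>auto simp: weight_integrable_def less_imp_le[OF weight_pos]\<close>)
  also have "wint (\<lambda>x. (dv e x)\<^sup>2) \<le> wint grad2"
    by (rule wint_mono[OF g weight_integrable_terms(4)]) (auto simp: grad2_def intro!: member_le_sum e)
  finally show ?thesis using L by simp
qed

text \<open>The derivative of \<sigma> v is (A - \<delta> v)/2, and \<sigma> v has the zeros of v. So A controls \<sigma> v.\<close>

lemma Poincare_sigma_v: "wint (\<lambda>x. (\<sigma> x * v x)\<^sup>2) \<le> 4 * L\<^sup>2 * (1 / 2 * wint (\<lambda>x. (A x)\<^sup>2) + 1 / 2 * \<delta>\<^sup>2 * wint (\<lambda>x. (v x)\<^sup>2))"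
proof -
  let ?z' = "\<lambda>x. \<sigma> x * dv e x - \<delta> * v x"
  have z: "has_pderiv (\<lambda>x. \<sigma> x * v x) e ?z'"
    unfolding has_pderiv_def
    by (intro allI) (rule DERIV_cong, (rule derivative_intros has_pderivD[OF sigma_pderiv[OF e]] has_pderivD[OF dv[OF e]])+, simp)
  have hz: "root_decay ?z'" by (intro root_decay_diff root_decay_cmult root_decay_dv root_decay_v e)
  have g: "weight_integrable (\<lambda>x. (?z' x)\<^sup>2)" using weight_integrable_root_decay[OF hz hz] by (simp add: power2_eq_square)
  have "wint (\<lambda>x. (\<sigma> x * v x)\<^sup>2) \<le> 4 * L\<^sup>2 * wint (\<lambda>x. (?z' x)\<^sup>2)"
    unfolding wint_def
  proof (rule weighted_Poincare[OF L z _ root_decay_cont[OF hz] weight_continuous _ weight_invariant[OF e]])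
    show "\<exists>r. \<bar>r\<bar> \<le> L \<and> \<sigma> (x + r *\<^sub>R e) * v (x + r *\<^sub>R e) = 0" for x using zeros[of x] by auto
  qed (use weight_integrable_terms g in \<open>auto simp: weight_integrable_def less_imp_le[OF weight_pos] intro!: continuous_intros cont\<close>)
  also have "wint (\<lambda>x. (?z' x)\<^sup>2) \<le> wint (\<lambda>x. 1 / 2 * (A x)\<^sup>2 + 1 / 2 * \<delta>\<^sup>2 * (v x)\<^sup>2)"
  proof (rule wint_mono[OF g])
    show "weight_integrable (\<lambda>x. 1 / 2 * (A x)\<^sup>2 + 1 / 2 * \<delta>\<^sup>2 * (v x)\<^sup>2)"
      using weight_integrable_terms wint_add wint_cmult by presburger
    show "(?z' x)\<^sup>2 \<le> 1 / 2 * (A x)\<^sup>2 + 1 / 2 * \<delta>\<^sup>2 * (v x)\<^sup>2" for x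
    proof -
      have z2: "?z' x = A x / 2 - \<delta> * v x / 2" by (simp add: A field_simps)
      have "(A x / 2 - \<delta> * v x / 2)\<^sup>2 + (A x / 2 + \<delta> * v x / 2)\<^sup>2 = 1 / 2 * (A x)\<^sup>2 + 1 / 2 * \<delta>\<^sup>2 * (v x)\<^sup>2"
        by (simp add: power2_eq_square field_simps)
      then show ?thesis unfolding z2 using zero_le_power2[of "A x / 2 + \<delta> * v x / 2"] by linarith
    qed
  qed
  also have "wint (\<lambda>x. 1 / 2 * (A x)\<^sup>2 + 1 / 2 * \<delta>\<^sup>2 * (v x)\<^sup>2) = 1 / 2 * wint (\<lambda>x. (A x)\<^sup>2) + 1 / 2 * \<delta>\<^sup>2 * wint (\<lambda>x. (v x)\<^sup>2)"
    using weight_integrable_terms wint_add wint_cmult by presburger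
  finally show ?thesis using L by simp
qed

text \<open>The estimates close in a circle: A controls \<sigma> v by the Poincare inequality, \<sigma> v controls the gradient, the gradient controls v by the Poincare inequality, and all of them
together control A with a factor less than 1.\<close>

lemma vanishing: "v x = 0"
proof -
  define a where "a = wint (\<lambda>x. (A x)\<^sup>2)"
  define b where "b = wint (\<lambda>x. (\<sigma> x * v x)\<^sup>2)"
  define d where "d = wint (\<lambda>x. (v x)\<^sup>2)"
  define g where "g = wint grad2"
  define P where "P = 4 * L\<^sup>2"
  have nn: "a \<ge> 0" "b \<ge> 0" "d \<ge> 0" "g \<ge> 0"
    by (auto simp: a_def b_def d_def g_def grad2_def intro!: wint_nonneg sum_nonneg)
  have P: "P \<ge> 0" by (simp add: P_def)
  have k0: "0 < \<kappa>" using small(3) \<epsilon> by simp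
  have kk: "\<kappa> + 2 * (\<kappa> * P) + \<kappa> * (P * P) \<le> 1 / 100"
  proof -
    have "\<kappa> * (1 + P)\<^sup>2 \<le> 1 / 100" using \<kappa> by (simp add: P_def)
    then show ?thesis by (simp add: power2_eq_square algebra_simps)
  qed
  have k: "\<kappa> \<le> 1 / 100" "\<kappa> * P \<le> 1 / 100" "\<kappa> * (P * P) \<le> 1 / 100"
  proof -
    have "0 \<le> \<kappa> * P" "0 \<le> \<kappa> * (P * P)" using k0 P by simp_all
    then show "\<kappa> \<le> 1 / 100" "\<kappa> * P \<le> 1 / 100" "\<kappa> * (P * P) \<le> 1 / 100"
      using kk k0 by linarith+
  qed
  have 2: "d \<le> P * g" using Poincare_v by (simp add: d_def g_def P_def)
  have kd: "\<kappa> * d \<le> (\<kappa> * P) * g" using mult_left_mono[OF 2, of \<kappa>] k0 by (simp add: mult_ac)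
  have kPg: "(\<kappa> * P) * g \<le> 1 / 100 * g" using k nn by (intro mult_right_mono) auto
  have kb: "\<kappa> * b \<le> 1 / 100 * b" and kg: "\<kappa> * g \<le> 1 / 100 * g" and ka: "\<kappa> * a \<le> 1 / 100 * a"
    using mult_right_mono[OF k(1) nn(2)] mult_right_mono[OF k(1) nn(4)] mult_right_mono[OF k(1) nn(1)] .
  have "g \<le> b + \<kappa> * b + 3 / 2 * (\<kappa> * d) + 1 / 2 * (\<kappa> * g)"
    using gradient_estimate by (simp add: g_def b_def d_def mult_ac)
  then have 3: "g \<le> 11 / 10 * b" using kd kPg kb kg nn by linarith
  have "\<delta>\<^sup>2 \<le> \<kappa> * 1" unfolding power2_eq_square using small(1) k k0 \<delta> by (intro mult_mono) auto
  then have \<delta>d: "\<delta>\<^sup>2 * d \<le> \<kappa> * d" using nn by (intro mult_right_mono) auto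
  have "b \<le> P * (1 / 2 * a + 1 / 2 * (\<delta>\<^sup>2 * d))"
    using Poincare_sigma_v unfolding a_def b_def d_def P_def by (simp only: mult.assoc)
  also have "\<dots> \<le> P * (1 / 2 * a + 1 / 2 * (\<kappa> * P * g))"
    by (intro mult_left_mono P) (use \<delta>d kd in linarith)
  also have "\<dots> = 1 / 2 * (P * a) + 1 / 2 * ((\<kappa> * (P * P)) * g)" by (simp add: algebra_simps)
  also have "\<dots> \<le> 1 / 2 * (P * a) + 1 / 2 * (1 / 100 * g)"
    using k nn by (intro add_mono mult_left_mono mult_right_mono) auto
  finally have 1: "b \<le> 3 / 5 * (P * a)" using 3 nn mult_nonneg_nonneg[OF P nn(1)] by linarith
  have kb': "\<kappa> * b \<le> 3 / 5 * ((\<kappa> * P) * a)" using mult_left_mono[OF 1, of \<kappa>] k0 by (simp add: mult_ac)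
  have kPa: "(\<kappa> * P) * a \<le> 1 / 100 * a" using k nn by (intro mult_right_mono) auto
  have kPb: "(\<kappa> * P) * b \<le> 3 / 5 * ((\<kappa> * (P * P)) * a)" using mult_left_mono[OF 1, of "\<kappa> * P"] k0 P by (simp add: mult_ac)
  have kPPa: "(\<kappa> * (P * P)) * a \<le> 1 / 100 * a" using k nn by (intro mult_right_mono) auto
  have kg': "\<kappa> * g \<le> 11 / 10 * (\<kappa> * b)" using mult_left_mono[OF 3, of \<kappa>] k0 by (simp add: mult_ac)
  have kPg': "(\<kappa> * P) * g \<le> 11 / 10 * ((\<kappa> * P) * b)" using mult_left_mono[OF 3, of "\<kappa> * P"] k0 P by (simp add: mult_ac)
  have "3 / 4 * a \<le> 1 / 2 * (\<kappa> * a) + 5 / 2 * (\<kappa> * g) + 3 * (\<kappa> * b) + \<kappa> * d"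
    using commutator_estimate by (simp add: a_def g_def b_def d_def mult_ac)
  then have "a \<le> 0" using ka kg' kb' kPa kd kPg' kPb kPPa nn by linarith
  then have "a = 0" using nn by simp
  then have "b = 0" using 1 nn by simp
  then have "g = 0" using 3 nn by simp
  then have "d = 0" using 2 nn by simp
  then have "\<omega> x * (v x)\<^sup>2 = 0"
    using weight_integrable_terms(1) unfolding d_def wint_def weight_integrable_def
    by (intro continuous_nonneg_integral_zero[where f = "\<lambda>x. \<omega> x * (v x)\<^sup>2"])
       (auto intro!: continuous_intros weight_continuous cont mult_nonneg_nonneg simp: less_imp_le[OF weight_pos])
  then show ?thesis using weight_pos[of e h x] by simp
qed

end

section \<open>Stationary breathers\<close>

lemma quartic_le_gaussian:
  assumes "\<delta> > (0::real)"
  obtains K where "K > 0" "\<And>y. (1 + \<bar>y\<bar>) ^ 4 \<le> K * exp (\<delta> / 2 * y\<^sup>2)"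
proof -
  define M where "M = max 1 (4 / \<delta>)"
  have M: "M \<ge> 1" "M * (\<delta> / 4) \<ge> 1" using assms by (auto simp: M_def max_def field_simps)
  have "(1 + \<bar>y\<bar>) ^ 4 \<le> 4 * M\<^sup>2 * exp (\<delta> / 2 * y\<^sup>2)" for y :: real
  proof -
    have "(1 + \<bar>y\<bar>)\<^sup>2 \<le> 2 * (1 + y\<^sup>2)"
      using zero_le_power2[of "1 - \<bar>y\<bar>"] by (simp add: power2_eq_square algebra_simps)
    also have "1 + y\<^sup>2 \<le> M * 1 + (M * (\<delta> / 4)) * y\<^sup>2"
      using M mult_right_mono[OF M(2), of "y\<^sup>2"] by simp
    also have "\<dots> = M * (1 + \<delta> / 4 * y\<^sup>2)" by (simp add: algebra_simps)
    also have "\<dots> \<le> M * exp (\<delta> / 4 * y\<^sup>2)" using M exp_ge_add_one_self by (intro mult_left_mono) auto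
    finally have "(1 + \<bar>y\<bar>)\<^sup>2 \<le> 2 * (M * exp (\<delta> / 4 * y\<^sup>2))" by simp
    then have "((1 + \<bar>y\<bar>)\<^sup>2)\<^sup>2 \<le> (2 * (M * exp (\<delta> / 4 * y\<^sup>2)))\<^sup>2" by (rule power_mono) simp
    also have "\<dots> = 4 * M\<^sup>2 * (exp (\<delta> / 4 * y\<^sup>2))\<^sup>2" by (simp add: power_mult_distrib)
    also have "(exp (\<delta> / 4 * y\<^sup>2))\<^sup>2 = exp (\<delta> / 2 * y\<^sup>2)" by (simp add: exp_double[symmetric])
    finally show ?thesis by simp
  qed
  moreover have "4 * M\<^sup>2 > 0" using M by simp
  ultimately show thesis using that by blast
qed

lemma gaussian_beats_power:
  assumes "\<delta> > (0::real)" "k \<le> 3"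
  obtains K where "K \<ge> 0" "\<And>y. \<bar>\<delta> * (y - r0)\<bar> ^ k * exp (- (\<delta> / 2 * (y - r0)\<^sup>2)) \<le> K / sqrt (1 + y\<^sup>2)"
proof -
  obtain K where K: "K > 0" "\<And>y. (1 + \<bar>y\<bar>) ^ 4 \<le> K * exp (\<delta> / 2 * y\<^sup>2)"
    using quartic_le_gaussian[OF assms(1)] by blast
  define D where "D = (1 + \<delta>) ^ 3 * (1 + \<bar>r0\<bar>)"
  have D: "D > 0" using assms by (auto simp: D_def intro!: mult_pos_pos zero_less_power)
  have "\<bar>\<delta> * (y - r0)\<bar> ^ k * exp (- (\<delta> / 2 * (y - r0)\<^sup>2)) \<le> (D * K) / sqrt (1 + y\<^sup>2)" for y
  proof -
    define z where "z = y - r0"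
    have s0: "sqrt (1 + y\<^sup>2) > 0" by (simp add: add_pos_nonneg)
    have "\<bar>\<delta> * z\<bar> \<le> (1 + \<delta>) * (1 + \<bar>z\<bar>)" using assms by (simp add: abs_mult algebra_simps)
    then have "\<bar>\<delta> * z\<bar> ^ k \<le> ((1 + \<delta>) * (1 + \<bar>z\<bar>)) ^ k" by (rule power_mono) simp
    also have "\<dots> \<le> ((1 + \<delta>) * (1 + \<bar>z\<bar>)) ^ 3"
    proof (rule power_increasing[OF assms(2)])
      show "1 \<le> (1 + \<delta>) * (1 + \<bar>z\<bar>)" using mult_mono[of 1 "1 + \<delta>" 1 "1 + \<bar>z\<bar>"] assms(1) by simp
    qed
    finally have 1: "\<bar>\<delta> * z\<bar> ^ k \<le> (1 + \<delta>) ^ 3 * (1 + \<bar>z\<bar>) ^ 3" by (simp only: power_mult_distrib)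
    have "sqrt (1 + y\<^sup>2) \<le> sqrt ((1 + \<bar>y\<bar>)\<^sup>2)"
      by (rule real_sqrt_le_mono) (simp add: power2_eq_square algebra_simps)
    also have "\<dots> = 1 + \<bar>y\<bar>" by simp
    also have "\<dots> \<le> 1 + (\<bar>z\<bar> + \<bar>r0\<bar>)" unfolding z_def by linarith
    also have "\<dots> \<le> (1 + \<bar>r0\<bar>) * (1 + \<bar>z\<bar>)" by (simp add: algebra_simps)
    finally have 2: "sqrt (1 + y\<^sup>2) \<le> (1 + \<bar>r0\<bar>) * (1 + \<bar>z\<bar>)" .
    have "\<bar>\<delta> * z\<bar> ^ k * sqrt (1 + y\<^sup>2) \<le> ((1 + \<delta>) ^ 3 * (1 + \<bar>z\<bar>) ^ 3) * ((1 + \<bar>r0\<bar>) * (1 + \<bar>z\<bar>))"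
      using assms(1) s0 by (intro mult_mono 1 2) auto
    also have "\<dots> = D * (1 + \<bar>z\<bar>) ^ 4" by (simp add: D_def power4_eq_xxxx power3_eq_cube mult_ac)
    also have "\<dots> \<le> D * (K * exp (\<delta> / 2 * z\<^sup>2))" using K D by (intro mult_left_mono) auto
    finally have "\<bar>\<delta> * z\<bar> ^ k * sqrt (1 + y\<^sup>2) * exp (- (\<delta> / 2 * z\<^sup>2)) \<le> D * (K * exp (\<delta> / 2 * z\<^sup>2)) * exp (- (\<delta> / 2 * z\<^sup>2))"
      by (rule mult_right_mono) simp
    also have "\<dots> = D * K" by (simp add: mult.assoc exp_minus_inverse)
    finally show ?thesis unfolding z_def[symmetric] using s0 by (simp add: field_simps)
  qed
  moreover have "D * K \<ge> 0" using D K by simp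
  ultimately show thesis using that by blast
qed

text \<open>A unique continuation theorem at infinity in which the usual assumption of fast decay is replaced by zeros on all
segments of length 2 L in one direction. The derivatives du and ddu are those of u.\<close>

theorem vanishing_of_line_zeros:
  fixes u V :: "'a::euclidean_space \<Rightarrow> real" and du :: "'a \<Rightarrow> 'a \<Rightarrow> real" and ddu :: "'a \<Rightarrow> 'a \<Rightarrow> 'a \<Rightarrow> real"
  assumes e: "e \<in> Basis"
    and du: "\<And>b. b \<in> Basis \<Longrightarrow> has_pderiv u b (du b)"
    and ddu: "\<And>b c. b \<in> Basis \<Longrightarrow> c \<in> Basis \<Longrightarrow> has_pderiv (du b) c (ddu b c)"
    and sym: "\<And>b c x. b \<in> Basis \<Longrightarrow> c \<in> Basis \<Longrightarrow> ddu b c x = ddu c b x"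
    and cu: "continuous_on UNIV u" and cdu: "\<And>b. b \<in> Basis \<Longrightarrow> continuous_on UNIV (du b)"
    and cddu: "\<And>b c. b \<in> Basis \<Longrightarrow> c \<in> Basis \<Longrightarrow> continuous_on UNIV (ddu b c)"
    and eqn: "\<And>x. (\<Sum>b\<in>Basis. ddu b b x) + V x * u x = 0"
    and cV: "continuous_on UNIV V" and V0: "(V \<longlongrightarrow> 0) at_infinity"
    and bu: "\<And>x. \<bar>u x\<bar> \<le> B" and bdu: "\<And>b x. b \<in> Basis \<Longrightarrow> \<bar>du b x\<bar> \<le> B"
    and L: "L > 0" and zeros: "\<And>x. \<exists>r. \<bar>r\<bar> \<le> L \<and> u (x + r *\<^sub>R e) = 0"
  shows "u x = 0"
proof -
  obtain C where C: "C > 0" "\<And>x. \<bar>V x\<bar> \<le> C" using bounded_if_tendsto_at_infinity[OF V0 cV] by blast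
  define \<kappa> where "\<kappa> = 1 / (100 * (1 + 4 * L\<^sup>2)\<^sup>2)"
  have Lp: "1 + 4 * L\<^sup>2 > 0" by (simp add: add_pos_nonneg)
  have \<kappa>: "\<kappa> > 0" "\<kappa> * (1 + 4 * L\<^sup>2)\<^sup>2 \<le> 1 / 100" using Lp by (auto simp: \<kappa>_def)
  define h where "h = \<kappa> / DIM('a)"
  have h: "h > 0" "h * DIM('a) \<le> \<kappa>" using \<kappa> DIM_positive[where 'a='a] by (auto simp: h_def)
  (* The slope required where V is only bounded by C. *)
  define \<tau> where "\<tau> = 1 + sqrt ((C + C\<^sup>2) / \<kappa>)"
  have \<tau>: "\<tau> > 0" using C \<kappa> by (auto simp: \<tau>_def intro!: add_pos_nonneg)
  have "(C + C\<^sup>2) / \<kappa> = (sqrt ((C + C\<^sup>2) / \<kappa>))\<^sup>2" using C \<kappa> by simp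
  also have "\<dots> \<le> \<tau>\<^sup>2" unfolding \<tau>_def using C \<kappa> by (intro power_mono) auto
  finally have "C + C\<^sup>2 \<le> \<kappa> * \<tau>\<^sup>2" using \<kappa> by (simp add: field_simps)
  then have C\<tau>: "C \<le> \<kappa> * \<tau>\<^sup>2" "C\<^sup>2 \<le> \<kappa> * \<tau>\<^sup>2" using C(1) zero_le_power2[of C] by linarith+
  obtain R where R: "\<And>x. norm x \<ge> R \<Longrightarrow> \<bar>V x\<bar> < \<kappa>" using tendsto_0_at_infinityE[OF V0 \<kappa>(1)] by blast
  (* With this centre the slope is at least \<tau> on the half space x_e < R, and V is at most \<kappa> on its complement. *)
  define r0 where "r0 = R + \<tau> / \<kappa>"
  define \<sigma> where "\<sigma> = (\<lambda>x::'a. - \<kappa> * (x \<bullet> e - r0))"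
  define g where "g x = exp (- (\<kappa> / 2 * (x \<bullet> e - r0)\<^sup>2))" for x :: 'a
  define \<beta> where "\<beta> b = (if b = e then 1 else 0::real)" for b
  define v where "v = (\<lambda>x. g x * u x)"
  define dv where "dv b = (\<lambda>x. g x * (du b x + \<beta> b * (\<sigma> x * u x)))" for b
  define ddv where "ddv b c = (\<lambda>x. g x * (ddu b c x + \<beta> c * (\<sigma> x * du b x) + \<beta> b * (\<sigma> x * du c x)
     + \<beta> b * \<beta> c * (((\<sigma> x)\<^sup>2 - \<kappa>) * u x)))" for b c
  define A where "A = (\<lambda>x. 2 * \<sigma> x * dv e x - \<kappa> * v x)"
  have ip: "(x + r *\<^sub>R b) \<bullet> e = x \<bullet> e + r * \<beta> b" if "b \<in> Basis" for x r and b :: 'a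
    using that e by (auto simp: \<beta>_def inner_add_left inner_not_same_Basis)
  have dg: "((\<lambda>r. g (x + r *\<^sub>R b)) has_real_derivative \<beta> b * \<sigma> x * g x) (at 0)" if "b \<in> Basis" for b x
    unfolding g_def ip[OF that]
    by (rule DERIV_cong, (rule derivative_intros)+) (simp add: \<sigma>_def field_simps)
  have d\<sigma>: "((\<lambda>r. \<sigma> (x + r *\<^sub>R b)) has_real_derivative - \<kappa> * \<beta> b) (at 0)" if "b \<in> Basis" for b x
    unfolding \<sigma>_def ip[OF that] by (auto intro!: derivative_eq_intros)
  have cg: "continuous_on UNIV g" unfolding g_def by (intro continuous_intros)
  have c\<sigma>: "continuous_on UNIV \<sigma>" unfolding \<sigma>_def by (intro continuous_intros)
  interpret W: weighted_identity e h \<kappa> r0 v V dv ddv \<sigma> A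
  proof
    show "\<sigma> = (\<lambda>x. - \<kappa> * (x \<bullet> e - r0))" "A = (\<lambda>x. 2 * \<sigma> x * dv e x - \<kappa> * v x)" by (simp_all add: \<sigma>_def A_def)
    show "has_pderiv v b (dv b)" if b: "b \<in> Basis" for b
      unfolding has_pderiv_def
    proof
      fix x show "((\<lambda>r. v (x + r *\<^sub>R b)) has_real_derivative dv b x) (at 0)"
        unfolding v_def dv_def
        by (rule DERIV_cong, (rule derivative_intros dg[OF b] has_pderivD[OF du[OF b]])+) (simp add: algebra_simps)
    qed
    show "has_pderiv (dv b) c (ddv b c)" if b: "b \<in> Basis" and c: "c \<in> Basis" for b c
      unfolding has_pderiv_def
    proof
      fix x show "((\<lambda>r. dv b (x + r *\<^sub>R c)) has_real_derivative ddv b c x) (at 0)"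
        unfolding dv_def ddv_def
        by (rule DERIV_cong, (rule derivative_intros dg[OF c] d\<sigma>[OF c] has_pderivD[OF du[OF c]] has_pderivD[OF ddu[OF b c]])+)
          (simp add: algebra_simps power2_eq_square)
    qed
    show "ddv b c x = ddv c b x" if "b \<in> Basis" "c \<in> Basis" for b c x
      using sym[OF that, of x] by (simp add: ddv_def algebra_simps)
    show "continuous_on UNIV (ddv b c)" if "b \<in> Basis" "c \<in> Basis" for b c
      unfolding ddv_def using that by (intro continuous_intros cg c\<sigma> cu cdu cddu)
    show "(\<Sum>b\<in>Basis. ddv b b x) = A x - (\<sigma> x)\<^sup>2 * v x - V x * v x" for x
    proof -
      have b1: "(\<Sum>b\<in>Basis. \<beta> b * f b) = f e" for f using e by (simp add: \<beta>_def if_distrib[of "\<lambda>t. t * _"] cong: if_cong)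
      have "(\<Sum>b\<in>Basis. ddv b b x) = g x * ((\<Sum>b\<in>Basis. ddu b b x) + (\<Sum>b\<in>Basis. \<beta> b * (2 * \<sigma> x * du b x))
          + (\<Sum>b\<in>Basis. \<beta> b * (\<beta> b * (((\<sigma> x)\<^sup>2 - \<kappa>) * u x))))"
        unfolding sum.distrib[symmetric] sum_distrib_left by (intro sum.cong refl) (simp add: ddv_def algebra_simps)
      also have "\<dots> = g x * ((\<Sum>b\<in>Basis. ddu b b x) + 2 * \<sigma> x * du e x + ((\<sigma> x)\<^sup>2 - \<kappa>) * u x)"
        unfolding b1 by (simp add: \<beta>_def)
      also have "(\<Sum>b\<in>Basis. ddu b b x) = - V x * u x" using eqn[of x] by (simp add: algebra_simps)
      finally show ?thesis by (simp add: A_def dv_def v_def \<beta>_def power2_eq_square algebra_simps)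
    qed
  qed (use e h cV in auto)
  have H: "W.root_decay (\<lambda>x. \<sigma> x ^ k * (g x * f x))" if k: "k \<le> 3" and cf: "continuous_on UNIV f" and bf: "\<And>x. \<bar>f x\<bar> \<le> B" for k f
  proof -
    obtain K where K: "K \<ge> 0" "\<And>y. \<bar>\<kappa> * (y - r0)\<bar> ^ k * exp (- (\<kappa> / 2 * (y - r0)\<^sup>2)) \<le> K / sqrt (1 + y\<^sup>2)"
      using gaussian_beats_power[OF \<kappa>(1) k] by blast
    have "\<bar>\<sigma> x ^ k * (g x * f x)\<bar> \<le> (K * B) / sqrt (1 + (x \<bullet> e)\<^sup>2)" for x
    proof -
      have "\<bar>\<sigma> x ^ k * (g x * f x)\<bar> = \<bar>\<kappa> * (x \<bullet> e - r0)\<bar> ^ k * exp (- (\<kappa> / 2 * (x \<bullet> e - r0)\<^sup>2)) * \<bar>f x\<bar>"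
        by (simp add: \<sigma>_def g_def abs_mult power_abs)
      also have "\<dots> \<le> K / sqrt (1 + (x \<bullet> e)\<^sup>2) * B"
        using K by (intro mult_mono K bf) auto
      finally show ?thesis by simp
    qed
    moreover have "continuous_on UNIV (\<lambda>x. \<sigma> x ^ k * (g x * f x))" by (intro continuous_intros cg c\<sigma> cf)
    ultimately show ?thesis unfolding W.root_decay_def by blast
  qed
  interpret Ca: carleman e h \<kappa> r0 v V dv ddv \<sigma> A L \<kappa> \<tau> C \<kappa>
  proof
    show "W.root_decay v" using H[of 0, OF _ cu bu] by (simp add: v_def)
    show "W.root_decay (\<lambda>x. \<sigma> x * v x)" using H[of 1, OF _ cu bu] by (simp add: v_def)
    show "W.root_decay (\<lambda>x. (\<sigma> x)\<^sup>2 * v x)" using H[of 2, OF _ cu bu] by (simp add: v_def)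
    fix b :: 'a assume b: "b \<in> Basis"
    have "W.root_decay (\<lambda>x. \<sigma> x ^ k * dv b x)" if "k \<le> 2" for k
    proof -
      have "W.root_decay (\<lambda>x. \<sigma> x ^ k * (g x * du b x) + \<beta> b * (\<sigma> x ^ Suc k * (g x * u x)))"
        by (intro W.root_decay_add W.root_decay_cmult H cu cdu bu bdu b) (use that in auto)
      then show ?thesis by (simp add: dv_def algebra_simps)
    qed
    from this[of 0] this[of 1] show "W.root_decay (dv b)" "W.root_decay (\<lambda>x. \<sigma> x * dv b x)" by simp_all
  next
    show "\<exists>r. \<bar>r\<bar> \<le> L \<and> v (x + r *\<^sub>R e) = 0" for x using zeros[of x] by (auto simp: v_def)
    show "\<bar>V x\<bar> \<le> \<kappa> \<or> \<tau> \<le> \<bar>\<sigma> x\<bar>" for x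
    proof (cases "x \<bullet> e \<ge> R")
      case True
      then have "norm x \<ge> R" using Basis_le_norm[OF e, of x] by linarith
      then show ?thesis using R[of x] by simp
    next
      case False
      then have "\<kappa> * (r0 - x \<bullet> e) \<ge> \<kappa> * (\<tau> / \<kappa>)" using \<kappa> by (intro mult_left_mono) (auto simp: r0_def)
      then have "\<sigma> x \<ge> \<tau>" using \<kappa> by (simp add: \<sigma>_def algebra_simps)
      then show ?thesis using abs_ge_self[of "\<sigma> x"] by linarith
    qed
  qed (use C \<kappa> L \<tau> C\<tau> h in auto)
  have "v x = 0" by (rule Ca.vanishing)
  then show ?thesis by (simp add: v_def g_def)
qed

lemma bounded_function_mult: "(\<exists>B. \<forall>x. \<bar>f x\<bar> \<le> B) \<Longrightarrow> (\<exists>B. \<forall>x. \<bar>g x\<bar> \<le> B) \<Longrightarrow> \<exists>B. \<forall>x. \<bar>f x * g x :: real\<bar> \<le> B"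
proof -
  assume "\<exists>B. \<forall>x. \<bar>f x\<bar> \<le> B" "\<exists>B. \<forall>x. \<bar>g x\<bar> \<le> B"
  then obtain B1 B2 where "\<And>x. \<bar>f x\<bar> \<le> B1" "\<And>x. \<bar>g x\<bar> \<le> B2" by blast
  then have "\<bar>f x * g x\<bar> \<le> \<bar>B1\<bar> * \<bar>B2\<bar>" for x
    unfolding abs_mult by (intro mult_mono) (auto intro: order_trans[OF _ abs_ge_self])
  then show ?thesis by blast
qed

lemma bounded_function_add: "(\<exists>B. \<forall>x. \<bar>f x\<bar> \<le> B) \<Longrightarrow> (\<exists>B. \<forall>x. \<bar>g x\<bar> \<le> B) \<Longrightarrow> \<exists>B. \<forall>x. \<bar>f x + g x :: real\<bar> \<le> B"
proof -
  assume "\<exists>B. \<forall>x. \<bar>f x\<bar> \<le> B" "\<exists>B. \<forall>x. \<bar>g x\<bar> \<le> B"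
  then obtain B1 B2 where "\<And>x. \<bar>f x\<bar> \<le> B1" "\<And>x. \<bar>g x\<bar> \<le> B2" by blast
  then have "\<bar>f x + g x\<bar> \<le> B1 + B2" for x by (meson abs_triangle_ineq add_mono order_trans)
  then show ?thesis by blast
qed

context breather begin

text \<open>The indicator of the distinguished direction allows one formula for the derivatives of the phase in all coordinate directions.\<close>

definition "is_ax b = (if b = ax then 1 else 0::real)"

lemma is_ax_ax [simp]: "is_ax ax = 1"
  by (simp add: is_ax_def)

lemma theta_Basis: "b \<in> Basis \<Longrightarrow> theta t (x + r *\<^sub>R b) = theta t x + 2 * \<alpha> * is_ax b * r"
proof -
  assume b: "b \<in> Basis"
  have "b $ e = b \<bullet> ax" by (simp add: ax_def inner_axis)
  also have "\<dots> = is_ax b" using b by (auto simp: is_ax_def inner_not_same_Basis)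
  finally show ?thesis by (simp add: theta_def algebra_simps)
qed

lemma p1_pderiv: "has_pderiv p1 v (dir_deriv v p1)"
  unfolding p1_def by (rule dp_pderiv) simp

text \<open>The argument of F, its derivatives osc1 and dosc along the x_1-axis and along b, and the derivative dosc1 of osc1 along b.\<close>

definition "osc t x = p x * sin (theta t x)"
definition "osc1 t x = p1 x * sin (theta t x) + 2 * \<alpha> * p x * cos (theta t x)"
definition "dosc b t x = dir_deriv b p x * sin (theta t x) + is_ax b * (2 * \<alpha> * p x * cos (theta t x))"
definition "dosc1 b t x = dir_deriv b p1 x * sin (theta t x) + 2 * \<alpha> * dir_deriv b p x * cos (theta t x)
   + is_ax b * (2 * \<alpha> * p1 x * cos (theta t x) - 4 * \<alpha>\<^sup>2 * p x * sin (theta t x))"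

lemma u_osc: "u (t, x) = G (osc t x) * osc1 t x"
  by (simp add: u_formula osc_def osc1_def)

lemma trig_pderiv:
  assumes "b \<in> Basis"
  shows "has_pderiv (\<lambda>x. sin (theta t x)) b (\<lambda>x. is_ax b * (2 * \<alpha> * cos (theta t x)))"
    and "has_pderiv (\<lambda>x. cos (theta t x)) b (\<lambda>x. - is_ax b * (2 * \<alpha> * sin (theta t x)))"
  unfolding has_pderiv_def theta_Basis[OF assms] by (auto intro!: derivative_eq_intros)

lemma osc_pderiv: "b \<in> Basis \<Longrightarrow> has_pderiv (osc t) b (dosc b t)"
  unfolding has_pderiv_def
proof
  fix x assume b: "b \<in> Basis"
  show "((\<lambda>r. osc t (x + r *\<^sub>R b)) has_real_derivative dosc b t x) (at 0)"
    unfolding osc_def dosc_def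
    by (rule DERIV_cong, (rule derivative_intros has_pderivD[OF p_pderiv] has_pderivD[OF trig_pderiv(1)[OF b]])+) (simp add: algebra_simps)
qed

lemma osc1_pderiv: "b \<in> Basis \<Longrightarrow> has_pderiv (osc1 t) b (dosc1 b t)"
  unfolding has_pderiv_def
proof
  fix x assume b: "b \<in> Basis"
  show "((\<lambda>r. osc1 t (x + r *\<^sub>R b)) has_real_derivative dosc1 b t x) (at 0)"
    unfolding osc1_def dosc1_def
    by (rule DERIV_cong, (rule derivative_intros has_pderivD[OF p_pderiv] has_pderivD[OF p1_pderiv]
       has_pderivD[OF trig_pderiv(1)[OF b]] has_pderivD[OF trig_pderiv(2)[OF b]])+) (simp add: algebra_simps power2_eq_square)
qed

lemma osc_compose_pderiv:
  assumes "b \<in> Basis" "\<And>s. (g has_real_derivative g' s) (at s)"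
  shows "has_pderiv (\<lambda>x. g (osc t x)) b (\<lambda>x. g' (osc t x) * dosc b t x)"
  unfolding has_pderiv_def
  using DERIV_chain2[OF _ has_pderivD[OF osc_pderiv[OF assms(1)]], of g] assms(2) by auto

lemma dir_deriv_u: 
  assumes b: "b \<in> Basis"
  shows "dir_deriv (0, b) u (t, x) = G' (osc t x) * dosc b t x * osc1 t x + G (osc t x) * dosc1 b t x"
proof -
  have "((\<lambda>r. u (t, x + r *\<^sub>R b)) has_real_derivative dir_deriv (0, b) u (t, x)) (at 0)"
    by (rule has_pderivD[OF has_pderiv_slice[OF smooth_pderiv[OF u_smooth]]])
  moreover have "((\<lambda>r. u (t, x + r *\<^sub>R b)) has_real_derivative G' (osc t x) * dosc b t x * osc1 t x + G (osc t x) * dosc1 b t x) (at 0)"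
    unfolding u_osc
    by (rule DERIV_cong, (rule derivative_intros has_pderivD[OF osc_compose_pderiv[OF b G_DERIV]] has_pderivD[OF osc1_pderiv[OF b]])+) simp
  ultimately show ?thesis by (rule DERIV_unique)
qed

text \<open>The segment contains two consecutive zeros of sin \<theta>, where F(p sin \<theta>) takes the value F(0).\<close>

lemma line_Rolle:
  "\<exists>r. \<bar>r\<bar> \<le> pi / (2 * \<alpha>) \<and> u (t, x + r *\<^sub>R ax) = 0"
proof -
  let ?w = "\<lambda>r. F (osc t (x + r *\<^sub>R ax))"
  let ?L = "pi / (2 * \<alpha>)"
  define k where "k = \<lfloor>theta t x / pi\<rfloor>"
  define a where "a = (of_int k * pi - theta t x) / (2 * \<alpha>)"
  have th: "theta t (x + a *\<^sub>R ax) = of_int k * pi" "theta t (x + (a + ?L) *\<^sub>R ax) = of_int (k + 1) * pi"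
    using alpha_pos by (simp_all add: a_def field_simps)
  have k: "of_int k * pi \<le> theta t x" "theta t x \<le> of_int (k + 1) * pi"
    unfolding k_def by (simp_all add: pos_le_divide_eq[symmetric] pos_divide_le_eq[symmetric] real_of_int_floor_add_one_ge)
  have ab: "a \<le> 0" "- ?L \<le> a"
    using k alpha_pos unfolding a_def by (auto simp: field_simps)
  have sin0: "sin (of_int j * pi) = 0" for j :: int by (rule sin_zero_iff_int2[THEN iffD2]) blast
  have wd: "(?w has_real_derivative u (t, x + r *\<^sub>R ax)) (at r)" for r
  proof -
    have "dosc ax t = osc1 t" by (auto simp: dosc_def osc1_def p1_def fun_eq_iff)
    then show ?thesis
      using has_pderiv_line[OF osc_compose_pderiv[OF ax_Basis F_DERIV], of t x r] by (simp add: u_osc)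
  qed
  have "\<exists>r. a < r \<and> r < a + ?L \<and> (?w has_real_derivative 0) (at r)"
  proof (rule Rolle)
    show "a < a + ?L" using alpha_pos by simp
    show "?w a = ?w (a + ?L)" unfolding osc_def th sin0 by simp
    show "continuous_on {a..a + ?L} ?w"
      by (rule continuous_at_imp_continuous_on) (use wd DERIV_isCont in blast)
    show "?w differentiable (at r)" for r using wd real_differentiable_def by blast
  qed
  then obtain r where r: "a < r" "r < a + ?L" "(?w has_real_derivative 0) (at r)" by blast
  have "u (t, x + r *\<^sub>R ax) = 0" by (rule DERIV_unique[OF wd r(3)])
  moreover have "\<bar>r\<bar> \<le> ?L" using r ab by auto
  ultimately show ?thesis by blast
qed

lemma gradient_bounded: "b \<in> Basis \<Longrightarrow> \<exists>B. \<forall>x. \<bar>dir_deriv (0, b) u (t, x)\<bar> \<le> B"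
proof -
  assume b: "b \<in> Basis"
  have lim: "\<exists>B. \<forall>x. \<bar>f x\<bar> \<le> B" if "(f \<longlongrightarrow> 0) at_infinity" "continuous_on UNIV f" for f :: "real ^ 'n \<Rightarrow> real"
    using bounded_if_tendsto_at_infinity[OF that] by blast
  have bp: "\<exists>B. \<forall>x. \<bar>p x\<bar> \<le> B" "\<exists>B. \<forall>x. \<bar>p1 x\<bar> \<le> B" "\<exists>B. \<forall>x. \<bar>dir_deriv b p x\<bar> \<le> B" "\<exists>B. \<forall>x. \<bar>dir_deriv b p1 x\<bar> \<le> B"
    unfolding p1_def
    by (intro lim p_tendsto continuous_p dp_tendsto continuous_dp ddp_tendsto continuous_ddp b ax_Basis)+
  have bG: "\<exists>B. \<forall>x. \<bar>g (osc t x)\<bar> \<le> B" if "continuous_on UNIV g" for g :: "real \<Rightarrow> real"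
    using bounded_on_range[OF that] unfolding osc_def by metis
  have const: "\<exists>B. \<forall>x::real ^ 'n. \<bar>c\<bar> \<le> B" for c :: real by (intro exI[of _ "\<bar>c\<bar>"]) simp
  have trig: "\<exists>B. \<forall>x. \<bar>sin (theta t x)\<bar> \<le> B" "\<exists>B. \<forall>x. \<bar>cos (theta t x)\<bar> \<le> B"
    by (intro exI[of _ 1] allI abs_sin_le_one abs_cos_le_one)+
  show ?thesis
    unfolding dir_deriv_u[OF b] dosc_def osc1_def dosc1_def diff_conv_add_uminus minus_mult_left
    by (intro bounded_function_add bounded_function_mult bp bG continuous_G trig const)
qed

text \<open>For m = 0 the integrated equation is a linear elliptic equation for u with potential 2 u^(q-1). The gradient of u is bounded because it
involves only derivatives of p up to the second order.\<close>

theorem stationary_vanishes: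
  assumes m: "m = 0"
  shows "u z = 0"
proof -
  have th: "theta t x = theta 0 x" for t x unfolding theta_def using m by simp
  have indep: "u (t, x) = u (0, x)" for t x unfolding u_formula using th[of t x] by simp
  let ?u = "\<lambda>x. u (0, x)" and ?du = "\<lambda>b x. dir_deriv (0, b) u (0, x)"
    and ?ddu = "\<lambda>b c x. dir_deriv (0, c) (dir_deriv (0, b) u) (0, x)"
  have sl: "continuous_on UNIV (\<lambda>x. f (0, x))" if "continuous_on UNIV f" for f :: "real \<times> (real ^ 'n) \<Rightarrow> real"
    by (rule continuous_on_compose2[OF that]) (auto intro!: continuous_intros)
  have u0: "(?u \<longlongrightarrow> 0) at_infinity"
  proof (rule tendstoI)
    fix \<eta> :: real assume "\<eta> > 0"
    then have \<eta>2: "\<eta> / 2 > 0" by simp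
    obtain R where R: "\<And>t x. norm x \<ge> R \<Longrightarrow> \<bar>u (t, x)\<bar> \<le> \<eta> / 2"
        "\<And>t x. norm x \<ge> R \<Longrightarrow> \<bar>transport t x\<bar> \<le> \<eta> / 2"
      using decay[OF \<eta>2] by blast
    have "dist (u (0, x)) 0 < \<eta>" if "norm x \<ge> R" for x using R(1)[OF that, of 0] \<open>\<eta> > 0\<close> by simp
    then show "\<forall>\<^sub>F x in at_infinity. dist (u (0, x)) 0 < \<eta>" unfolding eventually_at_infinity by blast
  qed
  obtain B0 where B0: "\<And>x. \<bar>?u x\<bar> \<le> B0"
    using bounded_if_tendsto_at_infinity[OF u0 sl[OF smooth_continuous[OF u_smooth]]] by blast
  have "\<forall>b\<in>Basis. \<exists>B. \<forall>x. \<bar>?du b x\<bar> \<le> B" using gradient_bounded by blast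
  then obtain B1 where B1: "\<And>b x. b \<in> Basis \<Longrightarrow> \<bar>?du b x\<bar> \<le> B1 b" by metis
  define B where "B = \<bar>B0\<bar> + (\<Sum>b\<in>Basis. \<bar>B1 b\<bar>)"
  have sB: "\<bar>B1 b\<bar> \<le> (\<Sum>b\<in>Basis. \<bar>B1 b\<bar>)" if "b \<in> Basis" for b
    by (rule member_le_sum) (use that in auto)
  have S0: "(\<Sum>b\<in>(Basis :: (real ^ 'n) set). \<bar>B1 b\<bar>) \<ge> 0" by (rule sum_nonneg) simp
  have "?u x = 0" for x
  proof (rule vanishing_of_line_zeros[where e = ax and V = "\<lambda>x. 2 * ?u x ^ (q - 1)" and du = ?du and ddu = ?ddu and B = B
        and L = "pi / (2 * \<alpha>)"])
    show "has_pderiv ?u b (?du b)" for b by (intro has_pderiv_slice smooth_pderiv u_smooth)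
    show "has_pderiv (?du b) c (?ddu b c)" if "b \<in> Basis" for b c by (intro has_pderiv_slice smooth_pderiv u_smooth1 that)
    show "?ddu b c x = ?ddu c b x" if "b \<in> Basis" "c \<in> Basis" for b c x
      using dir_deriv_commute[of 0 u "(0, b)" "(0, c)"] u_smooth Basis_axis_x that by (simp only: smooth_def)
    show "continuous_on UNIV ?u" by (intro sl smooth_continuous u_smooth)
    show "continuous_on UNIV (?du b)" if "b \<in> Basis" for b by (intro sl smooth_continuous u_smooth1 that)
    show "continuous_on UNIV (?ddu b c)" if "b \<in> Basis" "c \<in> Basis" for b c by (intro sl smooth_continuous u_smooth2 that)
    show "(\<Sum>b\<in>Basis. ?ddu b b x) + 2 * ?u x ^ (q - 1) * ?u x = 0" for x
    proof -
      have "?u x ^ (q - 1) * ?u x = ?u x ^ q" using q_ge_2 by (simp add: power_eq_if mult.commute)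
      moreover have "transport 0 x = 0" unfolding transport_def using m by simp
      ultimately show ?thesis using profile_equation[of 0 x] by (simp add: laplace_x_Basis mult.assoc)
    qed
    show "continuous_on UNIV (\<lambda>x. 2 * ?u x ^ (q - 1))" by (intro continuous_intros sl smooth_continuous u_smooth)
    show "((\<lambda>x. 2 * ?u x ^ (q - 1)) \<longlongrightarrow> 0) at_infinity"
      using q_ge_2 by (auto intro!: tendsto_eq_intros u0)
    show "\<bar>?u x\<bar> \<le> B" for x using B0[of x] S0 unfolding B_def by linarith
    show "\<bar>?du b x\<bar> \<le> B" if "b \<in> Basis" for b x using B1[OF that, of x] sB[OF that] by (simp add: B_def)
    show "pi / (2 * \<alpha>) > 0" using alpha_pos by simp
    show "\<exists>r. \<bar>r\<bar> \<le> pi / (2 * \<alpha>) \<and> u (0, x + r *\<^sub>R ax) = 0" for x by (rule line_Rolle)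
  qed simp
  then show ?thesis using indep by (cases z) simp
qed

end

section \<open>Moving breathers whose profile vanishes near 0\<close>

text \<open>A function that vanishes on N can be cut off by the indicator of S without loss of smoothness, since N contains the
common boundary of S and T.\<close>

locale separated =
  fixes S N T :: "'a::euclidean_space set"
  assumes op: "open S" "open N" "open T" and cover: "S \<union> N \<union> T = UNIV" and disj: "S \<inter> T = {}"
begin

lemma glue_continuous:
  fixes g :: "'a \<Rightarrow> real"
  assumes c: "continuous_on UNIV g" and z: "\<And>x. x \<in> N \<Longrightarrow> g x = 0"
  shows "continuous_on UNIV (\<lambda>x. indicator S x * g x)"
proof -
  have 1: "continuous_on S (\<lambda>x. indicator S x * g x)"
    by (rule continuous_on_eq[OF continuous_on_subset[OF c]]) auto
  have 2: "continuous_on (N \<union> T) (\<lambda>x. indicator S x * g x)"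
    by (rule continuous_on_eq[OF continuous_on_const[of _ 0]]) (use z disj in \<open>auto simp: indicator_def\<close>)
  have "continuous_on (S \<union> (N \<union> T)) (\<lambda>x. indicator S x * g x)"
    by (rule continuous_on_open_Un) (use op 1 2 in auto)
  then show ?thesis using cover by (simp add: Un_assoc)
qed

lemma glue_pderiv:
  fixes g :: "'a \<Rightarrow> real"
  assumes d: "has_pderiv g b g'" and z: "\<And>x. x \<in> N \<Longrightarrow> g x = 0"
  shows "has_pderiv (\<lambda>x. indicator S x * g x) b (\<lambda>x. indicator S x * g' x)"
  unfolding has_pderiv_def
proof
  fix x
  show "((\<lambda>r. indicator S (x + r *\<^sub>R b) * g (x + r *\<^sub>R b)) has_real_derivative indicator S x * g' x) (at 0)"
  proof (cases "x \<in> S")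
    case True
    have "eventually (\<lambda>r. g (x + r *\<^sub>R b) = indicator S (x + r *\<^sub>R b) * g (x + r *\<^sub>R b)) (nhds 0)"
      using eventually_line_in_open[OF op(1) True, of b] by eventually_elim auto
    from iffD1[OF DERIV_cong_ev[OF refl this refl] has_pderivD[OF d]] show ?thesis using True by simp
  next
    case False
    have NT: "open (N \<union> T)" "x \<in> N \<union> T" using False cover op by auto
    have "eventually (\<lambda>r. 0 = indicator S (x + r *\<^sub>R b) * g (x + r *\<^sub>R b)) (nhds 0)"
      using eventually_line_in_open[OF NT, of b] by eventually_elim (use z disj in \<open>auto simp: indicator_def\<close>)
    from iffD1[OF DERIV_cong_ev[OF refl this refl] DERIV_const] show ?thesis using False by simp
  qed
qed

end

context breather begin

definition "Dx b = dir_deriv (0, b) u"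
definition "Dxx b c = dir_deriv (0, c) (Dx b)"
definition "Dlap z = (\<Sum>b\<in>Basis. dir_deriv (0, ax) (Dxx b b) z)"

lemma Dx_smooth: "b \<in> Basis \<Longrightarrow> smooth (Dx b)"
  and Dxx_smooth: "b \<in> Basis \<Longrightarrow> c \<in> Basis \<Longrightarrow> smooth (Dxx b c)"
  and Dxxx_smooth: "b \<in> Basis \<Longrightarrow> c \<in> Basis \<Longrightarrow> smooth (dir_deriv (0, ax) (Dxx b c))"
  by (auto simp: Dx_def Dxx_def intro!: smooth_dir_deriv u_smooth Basis_axis_x)

lemma d_t_smooth: "smooth (d_t u)"
  unfolding d_t_def by (intro smooth_dir_deriv u_smooth Basis_axis_t)

lemma u_pderiv_t: "has_pderiv u (1, 0) (d_t u)"
  and u_pderiv_x: "has_pderiv u (0, b) (Dx b)"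
  unfolding d_t_def Dx_def by (intro smooth_pderiv u_smooth)+

lemma Dx_pderiv: "b \<in> Basis \<Longrightarrow> has_pderiv (Dx b) (0, c) (Dxx b c)"
  unfolding Dxx_def by (intro smooth_pderiv Dx_smooth)

lemma Dxx_sym: "b \<in> Basis \<Longrightarrow> c \<in> Basis \<Longrightarrow> Dxx b c = Dxx c b"
  using dir_deriv_commute[of 0 u "(0, c)" "(0, b)"] u_smooth Basis_axis_x by (simp only: smooth_def Dxx_def Dx_def)

lemma laplace_x_Dxx: "laplace_x u z = (\<Sum>b\<in>Basis. Dxx b b z)"
  by (simp add: laplace_x_Basis Dxx_def Dx_def)

lemma laplace_pderiv: "has_pderiv (laplace_x u) (0, ax) Dlap"
  unfolding has_pderiv_def laplace_x_Dxx Dlap_def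
  by (intro allI DERIV_sum has_pderivD smooth_pderiv Dxx_smooth)

lemma evolution_equation: "d_t u z + Dlap z + 2 * real q * u z ^ (q - 1) * Dx ax z = 0"
proof -
  have 2: "((\<lambda>r. laplace_x u (z + r *\<^sub>R (0, ax)) + 2 * u (z + r *\<^sub>R (0, ax)) ^ q) has_real_derivative
      Dlap z + 2 * real q * u z ^ (q - 1) * Dx ax z) (at 0)"
    by (rule DERIV_cong, (rule derivative_intros has_pderivD[OF laplace_pderiv] has_pderivD[OF u_pderiv_x])+)
       (simp add: mult_ac zero_prod_def[symmetric])
  have "d_x e (\<lambda>w. laplace_x u w + 2 * u w ^ q) z = Dlap z + 2 * real q * u z ^ (q - 1) * Dx ax z"
    by (rule DERIV_unique[OF has_pderivD[OF flux_pderiv] 2])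
  moreover have "d_t u z + d_x e (\<lambda>w. laplace_x u w + 2 * u w ^ q) z = 0"
    using solution unfolding smooth_solution_def by blast
  ultimately show ?thesis by (simp only: add.assoc)
qed

text \<open>The space-time vector field whose time component is t u^2/2 and whose space components are t times the flux of the conserved density u^2/2. By
conservation its divergence is u^2/2, so the factor t turns a conservation law into a bound for the mass.\<close>

definition mass_flux :: "real \<times> (real ^ 'n) \<Rightarrow> real \<times> (real ^ 'n) \<Rightarrow> real" where
  "mass_flux c z = (if snd c = 0 then fst z * ((u z)\<^sup>2 / 2)
    else fst z * ((if snd c = ax then u z * laplace_x u z + (\<Sum>b\<in>Basis. (Dx b z)\<^sup>2) / 2 + 2 * real q / real (Suc q) * u z ^ Suc q else 0)
       - Dx ax z * Dx (snd c) z))"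

lemma mass_divergence:
  shows "\<exists>Z'. (\<forall>c\<in>Basis. has_pderiv (mass_flux c) c (Z' c) \<and> continuous_on UNIV (mass_flux c) \<and> continuous_on UNIV (Z' c))
    \<and> (\<forall>z. (\<Sum>c\<in>Basis. Z' c z) = (u z)\<^sup>2 / 2)"
proof -
  define Z' where "Z' c z = (if snd c = 0 then (u z)\<^sup>2 / 2 + fst z * (u z * d_t u z)
    else fst z * ((if snd c = ax then Dx ax z * laplace_x u z + u z * Dlap z + (\<Sum>b\<in>Basis. Dx b z * Dxx b ax z)
         + 2 * real q * u z ^ q * Dx ax z else 0)
       - (Dxx ax (snd c) z * Dx (snd c) z + Dx ax z * Dxx (snd c) (snd c) z)))" for c z :: "real \<times> (real ^ 'n)"
  have Basis_cases: "c = (1, 0) \<or> (\<exists>b\<in>Basis. c = (0, b))" if "c \<in> Basis" for c :: "real \<times> (real ^ 'n)"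
    using that by (auto simp: Basis_prod_def)
  have nz: "b \<noteq> 0" if "b \<in> Basis" for b :: "real ^ 'n" using that by (rule nonzero_Basis)
  have fx: "fst (z + r *\<^sub>R (0, b)) = fst z" for z :: "real \<times> (real ^ 'n)" and r b by simp
  show ?thesis
  proof (intro exI[of _ Z'] conjI ballI allI)
    fix c :: "real \<times> (real ^ 'n)" assume "c \<in> Basis"
    then consider "c = (1, 0)" | b where "b \<in> Basis" "c = (0, b)" using Basis_cases by blast
    then have all: "has_pderiv (mass_flux c) c (Z' c) \<and> continuous_on UNIV (mass_flux c) \<and> continuous_on UNIV (Z' c)"
    proof cases
      case 1
      have "((\<lambda>r. mass_flux c (z + r *\<^sub>R c)) has_real_derivative Z' c z) (at 0)" for z
      proof -
        have f: "((\<lambda>r. fst (z + r *\<^sub>R (1, 0::real ^ 'n))) has_real_derivative 1) (at 0)"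
          by (auto intro!: derivative_eq_intros)
        show ?thesis unfolding mass_flux_def Z'_def 1 snd_conv
          using DERIV_mult[OF f DERIV_cdivide[OF DERIV_power[OF has_pderivD[OF u_pderiv_t, of z], of 2], of 2]]
          by (simp add: zero_prod_def[symmetric] mult_ac)
      qed
      moreover have "continuous_on UNIV (mass_flux c)" "continuous_on UNIV (Z' c)"
        unfolding mass_flux_def Z'_def 1 snd_conv
        by (simp_all only: if_True simp_thms) (intro continuous_intros smooth_continuous u_smooth d_t_smooth; simp)+
      ultimately show ?thesis by (auto simp: has_pderiv_def)
    next
      case (2 b)
      note b = 2(1)
      have 3: "((\<lambda>r. Dx ax (z + r *\<^sub>R (0, b)) * Dx b (z + r *\<^sub>R (0, b))) has_real_derivative
         Dxx ax b z * Dx b z + Dx ax z * Dxx b b z) (at 0)" for z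
        by (rule DERIV_cong, (rule derivative_intros has_pderivD[OF Dx_pderiv[OF ax_Basis]] has_pderivD[OF Dx_pderiv[OF b]])+) (simp add: zero_prod_def[symmetric])
      have 4: "((\<lambda>r. (\<Sum>c\<in>Basis. (Dx c (z + r *\<^sub>R (0, ax)))\<^sup>2)) has_real_derivative (\<Sum>c\<in>Basis. 2 * (Dx c z * Dxx c ax z))) (at 0)" for z
      proof (rule DERIV_sum)
        fix c :: "real ^ 'n" assume c: "c \<in> Basis"
        show "((\<lambda>r. (Dx c (z + r *\<^sub>R (0, ax)))\<^sup>2) has_real_derivative 2 * (Dx c z * Dxx c ax z)) (at 0)"
          by (rule DERIV_cong, (rule derivative_intros has_pderivD[OF Dx_pderiv[OF c]])+) (simp add: zero_prod_def[symmetric])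
      qed
      have 5: "((\<lambda>r. u (z + r *\<^sub>R (0, ax)) * laplace_x u (z + r *\<^sub>R (0, ax)) + (\<Sum>c\<in>Basis. (Dx c (z + r *\<^sub>R (0, ax)))\<^sup>2) / 2
           + 2 * real q / real (Suc q) * u (z + r *\<^sub>R (0, ax)) ^ Suc q) has_real_derivative
         Dx ax z * laplace_x u z + u z * Dlap z + (\<Sum>c\<in>Basis. Dx c z * Dxx c ax z) + 2 * real q * u z ^ q * Dx ax z) (at 0)" for z
      proof -
        have "((\<lambda>r. u (z + r *\<^sub>R (0, ax)) ^ Suc q) has_real_derivative real (Suc q) * u z ^ q * Dx ax z) (at 0)"
          by (rule DERIV_cong, (rule DERIV_power has_pderivD[OF u_pderiv_x])+) (simp add: zero_prod_def[symmetric])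
        from DERIV_cmult[OF this, of "2 * real q / real (Suc q)"]
        have "((\<lambda>r. 2 * real q / real (Suc q) * u (z + r *\<^sub>R (0, ax)) ^ Suc q) has_real_derivative 2 * real q * u z ^ q * Dx ax z) (at 0)"
          by (rule DERIV_cong) (simp add: mult.assoc del: of_nat_Suc)
        moreover have "((\<lambda>r. u (z + r *\<^sub>R (0, ax)) * laplace_x u (z + r *\<^sub>R (0, ax))) has_real_derivative
            Dx ax z * laplace_x u z + u z * Dlap z) (at 0)"
          by (rule DERIV_cong, (rule derivative_intros has_pderivD[OF u_pderiv_x] has_pderivD[OF laplace_pderiv])+) (simp add: zero_prod_def[symmetric])
        moreover have "((\<lambda>r. (\<Sum>c\<in>Basis. (Dx c (z + r *\<^sub>R (0, ax)))\<^sup>2) / 2) has_real_derivative (\<Sum>c\<in>Basis. Dx c z * Dxx c ax z)) (at 0)"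
          by (rule DERIV_cong[OF DERIV_cdivide[OF 4]]) (simp add: sum_distrib_left[symmetric])
        ultimately show ?thesis by (intro DERIV_add)
      qed
      have "((\<lambda>r. mass_flux c (z + r *\<^sub>R c)) has_real_derivative Z' c z) (at 0)" for z
      proof (cases "b = ax")
        case True
        from DERIV_cmult[OF DERIV_diff[OF 5[of z] 3[of z, unfolded True]], of "fst z"] show ?thesis
          unfolding mass_flux_def Z'_def 2(2) True snd_conv using nz[OF ax_Basis] by (simp only: if_False if_True simp_thms fx)
      next
        case False
        from DERIV_cmult[OF DERIV_diff[OF DERIV_const[of 0] 3[of z]], of "fst z"] show ?thesis
          unfolding mass_flux_def Z'_def 2(2) snd_conv using nz[OF b] False by (simp only: if_False if_True simp_thms fx)
      qed
      moreover have c: "continuous_on UNIV (laplace_x u)" "continuous_on UNIV Dlap"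
        unfolding laplace_x_Dxx[abs_def] Dlap_def[abs_def]
        by (intro continuous_intros smooth_continuous Dxx_smooth Dxxx_smooth; simp)+
      have "continuous_on UNIV (mass_flux c) \<and> continuous_on UNIV (Z' c)"
      proof (cases "b = ax")
        case True
        show ?thesis unfolding mass_flux_def Z'_def 2(2) True snd_conv using nz[OF ax_Basis]
          by (simp only: if_False if_True simp_thms)
             (intro conjI continuous_intros c smooth_continuous u_smooth Dx_smooth Dxx_smooth ax_Basis; simp)
      next
        case False
        show ?thesis unfolding mass_flux_def Z'_def 2(2) snd_conv using nz[OF b] False
          by (simp only: if_False if_True simp_thms)
             (intro conjI continuous_intros c smooth_continuous u_smooth Dx_smooth Dxx_smooth ax_Basis b; simp)
      qed
      ultimately show ?thesis by (auto simp: has_pderiv_def)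
    qed
    from all show "has_pderiv (mass_flux c) c (Z' c)" "continuous_on UNIV (mass_flux c)" "continuous_on UNIV (Z' c)" by auto
  next
    fix z :: "real \<times> (real ^ 'n)"
    let ?M = "\<Sum>b\<in>Basis. Dx b z * Dxx b ax z"
    have "(\<Sum>c\<in>Basis. Z' c z) = Z' (1, 0) z + (\<Sum>b\<in>Basis. Z' (0, b) z)"
    proof -
      let ?X = "(\<lambda>b. (0::real, b)) ` (Basis :: (real ^ 'n) set)"
      have "(\<Sum>c\<in>Basis. Z' c z) = (\<Sum>c\<in>insert (1, 0) ?X. Z' c z)"
        by (rule sum.cong) (auto simp: Basis_prod_def)
      also have "\<dots> = Z' (1, 0) z + (\<Sum>c\<in>?X. Z' c z)" by (rule sum.insert) auto
      also have "(\<Sum>c\<in>?X. Z' c z) = (\<Sum>b\<in>Basis. Z' (0, b) z)" by (simp add: sum.reindex inj_on_def)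
      finally show ?thesis .
    qed
    also have "(\<Sum>b\<in>Basis. Z' (0, b) z) = (\<Sum>b\<in>Basis. fst z * ((if b = ax then Dx ax z * laplace_x u z + u z * Dlap z + ?M
         + 2 * real q * u z ^ q * Dx ax z else 0) - (Dx b z * Dxx b ax z + Dx ax z * Dxx b b z)))"
      by (intro sum.cong refl) (simp add: Z'_def nz Dxx_sym[of ax] mult.commute)
    also have "\<dots> = fst z * ((Dx ax z * laplace_x u z + u z * Dlap z + ?M + 2 * real q * u z ^ q * Dx ax z) - (?M + Dx ax z * laplace_x u z))"
      by (simp add: sum_distrib_left[symmetric] sum_subtractf sum.distrib laplace_x_Dxx)
    also have "Z' (1, 0) z + \<dots> = (u z)\<^sup>2 / 2 + fst z * (u z * d_t u z + u z * Dlap z + 2 * real q * u z ^ q * Dx ax z)"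
      by (simp add: Z'_def algebra_simps)
    also have "u z ^ q = u z * u z ^ (q - 1)" using q_ge_2 by (simp add: power_eq_if)
    also have "u z * d_t u z + u z * Dlap z + 2 * real q * (u z * u z ^ (q - 1)) * Dx ax z = u z * (d_t u z + Dlap z + 2 * real q * u z ^ (q - 1) * Dx ax z)"
      by (simp add: algebra_simps)
    finally show "(\<Sum>c\<in>Basis. Z' c z) = (u z)\<^sup>2 / 2" by (simp only: evolution_equation mult_zero_right add_0_right)
  qed
qed

text \<open>Integrate the divergence of the mass flux over the slab between two zeros of sin \<theta>. In this slab x_1 + m t is
bounded, so on the compact support of p also t is bounded where u does not vanish.\<close>

theorem flat_profile_vanishes:
  assumes m: "m \<noteq> 0" and \<epsilon>: "\<epsilon> > 0" and flat: "\<And>s. \<bar>s\<bar> < \<epsilon> \<Longrightarrow> F s = 0"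
  shows "u z = 0"
proof (rule ccontr)
  assume nz: "u z \<noteq> 0"
  have G0: "G s = 0" if "\<bar>s\<bar> < \<epsilon>" for s
  proof -
    have "eventually (\<lambda>y. y \<in> ball 0 \<epsilon>) (nhds s)" using that by (intro eventually_nhds_in_open) auto
    then have "eventually (\<lambda>y. F y = 0) (nhds s)" by eventually_elim (use flat in auto)
    then have "(F has_real_derivative 0) (at s) \<longleftrightarrow> ((\<lambda>y. 0::real) has_real_derivative 0) (at s)"
      by (intro DERIV_cong_ev) auto
    then show ?thesis using F_DERIV DERIV_unique by fastforce
  qed
  define th where "th z = theta (fst z) (snd z)" for z :: "real \<times> (real ^ 'n)"
  have cth: "continuous_on UNIV th" unfolding th_def theta_def by (intro continuous_intros)
  have cph: "continuous_on UNIV (\<lambda>z. p (snd z) * sin (th z))"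
    by (intro continuous_intros cth continuous_on_compose2[OF continuous_p[of UNIV]]) auto
  define k where "k = \<lfloor>th z / pi\<rfloor>"
  define S where "S = {z. of_int k * pi < th z \<and> th z < (of_int k + 1) * pi}"
  define N where "N = {z. \<bar>p (snd z) * sin (th z)\<bar> < \<epsilon>}"
  define T where "T = {z. th z < of_int k * pi \<or> (of_int k + 1) * pi < th z}"
  have uN: "u y = 0" if "y \<in> N" for y
    using that G0 by (cases y) (auto simp: N_def th_def u_formula)
  have sin0: "sin (of_int j * pi) = 0" for j :: int by (rule sin_zero_iff_int2[THEN iffD2]) blast
  interpret separated S N T
  proof
    show "open S" unfolding S_def by (intro open_Collect_conj open_Collect_less continuous_intros cth)
    show "open T" unfolding T_def by (intro open_Collect_disj open_Collect_less continuous_intros cth)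
    show "open N" unfolding N_def by (intro open_Collect_less continuous_intros cph)
    show "S \<inter> T = {}" by (auto simp: S_def T_def)
    have "y \<in> N" if "y \<notin> S" "y \<notin> T" for y
    proof -
      have "th y = of_int k * pi \<or> th y = of_int (k + 1) * pi" using that by (auto simp: S_def T_def)
      then have "sin (th y) = 0" using sin0 by metis
      then show ?thesis using \<epsilon> by (simp add: N_def)
    qed
    then show "S \<union> N \<union> T = UNIV" by blast
  qed
  have zS: "z \<in> S"
  proof -
    have "z \<notin> N" using uN nz by blast
    then have "th z \<noteq> of_int k * pi" using \<epsilon> sin0[of k] by (auto simp: N_def)
    moreover have "of_int k * pi \<le> th z" "th z < (of_int k + 1) * pi"
      unfolding k_def by (simp_all add: pos_le_divide_eq[symmetric] pos_divide_less_eq[symmetric])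
    ultimately show ?thesis by (simp add: S_def)
  qed
  obtain R where R: "\<And>x. norm x \<ge> R \<Longrightarrow> \<bar>p x\<bar> < \<epsilon>" using tendsto_0_at_infinityE[OF p_tendsto \<epsilon>] by blast
  (* A bound for |t| + |x| on the part of the slab where |p| is at least \<epsilon>. *)
  define W where "W = ((\<bar>of_int k\<bar> + 1) * pi / (2 * \<alpha>) + \<bar>R\<bar>) / \<bar>m\<bar> + \<bar>R\<bar>"
  have supp: "y \<in> N" if "y \<in> S" "norm y > W" for y
  proof (rule ccontr)
    assume "y \<notin> N"
    obtain t x where y: "y = (t, x)" by (cases y)
    have "\<epsilon> \<le> \<bar>p x\<bar> * \<bar>sin (th y)\<bar>" using \<open>y \<notin> N\<close> by (simp add: N_def y abs_mult)
    also have "\<dots> \<le> \<bar>p x\<bar> * 1" by (intro mult_left_mono) auto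
    finally have nx: "norm x \<le> \<bar>R\<bar>" using R[of x] by (cases "norm x \<ge> R") auto
    have "\<bar>th y\<bar> \<le> (\<bar>of_int k\<bar> + 1) * pi"
    proof -
      have "th y < (of_int k + 1) * pi" "of_int k * pi < th y" using that(1) by (auto simp: S_def)
      moreover have "0 \<le> (\<bar>of_int k\<bar> + of_int k + 1) * pi" "0 \<le> (\<bar>of_int k\<bar> - of_int k) * pi"
        by (intro mult_nonneg_nonneg; simp)+
      then have "(of_int k + 1) * pi \<le> (\<bar>of_int k\<bar> + 1) * pi" "- ((\<bar>of_int k\<bar> + 1) * pi) \<le> of_int k * pi"
        by (simp_all add: algebra_simps)
      ultimately show ?thesis by linarith
    qed
    then have "\<bar>x $ e + m * t\<bar> \<le> (\<bar>of_int k\<bar> + 1) * pi / (2 * \<alpha>)"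
    proof -
      assume "\<bar>th y\<bar> \<le> (\<bar>of_int k\<bar> + 1) * pi"
      moreover have "\<bar>th y\<bar> = 2 * \<alpha> * \<bar>x $ e + m * t\<bar>"
        using alpha_pos by (simp add: th_def y theta_def abs_mult)
      ultimately show ?thesis using alpha_pos by (simp add: pos_le_divide_eq mult.commute)
    qed
    moreover have "\<bar>x $ e\<bar> \<le> \<bar>R\<bar>" using component_le_norm_cart[of x e] nx by linarith
    ultimately have "\<bar>m * t\<bar> \<le> (\<bar>of_int k\<bar> + 1) * pi / (2 * \<alpha>) + \<bar>R\<bar>" by linarith
    then have "\<bar>t\<bar> \<le> ((\<bar>of_int k\<bar> + 1) * pi / (2 * \<alpha>) + \<bar>R\<bar>) / \<bar>m\<bar>"
      using m by (simp add: abs_mult pos_le_divide_eq mult.commute)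
    then have "norm y \<le> W" using norm_Pair_le[of t x] nx by (simp add: W_def y)
    with that(2) show False by simp
  qed
  from mass_divergence obtain Z'
    where ZZ: "(\<forall>c\<in>Basis. has_pderiv (mass_flux c) c (Z' c) \<and> continuous_on UNIV (mass_flux c) \<and> continuous_on UNIV (Z' c))
      \<and> (\<forall>z. (\<Sum>c\<in>Basis. Z' c z) = (u z)\<^sup>2 / 2)" by (rule exE)
  note Z' = conjunct1[OF bspec[OF conjunct1[OF ZZ]]] conjunct1[OF conjunct2[OF bspec[OF conjunct1[OF ZZ]]]]
    conjunct2[OF conjunct2[OF bspec[OF conjunct1[OF ZZ]]]] spec[OF conjunct2[OF ZZ]]
  have DN: "Dx b y = 0" if "y \<in> N" for y b
    by (rule has_pderiv_zero_on_open[OF op(2) that _ u_pderiv_x]) (use uN in auto)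
  have ZN: "mass_flux c y = 0" if "y \<in> N" for c y
    using uN[OF that] DN[OF that] by (simp add: mass_flux_def)
  have Z'N: "Z' c y = 0" if "c \<in> Basis" "y \<in> N" for c y
    by (rule has_pderiv_zero_on_open[OF op(2) that(2) _ Z'(1)[OF that(1)]]) (use ZN in auto)
  have sum': "(\<Sum>c\<in>Basis. indicator S z * Z' c z) = indicator S z * ((u z)\<^sup>2 / 2)" for z
    by (simp add: sum_distrib_left[symmetric] Z'(4))
  have cu2: "continuous_on UNIV (\<lambda>z. indicator S z * ((u z)\<^sup>2 / 2))"
    by (intro glue_continuous continuous_intros smooth_continuous u_smooth) (use uN in auto)
  have iu2: "integrable lborel (\<lambda>z. indicator S z * ((u z)\<^sup>2 / 2))"
  proof (rule integrable_compact_support[OF cu2])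
    fix y :: "real \<times> (real ^ 'n)" assume "norm y > W" then show "indicator S y * ((u y)\<^sup>2 / 2) = 0" using supp uN by (cases "y \<in> S") auto
  qed
  have "(\<integral>z. (\<Sum>c\<in>Basis. indicator S z * Z' c z) \<partial>lborel) = 0"
  proof (rule integral_divergence_zero[where Z = "\<lambda>c z. indicator S z * mass_flux c z"])
    fix c :: "real \<times> (real ^ 'n)" assume c: "c \<in> Basis"
    show "has_pderiv (\<lambda>z. indicator S z * mass_flux c z) c (\<lambda>z. indicator S z * Z' c z)"
      by (rule glue_pderiv[OF Z'(1)[OF c] ZN])
    show cont: "continuous_on UNIV (\<lambda>z. indicator S z * mass_flux c z)"
      by (rule glue_continuous[OF Z'(2)[OF c] ZN])
    show "continuous_on UNIV (\<lambda>z. indicator S z * Z' c z)"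
      by (rule glue_continuous[OF Z'(3)[OF c] Z'N[OF c]])
    show "integrable lborel (\<lambda>z. indicator S z * mass_flux c z)"
    proof (rule integrable_compact_support[OF cont])
      fix y :: "real \<times> (real ^ 'n)" assume "norm y > W" then show "indicator S y * mass_flux c y = 0" using supp ZN by (cases "y \<in> S") auto
    qed
  qed (use iu2 in \<open>simp add: sum'\<close>)
  then have "(\<integral>z. indicator S z * ((u z)\<^sup>2 / 2) \<partial>lborel) = 0" by (simp only: sum')
  then have "indicator S z * ((u z)\<^sup>2 / 2) = 0"
    by (intro continuous_nonneg_integral_zero[where f = "\<lambda>z. indicator S z * ((u z)\<^sup>2 / 2)", OF cu2 _ iu2]) auto
  with zS nz show False by simp
qed

end

section \<open>Expansion of the integrated equation in the phase\<close>

lemma of_class_C_add: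
  "of_class_C k f \<Longrightarrow> of_class_C k g \<Longrightarrow> of_class_C k (\<lambda>x. f x + g x)"
proof (induction k arbitrary: f g)
  case 0
  then show ?case by (simp add: continuous_on_add)
next
  case (Suc k)
  have d: "(\<lambda>x. f x + g x) differentiable (at x)" for x using Suc.prems by (auto intro!: differentiable_add)
  have "dir_deriv b (\<lambda>x. f x + g x) = (\<lambda>x. dir_deriv b f x + dir_deriv b g x)" for b
  proof (rule has_pderiv_unique)
    show "has_pderiv (\<lambda>x. f x + g x) b (dir_deriv b (\<lambda>x. f x + g x))" by (rule frechet_has_pderiv[OF d])
    show "has_pderiv (\<lambda>x. f x + g x) b (\<lambda>x. dir_deriv b f x + dir_deriv b g x)"
      using of_class_C_pderiv[OF Suc.prems(1), of b] of_class_C_pderiv[OF Suc.prems(2), of b]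
      unfolding has_pderiv_def by (auto intro: DERIV_add)
  qed
  then show ?case using Suc d by auto
qed

lemma of_class_C_cmult:
  "of_class_C k f \<Longrightarrow> of_class_C k (\<lambda>x. c * f x)"
proof (induction k arbitrary: f)
  case 0
  then show ?case by (simp add: continuous_on_mult_left)
next
  case (Suc k)
  have d: "(\<lambda>x. c * f x) differentiable (at x)" for x using Suc.prems by (auto intro!: differentiable_mult)
  have "dir_deriv b (\<lambda>x. c * f x) = (\<lambda>x. c * dir_deriv b f x)" for b
  proof (rule has_pderiv_unique)
    show "has_pderiv (\<lambda>x. c * f x) b (dir_deriv b (\<lambda>x. c * f x))" by (rule frechet_has_pderiv[OF d])
    show "has_pderiv (\<lambda>x. c * f x) b (\<lambda>x. c * dir_deriv b f x)"
      using of_class_C_pderiv[OF Suc.prems, of b] unfolding has_pderiv_def by (auto intro: DERIV_cmult)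
  qed
  then show ?case using Suc d by auto
qed

lemma of_class_C_sum:
  "finite A \<Longrightarrow> (\<And>a. a \<in> A \<Longrightarrow> of_class_C k (f a)) \<Longrightarrow> of_class_C k (\<lambda>x. \<Sum>a\<in>A. f a x)"
proof (induction A rule: finite_induct)
  case empty
  have "of_class_C k (\<lambda>x::'b. 0)"
  proof (induction k)
    case (Suc k)
    have "dir_deriv b (\<lambda>x::'b. 0) = (\<lambda>x. 0)" for b by (auto simp: dir_deriv_def fun_eq_iff)
    then show ?case using Suc by simp
  qed simp
  then show ?case by simp
next
  case (insert a A)
  then show ?case by (simp add: of_class_C_add)
qed

lemma of_class_C_linear_compose:
  fixes l :: "'a::euclidean_space \<Rightarrow> 'b::euclidean_space"
  assumes l: "linear l"
  shows "of_class_C k f \<Longrightarrow> of_class_C k (\<lambda>x. f (l x))"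
proof (induction k arbitrary: f)
  case 0
  have "continuous_on UNIV l" using l by (simp add: linear_continuous_on linear_conv_bounded_linear)
  then show ?case using 0 by (auto intro: continuous_on_compose2)
next
  case (Suc k)
  have ld: "l differentiable (at x)" for x
    using l by (simp add: bounded_linear_imp_differentiable linear_conv_bounded_linear)
  have fd: "f differentiable (at y)" for y using Suc.prems by simp
  have d: "(\<lambda>x. f (l x)) differentiable (at x)" for x by (rule differentiable_compose[OF fd ld])
  have "dir_deriv b (\<lambda>x. f (l x)) = (\<lambda>x. \<Sum>c\<in>Basis. (l b \<bullet> c) * dir_deriv c f (l x))" for b
  proof (rule has_pderiv_unique)
    show "has_pderiv (\<lambda>x. f (l x)) b (dir_deriv b (\<lambda>x. f (l x)))" by (rule frechet_has_pderiv[OF d])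
    show "has_pderiv (\<lambda>x. f (l x)) b (\<lambda>x. \<Sum>c\<in>Basis. (l b \<bullet> c) * dir_deriv c f (l x))"
      unfolding has_pderiv_def
    proof
      fix x
      have "linear (frechet_derivative f (at (l x)))" by (rule linear_frechet_derivative[OF fd])
      then have "dir_deriv (l b) f (l x) = (\<Sum>c\<in>Basis. (l b \<bullet> c) * dir_deriv c f (l x))"
        unfolding dir_deriv_def
        by (subst (1) euclidean_representation[symmetric, of "l b"]) (simp add: linear_sum linear_cmul)
      moreover have "l (x + r *\<^sub>R b) = l x + r *\<^sub>R l b" for r using l by (simp add: linear_add linear_cmul)
      ultimately show "((\<lambda>r. f (l (x + r *\<^sub>R b))) has_real_derivative (\<Sum>c\<in>Basis. (l b \<bullet> c) * dir_deriv c f (l x))) (at 0)"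
        using has_pderivD[OF of_class_C_pderiv[OF Suc.prems], of "l x" "l b"] by simp
    qed
  qed
  moreover have "of_class_C k (\<lambda>x. \<Sum>c\<in>Basis. (l b \<bullet> c) * dir_deriv c f (l x))" for b
    by (intro of_class_C_sum of_class_C_cmult Suc.IH of_class_C_dir_deriv[OF Suc.prems]) auto
  ultimately show ?case using d by simp
qed

context breather begin

definition "ddosc b t x = dir_deriv b (dir_deriv b p) x * sin (theta t x)
  + is_ax b * (4 * \<alpha> * p1 x * cos (theta t x) - 4 * \<alpha>\<^sup>2 * p x * sin (theta t x))"

lemma dosc_pderiv: "b \<in> Basis \<Longrightarrow> has_pderiv (dosc b t) b (ddosc b t)"
  unfolding has_pderiv_def
proof
  fix x assume b: "b \<in> Basis"
  have "((\<lambda>r. dosc b t (x + r *\<^sub>R b)) has_real_derivative dir_deriv b (dir_deriv b p) x * sin (theta t x)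
      + dir_deriv b p x * (is_ax b * (2 * \<alpha> * cos (theta t x)))
      + is_ax b * (2 * \<alpha> * dir_deriv b p x * cos (theta t x) - 2 * \<alpha> * p x * (is_ax b * (2 * \<alpha> * sin (theta t x))))) (at 0)"
    unfolding dosc_def
    by (rule DERIV_cong, (rule derivative_intros has_pderivD[OF p_pderiv] has_pderivD[OF dp_pderiv[OF b]]
       has_pderivD[OF trig_pderiv(1)[OF b]] has_pderivD[OF trig_pderiv(2)[OF b]])+) (simp add: algebra_simps)
  also have "dir_deriv b (dir_deriv b p) x * sin (theta t x)
      + dir_deriv b p x * (is_ax b * (2 * \<alpha> * cos (theta t x)))
      + is_ax b * (2 * \<alpha> * dir_deriv b p x * cos (theta t x) - 2 * \<alpha> * p x * (is_ax b * (2 * \<alpha> * sin (theta t x)))) = ddosc b t x"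
    by (cases "b = ax") (auto simp: ddosc_def is_ax_def p1_def algebra_simps power2_eq_square)
  finally show "((\<lambda>r. dosc b t (x + r *\<^sub>R b)) has_real_derivative ddosc b t x) (at 0)" .
qed

text \<open>The amplitude is only twice differentiable, but u is smooth and u = G(s) (\<partial>_1 p sin \<theta> + 2 \<alpha> p cos \<theta>). Where G(s) and
sin \<theta> do not vanish, this can be solved for \<partial>_1 p.\<close>

lemma p1_third_derivative_exists:
  assumes b: "b \<in> Basis" and G: "G (osc t x) \<noteq> 0" and s: "sin (theta t x) \<noteq> 0"
  shows "\<exists>D. ((\<lambda>r. dir_deriv b p1 (x + r *\<^sub>R b)) has_real_derivative D) (at 0)"
proof -
  let ?y = "\<lambda>r. x + r *\<^sub>R b"
  define f where "f y = ((Dx b (t, y) - G' (osc t y) * dosc b t y * osc1 t y) / G (osc t y) - 2 * \<alpha> * dir_deriv b p y * cos (theta t y)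
     - is_ax b * (2 * \<alpha> * p1 y * cos (theta t y) - 4 * \<alpha>\<^sup>2 * p y * sin (theta t y))) / sin (theta t y)" for y
  have eq: "dir_deriv b p1 y = f y" if "G (osc t y) \<noteq> 0" "sin (theta t y) \<noteq> 0" for y
  proof -
    have "Dx b (t, y) - G' (osc t y) * dosc b t y * osc1 t y = G (osc t y) * dosc1 b t y"
      unfolding Dx_def dir_deriv_u[OF b] by simp
    then have "(Dx b (t, y) - G' (osc t y) * dosc b t y * osc1 t y) / G (osc t y) = dosc1 b t y" using that by simp
    then show ?thesis using that by (simp add: f_def dosc1_def)
  qed
  have d: "(\<lambda>r. h (?y r)) differentiable (at 0)" if "has_pderiv h b h'" for h h'
    using has_pderivD[OF that, of x] real_differentiable_def by blast
  have D: "(\<lambda>r. Dx b (t, ?y r)) differentiable (at 0)"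
    by (rule d[OF has_pderiv_slice[OF Dx_pderiv[OF b]]])
  have "(\<lambda>r. f (?y r)) differentiable (at 0)"
    unfolding f_def
    by (intro differentiable_divide differentiable_diff differentiable_mult differentiable_const D
        d[OF osc_compose_pderiv[OF b G_DERIV]] d[OF osc_compose_pderiv[OF b G'_DERIV]] d[OF dosc_pderiv[OF b]] d[OF osc1_pderiv[OF b]]
        d[OF dp_pderiv[OF b]] d[OF trig_pderiv(1)[OF b]] d[OF trig_pderiv(2)[OF b]] d[OF p1_pderiv] d[OF p_pderiv])
      (use G s in auto)
  then obtain D where D: "((\<lambda>r. f (?y r)) has_real_derivative D) (at 0)" using real_differentiable_def by blast
  have ev: "eventually (\<lambda>r. h (?y r) \<noteq> 0) (nhds 0)" if "has_pderiv h b h'" "h x \<noteq> 0" for h :: "real ^ 'n \<Rightarrow> real" and h'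
  proof -
    have "isCont (\<lambda>r. h (?y r)) 0" using DERIV_isCont[OF has_pderivD[OF that(1), of x]] .
    then have "((\<lambda>r. h (?y r)) \<longlongrightarrow> h x) (at 0)" by (simp add: continuous_at)
    then have "eventually (\<lambda>r. h (?y r) \<noteq> 0) (at 0)" using that(2) by (rule tendsto_imp_eventually_ne)
    then show ?thesis using that(2) by (simp add: eventually_nhds_conv_at)
  qed
  have "eventually (\<lambda>r. f (?y r) = dir_deriv b p1 (?y r)) (nhds 0)"
    using ev[OF osc_compose_pderiv[OF b G_DERIV] G] ev[OF trig_pderiv(1)[OF b] s]
    by eventually_elim (simp add: eq)
  from iffD1[OF DERIV_cong_ev[OF refl this refl] D] show ?thesis by blast
qed

text \<open>The terms of the integrated equation that are linear in F, as functions of the values A0, A1, A2 of G, G', G'' at s = P \<sigma>, of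
\<sigma> = sin \<theta> and of \<gamma> = cos \<theta>. The coefficients are values at one point: P of p, P1 and p11 of its derivatives along x_1, l of \<Delta>p,
d of \<Delta>\<partial>_1 p, g of |\<nabla>p|^2, and k of the inner product of \<nabla>p and \<nabla>\<partial>_1 p.\<close>

definition linear_residual :: "real \<Rightarrow> real \<Rightarrow> real \<Rightarrow> real \<Rightarrow> real \<Rightarrow> real \<Rightarrow> real \<Rightarrow> real \<Rightarrow> real \<Rightarrow> real \<Rightarrow> real \<Rightarrow> real \<Rightarrow> real"
  where "linear_residual g l k d p11 P P1 A0 A1 A2 \<sigma> \<gamma> = 2 * \<alpha> * m * A0 * P * \<gamma>
    + A2 * (g * \<sigma>\<^sup>2 + 4 * \<alpha> * P * P1 * \<sigma> * \<gamma> + 4 * \<alpha>\<^sup>2 * P\<^sup>2 * \<gamma>\<^sup>2) * (P1 * \<sigma> + 2 * \<alpha> * P * \<gamma>)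
    + A1 * ((l * \<sigma> + 4 * \<alpha> * P1 * \<gamma> - 4 * \<alpha>\<^sup>2 * P * \<sigma>) * (P1 * \<sigma> + 2 * \<alpha> * P * \<gamma>)
        + 2 * (k * \<sigma>\<^sup>2 + 2 * \<alpha> * g * \<sigma> * \<gamma> + P1 * \<sigma> * (2 * \<alpha> * P1 * \<gamma> - 4 * \<alpha>\<^sup>2 * P * \<sigma>)
          + 2 * \<alpha> * P * \<gamma> * (p11 * \<sigma> + 4 * \<alpha> * P1 * \<gamma> - 4 * \<alpha>\<^sup>2 * P * \<sigma>)))
    + A0 * (d * \<sigma> + 2 * \<alpha> * l * \<gamma> + 4 * \<alpha> * p11 * \<gamma> - 12 * \<alpha>\<^sup>2 * P1 * \<sigma> - 8 * \<alpha>^3 * P * \<gamma>)"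

text \<open>For m \<noteq> 0 the time t with prescribed phase \<theta> at x exists. The d3 b are the second derivatives of \<partial>_1 p along the coordinate axes.\<close>

lemma profile_identity:
  assumes m: "m \<noteq> 0"
    and d3: "\<And>b. b \<in> Basis \<Longrightarrow> ((\<lambda>r. dir_deriv b p1 (x + r *\<^sub>R b)) has_real_derivative d3 b) (at 0)"
  defines "g \<equiv> \<Sum>b\<in>Basis. (dir_deriv b p x)\<^sup>2"
    and "l \<equiv> \<Sum>b\<in>Basis. dir_deriv b (dir_deriv b p) x"
    and "k \<equiv> \<Sum>b\<in>Basis. dir_deriv b p x * dir_deriv b p1 x"
    and "d \<equiv> \<Sum>b\<in>Basis. d3 b" and "p11 \<equiv> dir_deriv ax p1 x" and "P \<equiv> p x" and "P1 \<equiv> p1 x"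
  shows "linear_residual g l k d p11 P P1 (G (P * sin \<theta>)) (G' (P * sin \<theta>)) (G'' (P * sin \<theta>)) (sin \<theta>) (cos \<theta>)
    + 2 * (G (P * sin \<theta>) * (P1 * sin \<theta> + 2 * \<alpha> * P * cos \<theta>)) ^ q = 0"
proof -
  define t where "t = (\<theta> / (2 * \<alpha>) - x $ e) / m"
  have th: "theta t x = \<theta>" using m alpha_pos by (simp add: theta_def t_def)
  let ?s = "P * sin \<theta>" and ?\<phi> = "P1 * sin \<theta> + 2 * \<alpha> * P * cos \<theta>"
  have osc: "osc t x = ?s" "osc1 t x = ?\<phi>" by (simp_all add: osc_def osc1_def th P_def P1_def)
  define dd1 where "dd1 b = d3 b * sin \<theta> + 2 * \<alpha> * dir_deriv b (dir_deriv b p) x * cos \<theta>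
     + is_ax b * (4 * \<alpha> * p11 * cos \<theta> - 12 * \<alpha>\<^sup>2 * P1 * sin \<theta> - 8 * \<alpha>^3 * P * cos \<theta>)" for b
  have dosc1: "((\<lambda>r. dosc1 b t (x + r *\<^sub>R b)) has_real_derivative dd1 b) (at 0)" if b: "b \<in> Basis" for b
  proof -
    have "((\<lambda>r. dosc1 b t (x + r *\<^sub>R b)) has_real_derivative d3 b * sin \<theta> + dir_deriv b p1 x * (is_ax b * (2 * \<alpha> * cos \<theta>))
       + 2 * \<alpha> * (dir_deriv b (dir_deriv b p) x * cos \<theta> - dir_deriv b p x * (is_ax b * (2 * \<alpha> * sin \<theta>)))
       + is_ax b * (2 * \<alpha> * (dir_deriv b p1 x * cos \<theta> - p1 x * (is_ax b * (2 * \<alpha> * sin \<theta>)))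
          - 4 * \<alpha>\<^sup>2 * (dir_deriv b p x * sin \<theta> + p x * (is_ax b * (2 * \<alpha> * cos \<theta>))))) (at 0)"
      unfolding dosc1_def
      by (rule DERIV_cong, (rule derivative_intros d3[OF b] has_pderivD[OF p_pderiv] has_pderivD[OF p1_pderiv] has_pderivD[OF dp_pderiv[OF b]]
         has_pderivD[OF trig_pderiv(1)[OF b]] has_pderivD[OF trig_pderiv(2)[OF b]])+) (simp add: algebra_simps th)
    also have "d3 b * sin \<theta> + dir_deriv b p1 x * (is_ax b * (2 * \<alpha> * cos \<theta>))
       + 2 * \<alpha> * (dir_deriv b (dir_deriv b p) x * cos \<theta> - dir_deriv b p x * (is_ax b * (2 * \<alpha> * sin \<theta>)))
       + is_ax b * (2 * \<alpha> * (dir_deriv b p1 x * cos \<theta> - p1 x * (is_ax b * (2 * \<alpha> * sin \<theta>)))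
          - 4 * \<alpha>\<^sup>2 * (dir_deriv b p x * sin \<theta> + p x * (is_ax b * (2 * \<alpha> * cos \<theta>)))) = dd1 b"
    proof (cases "b = ax")
      case True
      have "dir_deriv b p x = P1" "dir_deriv b p1 x = p11" "is_ax b = 1" "p1 x = P1" "p x = P"
        by (simp_all add: True P1_def p11_def p1_def P_def)
      then show ?thesis unfolding dd1_def by (simp add: algebra_simps power2_eq_square power3_eq_cube)
    qed (simp add: dd1_def is_ax_def)
    finally show ?thesis .
  qed
  have Dxx: "Dxx b b (t, x) = G'' ?s * (dosc b t x)\<^sup>2 * ?\<phi> + G' ?s * (ddosc b t x * ?\<phi> + 2 * (dosc b t x * dosc1 b t x)) + G ?s * dd1 b"
    if b: "b \<in> Basis" for b
  proof -
    have "((\<lambda>r. Dx b (t, x + r *\<^sub>R b)) has_real_derivative Dxx b b (t, x)) (at 0)"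
      by (rule has_pderivD[OF has_pderiv_slice[OF Dx_pderiv[OF b]]])
    moreover have "((\<lambda>r. Dx b (t, x + r *\<^sub>R b)) has_real_derivative
       G'' ?s * (dosc b t x)\<^sup>2 * ?\<phi> + G' ?s * (ddosc b t x * ?\<phi> + 2 * (dosc b t x * dosc1 b t x)) + G ?s * dd1 b) (at 0)"
      unfolding Dx_def dir_deriv_u[OF b]
      by (rule DERIV_cong, (rule derivative_intros has_pderivD[OF osc_compose_pderiv[OF b G_DERIV]] has_pderivD[OF osc_compose_pderiv[OF b G'_DERIV]]
          has_pderivD[OF dosc_pderiv[OF b]] has_pderivD[OF osc1_pderiv[OF b]] dosc1[OF b])+)
        (simp add: osc algebra_simps power2_eq_square)
    ultimately show ?thesis by (rule DERIV_unique)
  qed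
  have sel: "(\<Sum>b\<in>Basis. is_ax b * f b) = f ax" for f
    by (simp add: is_ax_def if_distrib[of "\<lambda>t. t * _"] cong: if_cong)
  have s1: "(\<Sum>b\<in>Basis. (dosc b t x)\<^sup>2) = g * (sin \<theta>)\<^sup>2 + 4 * \<alpha> * P * P1 * sin \<theta> * cos \<theta> + 4 * \<alpha>\<^sup>2 * P\<^sup>2 * (cos \<theta>)\<^sup>2"
  proof -
    have "(dosc b t x)\<^sup>2 = (dir_deriv b p x)\<^sup>2 * (sin \<theta>)\<^sup>2 + is_ax b * (4 * \<alpha> * P * dir_deriv b p x * sin \<theta> * cos \<theta>) + is_ax b * (4 * \<alpha>\<^sup>2 * P\<^sup>2 * (cos \<theta>)\<^sup>2)" for b
      by (simp add: dosc_def th is_ax_def P_def power2_eq_square algebra_simps)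
    then show ?thesis by (simp add: sum.distrib sel g_def sum_distrib_right P1_def p1_def)
  qed
  have s2: "(\<Sum>b\<in>Basis. ddosc b t x) = l * sin \<theta> + 4 * \<alpha> * P1 * cos \<theta> - 4 * \<alpha>\<^sup>2 * P * sin \<theta>"
    by (simp add: ddosc_def th sum.distrib sel l_def sum_distrib_right P1_def P_def)
  have s3: "(\<Sum>b\<in>Basis. dosc b t x * dosc1 b t x) = k * (sin \<theta>)\<^sup>2 + 2 * \<alpha> * g * sin \<theta> * cos \<theta> + P1 * sin \<theta> * (2 * \<alpha> * P1 * cos \<theta> - 4 * \<alpha>\<^sup>2 * P * sin \<theta>)
          + 2 * \<alpha> * P * cos \<theta> * (p11 * sin \<theta> + 4 * \<alpha> * P1 * cos \<theta> - 4 * \<alpha>\<^sup>2 * P * sin \<theta>)"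
  proof -
    have "dosc b t x * dosc1 b t x = (dir_deriv b p x * dir_deriv b p1 x) * (sin \<theta>)\<^sup>2 + (2 * \<alpha> * sin \<theta> * cos \<theta>) * (dir_deriv b p x)\<^sup>2
       + is_ax b * (dir_deriv b p x * sin \<theta> * (2 * \<alpha> * P1 * cos \<theta> - 4 * \<alpha>\<^sup>2 * P * sin \<theta>)
         + 2 * \<alpha> * P * cos \<theta> * (dir_deriv b p1 x * sin \<theta> + 2 * \<alpha> * dir_deriv b p x * cos \<theta> + 2 * \<alpha> * P1 * cos \<theta> - 4 * \<alpha>\<^sup>2 * P * sin \<theta>))" for b
      by (simp add: dosc_def dosc1_def th is_ax_def P_def P1_def power2_eq_square algebra_simps)
    then have "(\<Sum>b\<in>Basis. dosc b t x * dosc1 b t x) = k * (sin \<theta>)\<^sup>2 + (2 * \<alpha> * sin \<theta> * cos \<theta>) * g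
       + (dir_deriv ax p x * sin \<theta> * (2 * \<alpha> * P1 * cos \<theta> - 4 * \<alpha>\<^sup>2 * P * sin \<theta>)
         + 2 * \<alpha> * P * cos \<theta> * (dir_deriv ax p1 x * sin \<theta> + 2 * \<alpha> * dir_deriv ax p x * cos \<theta> + 2 * \<alpha> * P1 * cos \<theta> - 4 * \<alpha>\<^sup>2 * P * sin \<theta>))"
      by (simp only: sum.distrib sel sum_distrib_right[symmetric] sum_distrib_left[symmetric] k_def g_def)
    also have "dir_deriv ax p x = P1" by (simp add: P1_def p1_def)
    also have "dir_deriv ax p1 x = p11" by (simp add: p11_def)
    finally show ?thesis by (simp add: algebra_simps)
  qed
  have s4: "(\<Sum>b\<in>Basis. dd1 b) = d * sin \<theta> + 2 * \<alpha> * l * cos \<theta> + 4 * \<alpha> * p11 * cos \<theta> - 12 * \<alpha>\<^sup>2 * P1 * sin \<theta> - 8 * \<alpha>^3 * P * cos \<theta>"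
    unfolding dd1_def sum.distrib sel d_def l_def by (simp add: sum_distrib_right sum_distrib_left mult_ac)
  have "laplace_x u (t, x) = (\<Sum>b\<in>Basis. G'' ?s * (dosc b t x)\<^sup>2 * ?\<phi> + G' ?s * (ddosc b t x * ?\<phi> + 2 * (dosc b t x * dosc1 b t x)) + G ?s * dd1 b)"
    unfolding laplace_x_Dxx by (intro sum.cong refl Dxx)
  also have "\<dots> = G'' ?s * (\<Sum>b\<in>Basis. (dosc b t x)\<^sup>2) * ?\<phi> + G' ?s * ((\<Sum>b\<in>Basis. ddosc b t x) * ?\<phi> + 2 * (\<Sum>b\<in>Basis. dosc b t x * dosc1 b t x)) + G ?s * (\<Sum>b\<in>Basis. dd1 b)"
    by (simp add: sum.distrib sum_distrib_left sum_distrib_right distrib_left)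
  finally have lap: "laplace_x u (t, x) = \<dots>" .
  have tr: "transport t x = 2 * \<alpha> * m * G ?s * P * cos \<theta>" by (simp add: transport_def th P_def)
  have "u (t, x) = G ?s * ?\<phi>" by (simp add: u_osc osc)
  with profile_equation[of t x] show ?thesis
    unfolding linear_residual_def lap tr s1 s2 s3 s4 by (simp only: add.assoc)
qed

end

section \<open>The order of vanishing of the profile\<close>

lemma power_series_leading_quotient:
  fixes f :: "real \<Rightarrow> real"
  assumes r: "r > 0" and s: "\<And>s. \<bar>s\<bar> < r \<Longrightarrow> (\<lambda>n. b n * s ^ n) sums f s" and z: "\<And>n. n < j \<Longrightarrow> b n = 0"
  shows "((\<lambda>s. f s / s ^ j) \<longlongrightarrow> b j) (at 0)"
proof -
  define h where "h s = (if s = 0 then b j else f s / s ^ j)" for s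
  have "(\<lambda>n. b (n + j) * s ^ n) sums h s" if "norm s < r" for s
  proof (cases "s = 0")
    case True
    then show ?thesis using powser_sums_zero[of "\<lambda>n. b (n + j)"] by (simp add: h_def)
  next
    case False
    have "(\<lambda>n. b (n + j) * s ^ (n + j)) sums (f s - (\<Sum>n<j. b n * s ^ n))"
      using s[of s] that by (subst sums_iff_shift) simp
    moreover have "(\<Sum>n<j. b n * s ^ n) = 0" by (rule sum.neutral) (use z in auto)
    ultimately have "(\<lambda>n. b (n + j) * s ^ (n + j) / s ^ j) sums (f s / s ^ j)" by (intro sums_divide) simp
    then show ?thesis using False by (simp add: h_def power_add)
  qed
  from powser_limit_0[OF r this] have "(h \<longlongrightarrow> b j) (at 0)" by simp
  moreover have "eventually (\<lambda>s. h s = f s / s ^ j) (at 0)"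
    by (auto simp: h_def eventually_at intro!: exI[of _ 1])
  ultimately show ?thesis by (rule Lim_transform_eventually)
qed

context breather begin

lemma small_far_on_line:
  assumes lim: "(f \<longlongrightarrow> 0) at_infinity" and "\<eta> > (0::real)"
  obtains N where "N \<ge> 0" "\<And>r. N \<le> \<bar>r\<bar> \<Longrightarrow> \<bar>f (x + r *\<^sub>R ax)\<bar> < \<eta>"
proof -
  obtain R where R: "\<And>y. norm y \<ge> R \<Longrightarrow> \<bar>f y\<bar> < \<eta>"
    using tendsto_0_at_infinityE[OF assms] by blast
  have "\<bar>f (x + r *\<^sub>R ax)\<bar> < \<eta>" if "\<bar>R\<bar> + norm x \<le> \<bar>r\<bar>" for r
  proof -
    have "norm (r *\<^sub>R ax) \<le> norm (x + r *\<^sub>R ax) + norm x"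
      by (metis add_diff_cancel_left' norm_triangle_ineq4)
    then show ?thesis using that by (intro R) simp
  qed
  then show thesis using that[of "\<bar>R\<bar> + norm x"] by simp
qed

lemma monotone_amplitude_contradiction:
  assumes "(\<forall>x. p x * p1 x \<le> 0) \<or> (\<forall>x. p x * p1 x \<ge> 0)"
  shows False
proof -
  obtain x where x: "p x \<noteq> 0" using admissible by (auto simp: admissible_amplitude_def)
  obtain N where N: "N \<ge> 0" "\<And>r. N \<le> \<bar>r\<bar> \<Longrightarrow> \<bar>p (x + r *\<^sub>R ax)\<bar> < \<bar>p x\<bar>"
    using small_far_on_line[OF p_tendsto, of "\<bar>p x\<bar>" x] x by auto
  define f where "f r = (p (x + r *\<^sub>R ax))\<^sup>2" for r
  have d: "(f has_real_derivative 2 * (p (x + r *\<^sub>R ax) * p1 (x + r *\<^sub>R ax))) (at r)" for r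
    unfolding f_def p1_def
    by (rule DERIV_cong, (rule derivative_intros has_pderiv_line[OF p_pderiv])+) simp
  have far: "f r < f 0" if "\<bar>r\<bar> = N" for r
    using N(2)[of r] that unfolding f_def
    by (metis abs_ge_zero add.right_neutral order_refl power2_abs power_strict_mono scaleR_zero_left zero_less_numeral)
  from assms show False
  proof
    assume h: "\<forall>x. p x * p1 x \<ge> 0"
    have "f 0 \<le> f N"
    proof (rule DERIV_nonneg_imp_nondecreasing[OF N(1)])
      fix r show "\<exists>y. (f has_real_derivative y) (at r) \<and> 0 \<le> y"
        using d[of r] h by (intro exI[of _ "2 * (p (x + r *\<^sub>R ax) * p1 (x + r *\<^sub>R ax))"]) simp
    qed
    then show False using far[of N] N(1) by simp
  next
    assume h: "\<forall>x. p x * p1 x \<le> 0"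
    have "f 0 \<le> f (- N)"
    proof (rule DERIV_nonpos_imp_nonincreasing[of "- N" 0 f])
      show "- N \<le> 0" using N(1) by simp
      fix r show "\<exists>y. (f has_real_derivative y) (at r) \<and> y \<le> 0"
        using d[of r] h by (intro exI[of _ "2 * (p (x + r *\<^sub>R ax) * p1 (x + r *\<^sub>R ax))"]) simp
    qed
    then show False using far[of "- N"] N(1) by simp
  qed
qed

lemma third_derivatives_exist:
  assumes m: "m \<noteq> 0" and \<eta>: "\<eta> > 0" and nz: "\<And>s. 0 < \<bar>s\<bar> \<Longrightarrow> \<bar>s\<bar> < \<eta> \<Longrightarrow> G s \<noteq> 0"
    and x: "p x \<noteq> 0 \<or> G 0 \<noteq> 0"
  obtains d3 where "\<And>b. b \<in> Basis \<Longrightarrow> ((\<lambda>r. dir_deriv b p1 (x + r *\<^sub>R b)) has_real_derivative d3 b) (at 0)"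
proof -
  define \<theta> where "\<theta> = min 1 (\<eta> / (\<bar>p x\<bar> + 1))"
  have \<theta>: "0 < \<theta>" "\<theta> \<le> 1" "\<theta> \<le> \<eta> / (\<bar>p x\<bar> + 1)" using \<eta> by (auto simp: \<theta>_def)
  have "\<theta> * (\<bar>p x\<bar> + 1) \<le> \<eta>" using \<theta>(3) by (simp add: pos_le_divide_eq)
  then have p\<theta>: "\<bar>p x\<bar> * \<theta> < \<eta>" using \<theta>(1) by (simp add: algebra_simps)
  have sp: "sin \<theta> > 0" using \<theta> pi_gt3 by (intro sin_gt_zero) auto
  have sl: "sin \<theta> \<le> \<theta>" using \<theta> by (intro sin_x_le_x) auto
  define t where "t = (\<theta> / (2 * \<alpha>) - x $ e) / m"
  have th: "theta t x = \<theta>" using m alpha_pos by (simp add: theta_def t_def)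
  have "\<bar>p x * sin \<theta>\<bar> \<le> \<bar>p x\<bar> * \<theta>" using sp sl by (simp add: abs_mult mult_left_mono)
  then have "\<bar>osc t x\<bar> < \<eta>" using p\<theta> by (simp add: osc_def th)
  moreover have "p x = 0 \<longrightarrow> osc t x = 0" "p x \<noteq> 0 \<longrightarrow> osc t x \<noteq> 0" using sp by (auto simp: osc_def th)
  ultimately have "G (osc t x) \<noteq> 0" using nz[of "osc t x"] x by (cases "p x = 0") auto
  then have "\<forall>b\<in>Basis. \<exists>D. ((\<lambda>r. dir_deriv b p1 (x + r *\<^sub>R b)) has_real_derivative D) (at 0)"
    using p1_third_derivative_exists[of _ t x] sp by (auto simp: th)
  then obtain d3 where "\<forall>b\<in>Basis. ((\<lambda>r. dir_deriv b p1 (x + r *\<^sub>R b)) has_real_derivative d3 b) (at 0)" by (rule bchoice[THEN exE])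
  then show thesis using that by blast
qed

text \<open>At \<theta> = 0 and \<theta> = \<pi> the argument s of F is 0 and cos \<theta> changes sign. So the sum of both identities retains only the terms that are even in cos \<theta>.\<close>

lemma even_part_identity:
  assumes m: "m \<noteq> 0"
    and d3: "\<And>b. b \<in> Basis \<Longrightarrow> ((\<lambda>r. dir_deriv b p1 (x + r *\<^sub>R b)) has_real_derivative d3 b) (at 0)"
  shows "24 * \<alpha>\<^sup>2 * G' 0 * (p x * p1 x) + (2 * \<alpha> * G 0 * p x) ^ q + (- (2 * \<alpha> * G 0 * p x)) ^ q = 0"
proof -
  note E = profile_identity[OF m d3]
  from E[of 0] E[of pi] show ?thesis
    by (simp add: linear_residual_def algebra_simps power2_eq_square power3_eq_cube)
qed

text \<open>Here j = k - 3 for a zero of order k \<ge> 3 of F. After division by s^j all terms except the one with G'' tend to 0 as \<theta> \<rightarrow> 0, and this term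
tends to 8 \<alpha>^3 P^3 c. In the nonlinear term one factor G is divided by s^j.\<close>

lemma no_high_order_zero:
  assumes m: "m \<noteq> 0" and c: "c \<noteq> 0" and nz: "\<And>s. 0 < \<bar>s\<bar> \<Longrightarrow> \<bar>s\<bar> < \<eta> \<Longrightarrow> G s \<noteq> 0" and \<eta>: "\<eta> > 0"
    and l0: "((\<lambda>s. G s / s ^ j) \<longlongrightarrow> 0) (at 0)" and l1: "((\<lambda>s. G' s / s ^ j) \<longlongrightarrow> 0) (at 0)"
    and l2: "((\<lambda>s. G'' s / s ^ j) \<longlongrightarrow> c) (at 0)"
  shows False
proof -
  obtain x where x: "p x \<noteq> 0" using admissible by (auto simp: admissible_amplitude_def)
  define P where "P = p x"
  have P: "P \<noteq> 0" using x by (simp add: P_def)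
  obtain d3 where d3: "\<And>b. b \<in> Basis \<Longrightarrow> ((\<lambda>r. dir_deriv b p1 (x + r *\<^sub>R b)) has_real_derivative d3 b) (at 0)"
    using third_derivatives_exist[OF m \<eta> nz, of x] x by blast
  obtain g l k d p11 P1 where E: "\<And>\<theta>. linear_residual g l k d p11 P P1 (G (P * sin \<theta>)) (G' (P * sin \<theta>)) (G'' (P * sin \<theta>)) (sin \<theta>) (cos \<theta>)
    + 2 * (G (P * sin \<theta>) * (P1 * sin \<theta> + 2 * \<alpha> * P * cos \<theta>)) ^ q = 0"
    using profile_identity[OF m d3] unfolding P_def by blast
  define K where "K A0 A1 A2 B \<sigma> \<gamma> = linear_residual g l k d p11 P P1 A0 A1 A2 \<sigma> \<gamma>
    + 2 * A0 * B ^ (q - 1) * (P1 * \<sigma> + 2 * \<alpha> * P * \<gamma>) ^ q" for A0 A1 A2 B \<sigma> \<gamma>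
  let ?s = "\<lambda>\<theta>. P * sin \<theta>"
  have slim: "filterlim ?s (at 0) (at 0)"
    unfolding filterlim_at
  proof
    show "(?s \<longlongrightarrow> 0) (at 0)" by (auto intro!: tendsto_eq_intros)
    have "sin \<theta> \<noteq> 0" if "\<theta> \<noteq> 0" "\<bar>\<theta>\<bar> < 1" for \<theta> :: real
      using sin_gt_zero[of \<theta>] sin_gt_zero[of "- \<theta>"] that pi_gt3 by (cases "\<theta> > 0") auto
    then show "\<forall>\<^sub>F \<theta> in at 0. ?s \<theta> \<in> UNIV \<and> ?s \<theta> \<noteq> 0"
      using P by (auto simp: eventually_at intro!: exI[of _ 1])
  qed
  have zero: "K (G (?s \<theta>) / ?s \<theta> ^ j) (G' (?s \<theta>) / ?s \<theta> ^ j) (G'' (?s \<theta>) / ?s \<theta> ^ j) (G (?s \<theta>)) (sin \<theta>) (cos \<theta>) = 0" for \<theta>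
  proof -
    have "G (?s \<theta>) * G (?s \<theta>) ^ (q - 1) = G (?s \<theta>) ^ q" using q_ge_2 by (simp add: power_eq_if)
    then have "K (G (?s \<theta>) / ?s \<theta> ^ j) (G' (?s \<theta>) / ?s \<theta> ^ j) (G'' (?s \<theta>) / ?s \<theta> ^ j) (G (?s \<theta>)) (sin \<theta>) (cos \<theta>)
      = 0 / ?s \<theta> ^ j"
      unfolding E[of \<theta>, symmetric] K_def linear_residual_def
      by (simp add: add_divide_distrib power_mult_distrib mult.assoc)
    then show ?thesis by simp
  qed
  have Glim: "((\<lambda>\<theta>. G (?s \<theta>)) \<longlongrightarrow> G 0) (at 0)"
  proof -
    have "(G \<longlongrightarrow> G 0) (at 0)" using DERIV_isCont[OF G_DERIV, of 0] by (simp add: continuous_at)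
    then show ?thesis by (rule filterlim_compose[OF _ slim])
  qed
  have trig: "(sin \<longlongrightarrow> (0::real)) (at 0)" "(cos \<longlongrightarrow> (1::real)) (at 0)"
    by (auto intro!: tendsto_eq_intros)
  have "((\<lambda>\<theta>. K (G (?s \<theta>) / ?s \<theta> ^ j) (G' (?s \<theta>) / ?s \<theta> ^ j) (G'' (?s \<theta>) / ?s \<theta> ^ j) (G (?s \<theta>)) (sin \<theta>) (cos \<theta>))
      \<longlongrightarrow> K 0 0 c (G 0) 0 1) (at 0)"
    unfolding K_def linear_residual_def
    by (intro tendsto_intros trig Glim filterlim_compose[OF l0 slim] filterlim_compose[OF l1 slim] filterlim_compose[OF l2 slim])
  then have "K 0 0 c (G 0) 0 1 = 0" unfolding zero by (simp add: tendsto_const_iff)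
  then show False using c P alpha_pos by (simp add: K_def linear_residual_def)
qed

end

section \<open>Odd powers and a first integral\<close>

context breather begin

text \<open>On the hyperplane \<theta> = 0 of space-time u is 2 \<alpha> G(0) p, and this hyperplane is the image of a linear map.\<close>

lemma smooth_amplitude:
  assumes m: "m \<noteq> 0" and G0: "G 0 \<noteq> 0"
  shows "smooth p"
proof -
  define l where "l x = (- (x $ e) / m, x)" for x :: "real ^ 'n"
  have l: "linear l" unfolding l_def by (rule linearI) (auto simp: add_divide_distrib diff_divide_distrib)
  have "p x = (1 / (2 * \<alpha> * G 0)) * u (l x)" for x
  proof -
    have "theta (- (x $ e) / m) x = 0" using m by (simp add: theta_def)
    then show ?thesis using G0 alpha_pos by (simp add: l_def u_formula)
  qed
  then have "p = (\<lambda>x. (1 / (2 * \<alpha> * G 0)) * u (l x))" by (rule ext)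
  moreover have "smooth (\<lambda>x. (1 / (2 * \<alpha> * G 0)) * u (l x))"
    using u_smooth unfolding smooth_def by (intro allI of_class_C_cmult of_class_C_linear_compose[OF l]) blast
  ultimately show ?thesis by simp
qed

lemma constant_on_lines_zero:
  assumes d: "has_pderiv f ax (\<lambda>x. 0)" and lim: "(f \<longlongrightarrow> 0) at_infinity"
  shows "f x = 0"
proof (rule ccontr)
  assume nz: "f x \<noteq> 0"
  then obtain N where N: "N \<ge> 0" "\<And>r. N \<le> \<bar>r\<bar> \<Longrightarrow> \<bar>f (x + r *\<^sub>R ax)\<bar> < \<bar>f x\<bar>"
    using small_far_on_line[OF lim, of "\<bar>f x\<bar>" x] by auto
  moreover have "f (x + N *\<^sub>R ax) = f x"
    using DERIV_isconst_all[of "\<lambda>r. f (x + r *\<^sub>R ax)" N 0] has_pderiv_line[OF d] by auto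
  ultimately show False using N(2)[of N] by simp
qed

text \<open>Let l = \<Delta>p. The identity I at \<theta> = 0 involves l, the second derivative p11, and p^q. Its derivative along x_1, minus 2 \<alpha> times the identity II for
\<partial>_1 l, involves neither l nor p^q any more; this is the third-order equation for p on lines. It is integrated twice,
with constants of integration 0 because p and its first two derivatives tend to 0.\<close>

lemma amplitude_ode:
  assumes m: "m \<noteq> 0" and q: "odd q" and G0: "G 0 \<noteq> 0" and G1: "G' 0 = 0"
  shows "(p1 x)\<^sup>2 = (p x)\<^sup>2 * (2 * \<alpha>\<^sup>2 * G'' 0 / G 0 * (p x)\<^sup>2 - (4 * \<alpha>\<^sup>2 + m / 2))"
proof -
  have sp: "smooth p" by (rule smooth_amplitude[OF m G0])
  have sp1: "smooth p1" unfolding p1_def by (intro smooth_dir_deriv sp ax_Basis)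
  define p11 where "p11 = dir_deriv ax p1"
  define p111 where "p111 = dir_deriv ax p11"
  define l where "l x = (\<Sum>b\<in>Basis. dir_deriv b (dir_deriv b p) x)" for x
  define d where "d x = (\<Sum>b\<in>Basis. dir_deriv b (dir_deriv b p1) x)" for x
  have pd: "has_pderiv p ax p1" unfolding p1_def by (rule smooth_pderiv[OF sp])
  have p1d: "has_pderiv p1 ax p11" unfolding p11_def by (rule smooth_pderiv[OF sp1])
  have p11d: "has_pderiv p11 ax p111"
    unfolding p111_def p11_def by (intro smooth_pderiv smooth_dir_deriv sp1 ax_Basis)
  have ld: "has_pderiv l ax d"
  proof -
    have "has_pderiv (dir_deriv b (dir_deriv b p)) ax (dir_deriv b (dir_deriv b p1))" if b: "b \<in> Basis" for b
    proof -
      have "dir_deriv ax (dir_deriv b (dir_deriv b p)) = dir_deriv b (dir_deriv ax (dir_deriv b p))"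
        using smooth_dir_deriv[OF sp b] b by (intro dir_deriv_commute[of 0]) (auto simp: smooth_def)
      also have "dir_deriv ax (dir_deriv b p) = dir_deriv b (dir_deriv ax p)"
        using sp b by (intro dir_deriv_commute[of 0]) (auto simp: smooth_def)
      finally have "dir_deriv ax (dir_deriv b (dir_deriv b p)) = dir_deriv b (dir_deriv b p1)" by (simp add: p1_def)
      moreover have "has_pderiv (dir_deriv b (dir_deriv b p)) ax (dir_deriv ax (dir_deriv b (dir_deriv b p)))"
        by (intro smooth_pderiv smooth_dir_deriv sp b)
      ultimately show ?thesis by simp
    qed
    then show ?thesis unfolding has_pderiv_def l_def d_def by (auto intro!: DERIV_sum)
  qed
  have d3: "((\<lambda>r. dir_deriv b p1 (x + r *\<^sub>R b)) has_real_derivative dir_deriv b (dir_deriv b p1) x) (at 0)"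
    if "b \<in> Basis" for b x
    by (intro has_pderivD smooth_pderiv smooth_dir_deriv sp1 that)
  have I: "2 * \<alpha> * m * G 0 * p x + 8 * \<alpha>^3 * G'' 0 * (p x)^3 + G 0 * (2 * \<alpha> * l x + 4 * \<alpha> * p11 x - 8 * \<alpha>^3 * p x)
      + 2 * (2 * \<alpha> * G 0 * p x) ^ q = 0" for x
    using profile_identity[OF m d3, of x 0]
    by (simp add: linear_residual_def G1 l_def[symmetric] p11_def[symmetric] power2_eq_square power3_eq_cube algebra_simps)
  have II: "36 * \<alpha>\<^sup>2 * G'' 0 * (p x)\<^sup>2 * p1 x + G 0 * (d x - 12 * \<alpha>\<^sup>2 * p1 x)
      + 2 * real q * (2 * \<alpha> * G 0 * p x) ^ (q - 1) * G 0 * p1 x = 0" for x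
  proof -
    define g where "g = (\<Sum>b\<in>Basis. (dir_deriv b p x)\<^sup>2)"
    define k where "k = (\<Sum>b\<in>Basis. dir_deriv b p x * dir_deriv b p1 x)"
    define P where "P = p x"
    define P1 where "P1 = p1 x"
    define G3 where "G3 = dir_deriv 1 G''"
    have G''_DERIV: "(G'' has_real_derivative G3 s) (at s)" for s
      unfolding G3_def by (rule smooth_real_DERIV[OF smooth_G(3)])
    define E where "E \<theta> = linear_residual g (l x) k (d x) (p11 x) P P1 (G (P * sin \<theta>)) (G' (P * sin \<theta>)) (G'' (P * sin \<theta>)) (sin \<theta>) (cos \<theta>)
      + 2 * (G (P * sin \<theta>) * (P1 * sin \<theta> + 2 * \<alpha> * P * cos \<theta>)) ^ q" for \<theta>
    have E0: "E \<theta> = 0" for \<theta>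
      using profile_identity[OF m d3, of x \<theta>]
      by (simp only: E_def g_def k_def P_def P1_def l_def d_def p11_def)
    (* The term with G3 does not change sign between \<theta> = 0 and \<theta> = pi, all other terms do since q is odd. Their difference is II. *)
    have deriv: "8 * \<alpha>^3 * G3 0 * P^4 + c * (36 * \<alpha>\<^sup>2 * G'' 0 * P\<^sup>2 * P1 + G 0 * (d x - 12 * \<alpha>\<^sup>2 * P1))
        + c * (2 * real q * (2 * \<alpha> * G 0 * P) ^ (q - 1) * G 0 * P1) = 0"
      if sc: "sin \<theta> = 0" "cos \<theta> = c" "c * c = 1" for \<theta> c
    proof -
      have s: "((\<lambda>\<theta>. P * sin \<theta>) has_real_derivative P * c) (at \<theta>)"
        by (rule DERIV_cong, (rule derivative_intros)+) (simp add: sc)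
      have Gs: "((\<lambda>\<theta>. G (P * sin \<theta>)) has_real_derivative 0) (at \<theta>)"
        using DERIV_chain2[OF G_DERIV s] by (simp add: sc G1)
      have G's: "((\<lambda>\<theta>. G' (P * sin \<theta>)) has_real_derivative G'' 0 * (P * c)) (at \<theta>)"
        using DERIV_chain2[OF G'_DERIV s] by (simp add: sc)
      have G''s: "((\<lambda>\<theta>. G'' (P * sin \<theta>)) has_real_derivative G3 0 * (P * c)) (at \<theta>)"
        using DERIV_chain2[OF G''_DERIV s] by (simp add: sc)
      have even: "even (q - 1)" using q q_ge_2 by simp
      have "c ^ (q - 1) = (c * c) ^ ((q - 1) div 2)"
        using even by (metis power2_eq_square power_mult dvd_mult_div_cancel)
      then have cq: "c ^ (q - 1) = 1" by (simp add: sc)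
      let ?\<phi> = "\<lambda>\<theta>. P1 * sin \<theta> + 2 * \<alpha> * P * cos \<theta>"
      let ?Q = "\<lambda>\<theta>. g * (sin \<theta>)\<^sup>2 + 4 * \<alpha> * P * P1 * sin \<theta> * cos \<theta> + 4 * \<alpha>\<^sup>2 * P\<^sup>2 * (cos \<theta>)\<^sup>2"
      let ?W = "\<lambda>\<theta>. (l x * sin \<theta> + 4 * \<alpha> * P1 * cos \<theta> - 4 * \<alpha>\<^sup>2 * P * sin \<theta>) * ?\<phi> \<theta>
        + 2 * (k * (sin \<theta>)\<^sup>2 + 2 * \<alpha> * g * sin \<theta> * cos \<theta> + P1 * sin \<theta> * (2 * \<alpha> * P1 * cos \<theta> - 4 * \<alpha>\<^sup>2 * P * sin \<theta>)
          + 2 * \<alpha> * P * cos \<theta> * (p11 x * sin \<theta> + 4 * \<alpha> * P1 * cos \<theta> - 4 * \<alpha>\<^sup>2 * P * sin \<theta>))"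
      let ?T = "\<lambda>\<theta>. d x * sin \<theta> + 2 * \<alpha> * l x * cos \<theta> + 4 * \<alpha> * p11 x * cos \<theta> - 12 * \<alpha>\<^sup>2 * P1 * sin \<theta> - 8 * \<alpha>^3 * P * cos \<theta>"
      have d\<phi>: "(?\<phi> has_real_derivative P1 * c) (at \<theta>)"
        by (rule DERIV_cong, (rule derivative_intros)+) (simp add: sc)
      have dQ: "(?Q has_real_derivative 4 * \<alpha> * P * P1 * (c * c)) (at \<theta>)"
        by (rule DERIV_cong, (rule derivative_intros)+) (simp add: sc)
      have "(?T has_real_derivative d x * cos \<theta> + 2 * \<alpha> * l x * - sin \<theta> + 4 * \<alpha> * p11 x * - sin \<theta>
          - 12 * \<alpha>\<^sup>2 * P1 * cos \<theta> - 8 * \<alpha>^3 * P * - sin \<theta>) (at \<theta>)"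
        by (intro DERIV_add DERIV_diff DERIV_cmult DERIV_sin DERIV_cos)
      then have dT: "(?T has_real_derivative (d x - 12 * \<alpha>\<^sup>2 * P1) * c) (at \<theta>)"
        by (rule DERIV_cong) (simp add: sc algebra_simps)
      have "sin differentiable (at \<theta>)" "cos differentiable (at \<theta>)"
        using DERIV_sin DERIV_cos real_differentiable_def by blast+
      then have "?W differentiable (at \<theta>)"
        by (intro derivative_intros)
      (* Below this derivative is multiplied by G' 0 = 0, so its existence suffices. *)
      then obtain W' where dW: "(?W has_real_derivative W') (at \<theta>)" using real_differentiable_def by blast
      have v: "?\<phi> \<theta> = 2 * \<alpha> * P * c" "?Q \<theta> = 4 * \<alpha>\<^sup>2 * P\<^sup>2 * (c * c)" "?W \<theta> = 24 * \<alpha>\<^sup>2 * P * P1 * (c * c)"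
        "G (P * sin \<theta>) = G 0" "G' (P * sin \<theta>) = 0" "G'' (P * sin \<theta>) = G'' 0"
        by (simp_all add: sc G1 power2_eq_square)
      have "((\<lambda>\<theta>. 2 * \<alpha> * m * G (P * sin \<theta>) * P * cos \<theta>) has_real_derivative 0) (at \<theta>)"
        by (rule DERIV_cong, (rule derivative_intros Gs)+) (simp add: sc)
      moreover have "((\<lambda>\<theta>. G'' (P * sin \<theta>) * ?Q \<theta> * ?\<phi> \<theta>) has_real_derivative
          (G3 0 * (P * c) * (4 * \<alpha>\<^sup>2 * P\<^sup>2 * (c * c)) + 4 * \<alpha> * P * P1 * (c * c) * G'' 0) * (2 * \<alpha> * P * c)
          + P1 * c * (G'' 0 * (4 * \<alpha>\<^sup>2 * P\<^sup>2 * (c * c)))) (at \<theta>)"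
        using DERIV_mult[OF DERIV_mult[OF G''s dQ] d\<phi>] unfolding v by (simp only: mult.commute)
      moreover have "((\<lambda>\<theta>. G' (P * sin \<theta>) * ?W \<theta>) has_real_derivative
          G'' 0 * (P * c) * (24 * \<alpha>\<^sup>2 * P * P1 * (c * c))) (at \<theta>)"
        by (rule DERIV_cong[OF DERIV_mult[OF G's dW]]) (unfold v(3,5), simp)
      moreover have "((\<lambda>\<theta>. G (P * sin \<theta>) * ?T \<theta>) has_real_derivative (d x - 12 * \<alpha>\<^sup>2 * P1) * c * G 0) (at \<theta>)"
        using DERIV_mult[OF Gs dT] unfolding v by simp
      moreover have "((\<lambda>\<theta>. 2 * (G (P * sin \<theta>) * ?\<phi> \<theta>) ^ q) has_real_derivative
          2 * (real q * (G 0 * (2 * \<alpha> * P * c)) ^ (q - 1) * (G 0 * (P1 * c)))) (at \<theta>)"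
        by (rule DERIV_cong[OF DERIV_cmult[OF DERIV_power[OF DERIV_mult[OF Gs d\<phi>]]]]) (unfold v(1,4), simp add: mult_ac)
      ultimately have "(E has_real_derivative 0
          + ((G3 0 * (P * c) * (4 * \<alpha>\<^sup>2 * P\<^sup>2 * (c * c)) + 4 * \<alpha> * P * P1 * (c * c) * G'' 0) * (2 * \<alpha> * P * c)
          + P1 * c * (G'' 0 * (4 * \<alpha>\<^sup>2 * P\<^sup>2 * (c * c))))
          + G'' 0 * (P * c) * (24 * \<alpha>\<^sup>2 * P * P1 * (c * c)) + (d x - 12 * \<alpha>\<^sup>2 * P1) * c * G 0
          + 2 * (real q * (G 0 * (2 * \<alpha> * P * c)) ^ (q - 1) * (G 0 * (P1 * c)))) (at \<theta>)"
        unfolding E_def linear_residual_def by (intro DERIV_add)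
      then have "(E has_real_derivative 8 * \<alpha>^3 * G3 0 * P^4 * (c * c * (c * c)) + c * c * c * (12 * \<alpha>\<^sup>2 * G'' 0 * P\<^sup>2 * P1) + c * c * c * (24 * \<alpha>\<^sup>2 * G'' 0 * P\<^sup>2 * P1)
          + c * (G 0 * (d x - 12 * \<alpha>\<^sup>2 * P1)) + 2 * (real q * (G 0 * (2 * \<alpha> * P * c)) ^ (q - 1) * (G 0 * (P1 * c)))) (at \<theta>)"
        by (rule DERIV_cong) (simp add: algebra_simps power2_eq_square power3_eq_cube power4_eq_xxxx)
      moreover have "(E has_real_derivative 0) (at \<theta>)" unfolding E0[abs_def] by simp
      ultimately have "8 * \<alpha>^3 * G3 0 * P^4 * (c * c * (c * c)) + c * c * c * (12 * \<alpha>\<^sup>2 * G'' 0 * P\<^sup>2 * P1) + c * c * c * (24 * \<alpha>\<^sup>2 * G'' 0 * P\<^sup>2 * P1)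
          + c * (G 0 * (d x - 12 * \<alpha>\<^sup>2 * P1)) + 2 * (real q * (G 0 * (2 * \<alpha> * P * c)) ^ (q - 1) * (G 0 * (P1 * c))) = 0"
        by (rule DERIV_unique)
      moreover have "(G 0 * (2 * \<alpha> * P * c)) ^ (q - 1) = (2 * \<alpha> * G 0 * P) ^ (q - 1)"
        using cq by (simp add: power_mult_distrib mult_ac)
      ultimately show ?thesis by (simp only: sc(3)) (simp add: algebra_simps)
    qed
    from deriv[of 0 1] deriv[of pi "- 1"] show ?thesis
      by (simp add: P_def[symmetric] P1_def[symmetric] algebra_simps)
  qed
  have dI: "2 * \<alpha> * m * G 0 * p1 x + 24 * \<alpha>^3 * G'' 0 * (p x)\<^sup>2 * p1 x + G 0 * (2 * \<alpha> * d x + 4 * \<alpha> * p111 x - 8 * \<alpha>^3 * p1 x)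
      + 2 * (real q * (2 * \<alpha> * G 0 * p x) ^ (q - 1) * (2 * \<alpha> * G 0 * p1 x)) = 0" for x
  proof (rule DERIV_unique)
    let ?f = "\<lambda>x. 2 * \<alpha> * m * G 0 * p x + 8 * \<alpha>^3 * G'' 0 * (p x)^3 + G 0 * (2 * \<alpha> * l x + 4 * \<alpha> * p11 x - 8 * \<alpha>^3 * p x)
      + 2 * (2 * \<alpha> * G 0 * p x) ^ q"
    show "((\<lambda>r. ?f (x + r *\<^sub>R ax)) has_real_derivative 0) (at 0)" unfolding I by simp
    show "((\<lambda>r. ?f (x + r *\<^sub>R ax)) has_real_derivative 2 * \<alpha> * m * G 0 * p1 x + 24 * \<alpha>^3 * G'' 0 * (p x)\<^sup>2 * p1 x + G 0 * (2 * \<alpha> * d x + 4 * \<alpha> * p111 x - 8 * \<alpha>^3 * p1 x)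
      + 2 * (real q * (2 * \<alpha> * G 0 * p x) ^ (q - 1) * (2 * \<alpha> * G 0 * p1 x))) (at 0)"
      by (rule DERIV_cong, (rule derivative_intros has_pderivD[OF pd] has_pderivD[OF p11d] has_pderivD[OF ld])+)
         (simp add: algebra_simps)
  qed
  define M where "M = 4 * \<alpha>\<^sup>2 + m / 2"
  define N where "N = 4 * \<alpha>\<^sup>2 * G'' 0 / G 0"
  have third: "p111 x + M * p1 x - 3 * N * (p x)\<^sup>2 * p1 x = 0" for x
  proof -
    have "4 * \<alpha> * G 0 * (p111 x + M * p1 x - 3 * N * (p x)\<^sup>2 * p1 x)
       = (2 * \<alpha> * m * G 0 * p1 x + 24 * \<alpha>^3 * G'' 0 * (p x)\<^sup>2 * p1 x + G 0 * (2 * \<alpha> * d x + 4 * \<alpha> * p111 x - 8 * \<alpha>^3 * p1 x)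
      + 2 * (real q * (2 * \<alpha> * G 0 * p x) ^ (q - 1) * (2 * \<alpha> * G 0 * p1 x)))
       - 2 * \<alpha> * (36 * \<alpha>\<^sup>2 * G'' 0 * (p x)\<^sup>2 * p1 x + G 0 * (d x - 12 * \<alpha>\<^sup>2 * p1 x)
      + 2 * real q * (2 * \<alpha> * G 0 * p x) ^ (q - 1) * G 0 * p1 x)"
      using G0 by (simp add: M_def N_def algebra_simps power2_eq_square power3_eq_cube)
    then have "4 * \<alpha> * G 0 * (p111 x + M * p1 x - 3 * N * (p x)\<^sup>2 * p1 x) = 0" unfolding dI II by simp
    then show ?thesis using G0 alpha_pos by simp
  qed
  have p11_lim: "(p11 \<longlongrightarrow> 0) at_infinity" unfolding p11_def p1_def by (intro ddp_tendsto ax_Basis)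
  have p1_lim: "(p1 \<longlongrightarrow> 0) at_infinity" unfolding p1_def by (intro dp_tendsto ax_Basis)
  have second: "p11 x + M * p x - N * (p x)^3 = 0" for x
  proof (rule constant_on_lines_zero)
    show "has_pderiv (\<lambda>x. p11 x + M * p x - N * (p x)^3) ax (\<lambda>x. 0)"
      unfolding has_pderiv_def
    proof
      fix x show "((\<lambda>r. p11 (x + r *\<^sub>R ax) + M * p (x + r *\<^sub>R ax) - N * (p (x + r *\<^sub>R ax))^3) has_real_derivative 0) (at 0)"
        by (rule DERIV_cong, (rule derivative_intros has_pderivD[OF pd] has_pderivD[OF p11d])+)
           (use third[of x] in \<open>simp add: algebra_simps power2_eq_square\<close>)
    qed
    show "((\<lambda>x. p11 x + M * p x - N * (p x)^3) \<longlongrightarrow> 0) at_infinity"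
      by (auto intro!: tendsto_eq_intros p11_lim p_tendsto)
  qed
  have "(p1 x)\<^sup>2 + M * (p x)\<^sup>2 - N / 2 * (p x)^4 = 0" for x
  proof (rule constant_on_lines_zero)
    show "has_pderiv (\<lambda>x. (p1 x)\<^sup>2 + M * (p x)\<^sup>2 - N / 2 * (p x)^4) ax (\<lambda>x. 0)"
      unfolding has_pderiv_def
    proof
      fix x
      have "2 * p1 x * (p11 x + M * p x - N * (p x)^3) = 0" by (simp add: second)
      then have z: "2 * p1 x * p11 x + M * (2 * p x * p1 x) - N / 2 * (4 * (p x)^3 * p1 x) = 0"
        by (simp add: algebra_simps)
      have "((\<lambda>r. (p1 (x + r *\<^sub>R ax))\<^sup>2 + M * (p (x + r *\<^sub>R ax))\<^sup>2 - N / 2 * (p (x + r *\<^sub>R ax))^4) has_real_derivative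
          2 * p1 x * p11 x + M * (2 * p x * p1 x) - N / 2 * (4 * (p x)^3 * p1 x)) (at 0)"
        by (rule DERIV_cong, (rule derivative_intros has_pderivD[OF pd] has_pderivD[OF p1d])+)
           (simp add: algebra_simps)
      then show "((\<lambda>r. (p1 (x + r *\<^sub>R ax))\<^sup>2 + M * (p (x + r *\<^sub>R ax))\<^sup>2 - N / 2 * (p (x + r *\<^sub>R ax))^4) has_real_derivative 0) (at 0)"
        unfolding z .
    qed
    show "((\<lambda>x. (p1 x)\<^sup>2 + M * (p x)\<^sup>2 - N / 2 * (p x)^4) \<longlongrightarrow> 0) at_infinity"
      by (auto intro!: tendsto_eq_intros p1_lim p_tendsto)
  qed
  from this[of x] show ?thesis
    by (simp add: M_def N_def algebra_simps power2_eq_square power4_eq_xxxx)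
qed

text \<open>On a line where p is not identically 0, p^2 has a positive maximum, at which \<partial>_1 p = 0 and hence K p^2 = M. So the union Z of these lines is
the set swept out by translating the compact set p^2 = M/K along the line, which is closed, while Z is open by continuity. Being nonempty, Z is the whole space.\<close>

lemma first_integral_contradiction:
  assumes card: "CARD('n) \<ge> 2" and ode: "\<And>x. (p1 x)\<^sup>2 = (p x)\<^sup>2 * (K * (p x)\<^sup>2 - M)"
  shows False
proof -
  have attain: "\<exists>r. p (x + r *\<^sub>R ax) \<noteq> 0 \<and> K * (p (x + r *\<^sub>R ax))\<^sup>2 = M" if x: "p x \<noteq> 0" for x
  proof -
    define f where "f r = (p (x + r *\<^sub>R ax))\<^sup>2" for r
    have d: "(f has_real_derivative 2 * (p (x + r *\<^sub>R ax) * p1 (x + r *\<^sub>R ax))) (at r)" for r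
      unfolding f_def p1_def
      by (rule DERIV_cong, (rule derivative_intros has_pderiv_line[OF p_pderiv])+) simp
    obtain N where N: "N \<ge> 0" "\<And>r. N \<le> \<bar>r\<bar> \<Longrightarrow> \<bar>p (x + r *\<^sub>R ax)\<bar> < \<bar>p x\<bar>"
      using small_far_on_line[OF p_tendsto, of "\<bar>p x\<bar>" x] x by auto
    have far: "f r \<le> f 0" if "\<bar>r\<bar> \<ge> N" for r
      using N(2)[OF that] unfolding f_def by (simp add: abs_le_square_iff[symmetric] less_imp_le)
    have "continuous_on {-N..N} f"
      by (rule continuous_at_imp_continuous_on) (use d DERIV_isCont in blast)
    then obtain r where r: "r \<in> {-N..N}" "\<And>y. y \<in> {-N..N} \<Longrightarrow> f y \<le> f r"
      using continuous_attains_sup[of "{-N..N}" f] N(1) by auto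
    have max: "f y \<le> f r" for y
      using r(2)[of y] r(2)[of 0] far[of y] N(1) by (cases "y \<in> {-N..N}") (auto simp: abs_if split: if_splits)
    have "2 * (p (x + r *\<^sub>R ax) * p1 (x + r *\<^sub>R ax)) = 0"
      by (rule DERIV_local_max[OF d, of 1]) (use max in auto)
    moreover have nz: "p (x + r *\<^sub>R ax) \<noteq> 0"
      using max[of 0] x unfolding f_def by auto
    ultimately have "p1 (x + r *\<^sub>R ax) = 0" by simp
    with ode[of "x + r *\<^sub>R ax"] nz have "K * (p (x + r *\<^sub>R ax))\<^sup>2 = M" by simp
    with nz show ?thesis by blast
  qed
  obtain x0 where x0: "p x0 \<noteq> 0" using admissible by (auto simp: admissible_amplitude_def)
  have K0: "K \<noteq> 0"
  proof
    assume "K = 0"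
    with attain[OF x0] have "M = 0" by auto
    then have "p1 x = 0" for x using ode[of x] \<open>K = 0\<close> by simp
    then show False using monotone_amplitude_contradiction by simp
  qed
  define C where "C = M / K"
  have attain': "\<exists>r. p (x + r *\<^sub>R ax) \<noteq> 0 \<and> (p (x + r *\<^sub>R ax))\<^sup>2 = C" if x: "p x \<noteq> 0" for x
    using attain[OF x] K0 by (auto simp: C_def nonzero_eq_divide_eq mult.commute)
  obtain r0 where "p (x0 + r0 *\<^sub>R ax) \<noteq> 0" "(p (x0 + r0 *\<^sub>R ax))\<^sup>2 = C" using attain'[OF x0] by blast
  then have C: "C > 0" by (metis zero_less_power2)
  define Z where "Z = {x. \<exists>r. p (x + r *\<^sub>R ax) \<noteq> 0}"
  have "open Z"
  proof -
    have "Z = (\<Union>r. {x. p (x + r *\<^sub>R ax) \<noteq> 0})" by (auto simp: Z_def)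
    moreover have "open {x. p (x + r *\<^sub>R ax) \<noteq> 0}" for r
      by (intro open_Collect_neq continuous_on_compose2[OF continuous_p[of UNIV]] continuous_intros) auto
    ultimately show ?thesis by auto
  qed
  moreover have "closed Z"
  proof -
    define X where "X = {x. (p x)\<^sup>2 = C}"
    have "closed X" unfolding X_def by (intro closed_Collect_eq continuous_intros continuous_p)
    obtain R where R: "\<And>y. norm y \<ge> R \<Longrightarrow> \<bar>p y\<bar> < sqrt C"
      using tendsto_0_at_infinityE[OF p_tendsto, of "sqrt C"] C by auto
    have "X \<subseteq> cball 0 R"
    proof
      fix y assume "y \<in> X"
      then have "\<bar>p y\<bar> = sqrt C" by (auto simp: X_def)
      then have "\<not> norm y \<ge> R" using R[of y] by auto
      then show "y \<in> cball 0 R" by simp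
    qed
    then have "compact X" using \<open>closed X\<close> by (meson bounded_cball bounded_subset compact_eq_bounded_closed)
    moreover have "closed (range (\<lambda>r. r *\<^sub>R ax))"
    proof -
      have "range (\<lambda>r. r *\<^sub>R ax) = span {ax}" by (auto simp: span_singleton)
      then show ?thesis by (simp add: closed_span)
    qed
    ultimately have "closed (\<Union>x\<in>range (\<lambda>r. r *\<^sub>R ax). \<Union>y\<in>X. {x + y})"
      by (intro closed_compact_sums)
    also have "(\<Union>x\<in>range (\<lambda>r. r *\<^sub>R ax). \<Union>y\<in>X. {x + y}) = Z"
    proof (intro equalityI subsetI)
      fix z assume "z \<in> (\<Union>x\<in>range (\<lambda>r. r *\<^sub>R ax). \<Union>y\<in>X. {x + y})"
      then obtain r y where ry: "z = r *\<^sub>R ax + y" "(p y)\<^sup>2 = C" by (auto simp: X_def)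
      have "z + (- r) *\<^sub>R ax = y" by (simp add: ry)
      then show "z \<in> Z" using ry C unfolding Z_def by (metis (mono_tags, lifting) less_irrefl mem_Collect_eq zero_eq_power2)
    next
      fix z assume "z \<in> Z"
      then obtain r where r: "p (z + r *\<^sub>R ax) \<noteq> 0" by (auto simp: Z_def)
      obtain r' where r': "(p (z + r *\<^sub>R ax + r' *\<^sub>R ax))\<^sup>2 = C" using attain'[OF r] by blast
      have "z = (- (r + r')) *\<^sub>R ax + (z + r *\<^sub>R ax + r' *\<^sub>R ax)" by (simp add: algebra_simps)
      then show "z \<in> (\<Union>x\<in>range (\<lambda>r. r *\<^sub>R ax). \<Union>y\<in>X. {x + y})" using r' unfolding X_def by blast
    qed
    finally show ?thesis .
  qed
  moreover have "x0 \<in> Z" using x0 unfolding Z_def by (auto intro: exI[of _ 0])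
  ultimately have Z: "Z = UNIV" using clopen by blast
  obtain j where j: "j \<noteq> e"
  proof -
    have "\<exists>j. j \<noteq> e"
    proof (rule ccontr)
      assume "\<not> ?thesis"
      then have "(UNIV :: 'n set) = {e}" by auto
      then have "CARD('n) = card {e}" by (rule arg_cong)
      then show False using card by simp
    qed
    then show thesis using that by blast
  qed
  obtain R where R: "\<And>y. norm y \<ge> R \<Longrightarrow> \<bar>p y\<bar> < sqrt C"
    using tendsto_0_at_infinityE[OF p_tendsto, of "sqrt C"] C by auto
  define y where "y = \<bar>R\<bar> *\<^sub>R (axis j 1 :: real ^ 'n)"
  have "y \<in> Z" using Z by simp
  then obtain r where r: "p (y + r *\<^sub>R ax) \<noteq> 0" by (auto simp: Z_def)
  obtain r' where r': "(p (y + r *\<^sub>R ax + r' *\<^sub>R ax))\<^sup>2 = C" using attain'[OF r] by blast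
  let ?y = "y + r *\<^sub>R ax + r' *\<^sub>R ax"
  have "?y $ j = \<bar>R\<bar>" using j by (simp add: y_def ax_def axis_def)
  then have "norm ?y \<ge> R" using component_le_norm_cart[of ?y j] by simp
  then have "\<bar>p ?y\<bar> < sqrt C" by (rule R)
  then show False using r' by auto
qed

text \<open>The case distinction on the order k of the zero of F at 0.\<close>

theorem nonflat_profile_contradiction:
  assumes m: "m \<noteq> 0" and card: "CARD('n) \<ge> 2" and an: "real_analytic_near F 0"
    and nf: "\<not> (\<exists>\<epsilon>>0. \<forall>s. \<bar>s\<bar> < \<epsilon> \<longrightarrow> F s = 0)"
  shows False
proof -
  obtain r a where r: "r > 0" "\<And>s. \<bar>s\<bar> < r \<Longrightarrow> (\<lambda>n. a n * s ^ n) sums F s"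
    using an unfolding real_analytic_near_def real_analytic_on_def by (metis diff_zero)
  have diffs: "(\<lambda>n. diffs b n * s ^ n) sums f' s"
    if "\<And>s. \<bar>s\<bar> < r \<Longrightarrow> (\<lambda>n. b n * s ^ n) sums f s" "\<And>s. (f has_real_derivative f' s) (at s)" "\<bar>s\<bar> < r" for b f f' and s :: real
    by (rule termdiffs_sums_strong[of r b f]) (use that in auto)
  note sG = diffs[OF r(2) F_DERIV]
  note sG' = diffs[OF sG G_DERIV]
  note sG'' = diffs[OF sG' G'_DERIV]
  have "\<exists>n. a n \<noteq> 0"
  proof (rule ccontr)
    assume "\<not> ?thesis"
    then have "F s = 0" if "\<bar>s\<bar> < r" for s using r(2)[OF that] sums_unique2[OF _ sums_zero] by auto
    then show False using nf r(1) by blast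
  qed
  define k where "k = (LEAST n. a n \<noteq> 0)"
  have k: "a k \<noteq> 0" "\<And>n. n < k \<Longrightarrow> a n = 0"
    unfolding k_def using LeastI_ex[OF \<open>\<exists>n. a n \<noteq> 0\<close>] not_less_Least by auto
  have "a 0 = 0" using sums_unique2[OF r(2)[of 0] powser_sums_zero] r(1) F_0 by simp
  then have k1: "k \<ge> 1" using k(1) by (cases k) auto
  have lim: "((\<lambda>s. G s / s ^ (k - 1)) \<longlongrightarrow> real k * a k) (at 0)"
    using power_series_leading_quotient[OF r(1) sG, of "k - 1"] k k1 by (simp add: diffs_def)
  have kc: "real k * a k \<noteq> 0" using k(1) k1 by simp
  have "eventually (\<lambda>s. G s / s ^ (k - 1) \<noteq> 0) (at 0)" by (rule tendsto_imp_eventually_ne[OF lim kc])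
  then obtain \<eta> where \<eta>: "\<eta> > 0" "\<And>s. s \<noteq> 0 \<Longrightarrow> \<bar>s\<bar> < \<eta> \<Longrightarrow> G s / s ^ (k - 1) \<noteq> 0"
    unfolding eventually_at by (auto simp: dist_real_def)
  have nz: "G s \<noteq> 0" if "0 < \<bar>s\<bar>" "\<bar>s\<bar> < \<eta>" for s using \<eta>(2)[of s] that by auto
  have G0: "G 0 = a 1" using sums_unique2[OF sG[of 0] powser_sums_zero] r(1) by (simp add: diffs_def)
  have G1: "G' 0 = 2 * a 2" using sums_unique2[OF sG'[of 0] powser_sums_zero] r(1) by (simp add: diffs_def numeral_2_eq_2)
  have even: "24 * \<alpha>\<^sup>2 * G' 0 * (p x * p1 x) + (2 * \<alpha> * G 0 * p x) ^ q + (- (2 * \<alpha> * G 0 * p x)) ^ q = 0"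
    if x: "p x \<noteq> 0 \<or> G 0 \<noteq> 0" for x
  proof -
    obtain d3 where "\<And>b. b \<in> Basis \<Longrightarrow> ((\<lambda>r. dir_deriv b p1 (x + r *\<^sub>R b)) has_real_derivative d3 b) (at 0)"
      using third_derivatives_exist[OF m \<eta>(1) nz x] by blast
    then show ?thesis by (rule even_part_identity[OF m])
  qed
  consider "k = 1" | "k = 2" | "k \<ge> 3" using k1 by linarith
  then show False
  proof cases
    case 1
    then have G0nz: "G 0 \<noteq> 0" using G0 k by simp
    show False
    proof (cases "even q")
      case True
      then have e: "12 * \<alpha>\<^sup>2 * G' 0 * (p x * p1 x) = - ((2 * \<alpha> * G 0 * p x) ^ q)" for x
        using even[of x] G0nz by simp
      have "(2 * \<alpha> * G 0 * p x) ^ q \<ge> 0" for x using True by (simp add: zero_le_even_power)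
      then have s: "G' 0 * (p x * p1 x) \<le> 0" for x
      proof -
        have "12 * \<alpha>\<^sup>2 * (G' 0 * (p x * p1 x)) \<le> 0"
          using e[of x] \<open>\<And>x. (2 * \<alpha> * G 0 * p x) ^ q \<ge> 0\<close>[of x] by (simp add: mult.assoc)
        then show ?thesis using alpha_pos by (simp add: mult_le_0_iff)
      qed
      obtain x where x: "p x \<noteq> 0" using admissible by (auto simp: admissible_amplitude_def)
      have "G' 0 \<noteq> 0"
      proof
        assume "G' 0 = 0"
        then have "(2 * \<alpha> * G 0 * p x) ^ q = 0" using e[of x] by simp
        then show False using x G0nz alpha_pos by simp
      qed
      then show False
        using monotone_amplitude_contradiction s by (cases "G' 0 > 0") (auto simp: mult_le_0_iff not_less)
    next
      case False
      then have "G' 0 * (p x * p1 x) = 0" for x using even[of x] G0nz alpha_pos by simp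
      then have "G' 0 = 0" using monotone_amplitude_contradiction by (metis mult_eq_0_iff order_refl)
      from first_integral_contradiction[OF card amplitude_ode[OF m False G0nz this]] show False .
    qed
  next
    case 2
    then have "G 0 = 0" "G' 0 \<noteq> 0" using G0 G1 k by auto
    then have "p x * p1 x = 0" for x
      using even[of x] q_ge_2 alpha_pos by (cases "p x = 0") (auto simp: power_0_left)
    then have "\<forall>x. p x * p1 x \<le> 0" by (metis order_refl)
    then show False using monotone_amplitude_contradiction by blast
  next
    case 3
    let ?j = "k - 3"
    have "((\<lambda>s. G s / s ^ ?j) \<longlongrightarrow> diffs a ?j) (at 0)"
      by (rule power_series_leading_quotient[OF r(1) sG]) (use k 3 in \<open>auto simp: diffs_def\<close>)
    moreover have "diffs a ?j = 0" using k 3 by (simp add: diffs_def)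
    moreover have "((\<lambda>s. G' s / s ^ ?j) \<longlongrightarrow> diffs (diffs a) ?j) (at 0)"
      by (rule power_series_leading_quotient[OF r(1) sG']) (use k 3 in \<open>auto simp: diffs_def\<close>)
    moreover have "diffs (diffs a) ?j = 0" using k 3 by (simp add: diffs_def)
    moreover have "((\<lambda>s. G'' s / s ^ ?j) \<longlongrightarrow> diffs (diffs (diffs a)) ?j) (at 0)"
      by (rule power_series_leading_quotient[OF r(1) sG'']) (use k 3 in \<open>auto simp: diffs_def\<close>)
    moreover have "diffs (diffs (diffs a)) ?j \<noteq> 0"
    proof -
      have "Suc (Suc (Suc ?j)) = k" using 3 by simp
      then show ?thesis using k(1) by (simp add: diffs_def)
    qed
    ultimately show False using no_high_order_zero[OF m _ nz \<eta>(1), of _ ?j] by metis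
  qed
qed

end

theorem theorem1p2:
  fixes e :: "'n::finite" and q :: nat
  assumes "CARD('n) \<ge> 2" and "q \<ge> 2"
  shows "\<not> (\<exists>(u :: real \<times> (real ^ 'n) \<Rightarrow> real) F.
           breather_with_profile e q F u \<and> F 0 = 0 \<and> real_analytic_near F 0 \<and>
           (\<exists>z. u z \<noteq> 0))"
proof
  assume "\<exists>(u :: real \<times> (real ^ 'n) \<Rightarrow> real) F. breather_with_profile e q F u \<and> F 0 = 0 \<and> real_analytic_near F 0 \<and> (\<exists>z. u z \<noteq> 0)"
  then obtain u :: "real \<times> (real ^ 'n) \<Rightarrow> real" and F z where u: "breather_with_profile e q F u" and an: "real_analytic_near F 0"
    and z: "u z \<noteq> 0" by blast
  from u obtain m \<alpha> p where "breather e q F u m \<alpha> p"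
    unfolding breather_with_profile_def using assms(2) by (auto intro!: breather.intro)
  then interpret breather e q F u m \<alpha> p .
  have m: "m \<noteq> 0" using stationary_vanishes z by blast
  have "\<not> (\<exists>\<epsilon>>0. \<forall>s. \<bar>s\<bar> < \<epsilon> \<longrightarrow> F s = 0)" using flat_profile_vanishes[OF m] z by blast
  then show False by (rule nonflat_profile_contradiction[OF m assms(1) an])
qed

end
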